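(* Let $B$ be a connected building set on $[n+1]$, let $P_B$ be the corresponding nestohedron (not necessarily flag), and let $S\in B\setminus\{[n+1]\}$. Then there is a commutative diagram $$\begin{array}{ccc} \mathcal Z_{P_{B|_S}} & \xrightarrow{\ \hat\phi_S\ } & \mathcal Z_{P_B}\\ {\scriptstyle h_1}\downarrow & & \downarrow{\scriptstyle h_2}\\ \mathcal Z_{N_{B|_S}} & \xrightarrow{\ j_{S*}\ } & \mathcal Z_{N_B} \end{array}$$ in which $h_1$ and $h_2$ are homeomorphisms. In particular, $\hat\phi_S$ induces a split epimorphism in cohomology for any $S\in B\setminus\{[n+1]\}$.
   Context: **Nestohedra.** A building set on a finite nonempty set $V$ is a collection $B$ of nonempty subsets of $V$ containing all singletons and such that $S_1,S_2\in B$, $S_1\cap S_2\ne\varnothing$ imply $S_1\cup S_2\in B$; it is connected if $V\in B$. Here $V=[n+1]=\{1,\dots,n+1\}$. The nestohedron is the simple polytope $P_B=\sum_{S\in B}\operatorname{conv}(e_i\mid i\in S)\subset\mathbb R^{V}$ (Minkowski sum). For $S\in B$ put $B|_S=\{T\in B\mid T\subseteq S\}$ (a connected building set on $S$) and $B/S=\{\varnothing\ne T\subseteq V\setminus S\mid T\in B\text{ or }T\sqcup S\in B\}$. Facets of $P_B$ correspond to the elements $S\in B\setminus\{[n+1]\}$, and the facet corresponding to $S$ is combinatorially $P_{B|_S}\times P_{B/S}$. **Nested set complexes.** $N_B=K_{P_B}$ is the nerve complex of $P_B$ (simplices are sets of facets with nonempty common intersection). Its vertices are the nonmaximal elements of $B$,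 and $\{S_1,\dots,S_k\}$ is a simplex iff any two $S_p,S_q$ are disjoint or one contains the other, and no union of $l\ge2$ pairwise disjoint members belongs to $B$. $N_{B|_S}$ is the full subcomplex of $N_B$ on the vertex set $B|_S\setminus\{S\}$. **Moment-angle manifolds and complexes.** For a simple polytope $P$ with facets $F_1,\dots,F_m$ and a face $G$, let $T^G\subseteq T^m=(S^1)^m$ be the product of the coordinate circles $T_i$ with $F_i\supseteq G$. Put $\mathcal Z_P=T^m\times P/\!\sim$, where $(t_1,p)\sim(t_2,q)$ iff $p=q$ and $t_1t_2^{-1}\in T^{G(p)}$, $G(p)$ the minimal face containing $p$. For a simplicial complex $K$ on $[m]$, $\mathcal Z_K=\bigcup_{\sigma\in K}\prod_iY_i^\sigma\subseteq(D^2)^m$, with $Y_i^\sigma=D^2$ if $i\in\sigma$ and $S^1$ otherwise. **The maps.** $j_{S*}:\mathcal Z_{N_{B|_S}}\to\mathcal Z_{N_B}$ is the embedding induced by the inclusion of the full subcomplex (coordinates of vertices outside $B|_S\setminus\{S\}$ are set equal to $1$). $\hat\phi_S:\mathcal Z_{P_{B|_S}}\to\mathcal Z_{P_B}$ is the map induced by the face embedding $i:P_{B|_S}\to P_B$ obtained by identifying $P_{B|_S}$ with the face $P_{B|_S}\times\{v\}$ ($v$ a vertex of $P_{B/S}$) of the facet $P_{B|_S}\times P_{B/S}$. In general, for a face $F$ of a simple polytope $P$ with embedding $i:F\to P$, each facet of $F$ is $F\cap F_j$ for a unique facet $F_j$ of $P$; this gives an inclusion $\iota$ of coordinate tori $T^{m(F)}\to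 T^{m(P)}$ ($m(\cdot)$ = number of facets), and the induced map $\mathcal Z_F\to\mathcal Z_P$ is $[t,x]\mapsto[\iota(t),i(x)]$. *)

theory Defs
  imports
    "HOL-Analysis.Analysis"
    "HOL-Library.Set_Algebras"
    "HOL-Homology.Homology"
begin

section \<open>Building sets and nestohedra\<close>

definition building_set :: "'v set \<Rightarrow> 'v set set \<Rightarrow> bool" where
  "building_set V B \<longleftrightarrow>
     finite V \<and> V \<noteq> {} \<and> B \<subseteq> Pow V - {{}} \<and> (\<forall>x\<in>V. {x} \<in> B) \<and>
     (\<forall>S\<in>B. \<forall>T\<in>B. S \<inter> T \<noteq> {} \<longrightarrow> S \<union> T \<in> B)"

definition connected_building_set :: "'v set \<Rightarrow> 'v set set \<Rightarrow> bool" where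
  "connected_building_set V B \<longleftrightarrow> building_set V B \<and> V \<in> B"

definition bs_restrict :: "'v set set \<Rightarrow> 'v set \<Rightarrow> 'v set set" where
  "bs_restrict B S = {T \<in> B. T \<subseteq> S}"

definition bs_contract :: "'v set \<Rightarrow> 'v set set \<Rightarrow> 'v set \<Rightarrow> 'v set set" where
  "bs_contract V B S = {T. T \<noteq> {} \<and> T \<subseteq> V - S \<and> (T \<in> B \<or> T \<union> S \<in> B)}"

text \<open>
  The ground sets are subsets of a finite type, and \<open>\<real>\<^sup>V\<close> is the coordinate subspace of
  \<^typ>\<open>real ^ 'v\<close>; hence the polytopes of \<open>B\<close>, \<open>B|\<^sub>S\<close> and \<open>B/S\<close> all live in the same space.
  The sum is the Minkowski sum of sets.
\<close>

definition nestohedron :: "'v::finite set set \<Rightarrow> (real ^ 'v) set" where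
  "nestohedron B = (\<Sum>S\<in>B. convex hull ((\<lambda>i. axis i 1) ` S))"

text \<open>
  The facet \<open>F\<^sub>S\<close> of \<open>P\<^sub>B\<close> corresponding to a nonmaximal \<open>S \<in> B\<close> is the face on which
  \<open>\<Sum>i\<in>S. x\<^sub>i\<close> is minimal.  On the summand \<open>conv (e\<^sub>i | i \<in> T)\<close> this functional has minimum
  1 if \<open>T \<subseteq> S\<close> and 0 otherwise, so that its minimum on \<open>P\<^sub>B\<close> is the cardinality of \<open>B|\<^sub>S\<close>.
\<close>

definition nesto_facet :: "'v::finite set set \<Rightarrow> 'v set \<Rightarrow> (real ^ 'v) set" where
  "nesto_facet B S = {x \<in> nestohedron B. (\<Sum>i\<in>S. x $ i) = real (card (bs_restrict B S))}"


section \<open>Nerve complexes and nested set complexes\<close>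

abbreviation facets :: "'a::euclidean_space set \<Rightarrow> 'a set set" where
  "facets P \<equiv> {F. F facet_of P}"

text \<open>
  Intersecting with \<open>P\<close> only matters for the empty simplex.
\<close>

definition nerve_complex :: "'a::euclidean_space set \<Rightarrow> 'a set set set" where
  "nerve_complex P = {\<sigma>. \<sigma> \<subseteq> facets P \<and> P \<inter> \<Inter>\<sigma> \<noteq> {}}"

text \<open>
  \<open>N\<^sub>B\<close> is the nerve complex of \<open>P\<^sub>B\<close>, with the vertex \<open>F\<^sub>S\<close> written as \<open>S\<close>; the set of
  vertices is \<open>B - {V}\<close>.
\<close>

definition nested_set_complex :: "'v::finite set \<Rightarrow> 'v set set \<Rightarrow> 'v set set set" where
  "nested_set_complex V B =
     {\<sigma>. \<sigma> \<subseteq> B - {V} \<and> nesto_facet B ` \<sigma> \<in> nerve_complex (nestohedron B)}"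


section \<open>Moment-angle manifolds and moment-angle complexes\<close>

definition quotient_topology :: "'a topology \<Rightarrow> ('a \<times> 'a) set \<Rightarrow> 'a set topology" where
  "quotient_topology X r =
     topology (\<lambda>U. U \<subseteq> topspace X // r \<and> openin X {x \<in> topspace X. r `` {x} \<in> U})"

lemma openin_quotient_topology:
  "openin (quotient_topology X r) U \<longleftrightarrow>
     U \<subseteq> topspace X // r \<and> openin X {x \<in> topspace X. r `` {x} \<in> U}"
proof -
  have "istopology (\<lambda>U. U \<subseteq> topspace X // r \<and> openin X {x \<in> topspace X. r `` {x} \<in> U})"
    unfolding istopology_def
  proof (intro conjI allI impI)
    fix S T
    assume "S \<subseteq> topspace X // r \<and> openin X {x \<in> topspace X. r `` {x} \<in> S}"
      and "T \<subseteq> topspace X // r \<and> openin X {x \<in> topspace X. r `` {x} \<in> T}"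
    moreover have "{x \<in> topspace X. r `` {x} \<in> S \<inter> T} =
        {x \<in> topspace X. r `` {x} \<in> S} \<inter> {x \<in> topspace X. r `` {x} \<in> T}"
      by auto
    ultimately show "S \<inter> T \<subseteq> topspace X // r"
      and "openin X {x \<in> topspace X. r `` {x} \<in> S \<inter> T}"
      by auto
  next
    fix \<K>
    assume *: "\<forall>K\<in>\<K>. K \<subseteq> topspace X // r \<and> openin X {x \<in> topspace X. r `` {x} \<in> K}"
    have "{x \<in> topspace X. r `` {x} \<in> \<Union>\<K>} = (\<Union>K\<in>\<K>. {x \<in> topspace X. r `` {x} \<in> K})"
      by auto
    with * show "\<Union>\<K> \<subseteq> topspace X // r"
      and "openin X {x \<in> topspace X. r `` {x} \<in> \<Union>\<K>}"
      by auto
  qed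
  then show ?thesis
    by (simp add: quotient_topology_def topology_inverse')
qed

lemma topspace_quotient_topology [simp]:
  "topspace (quotient_topology X r) = topspace X // r"
proof -
  have "{x \<in> topspace X. r `` {x} \<in> topspace X // r} = topspace X"
    by (auto simp: quotient_def)
  then have "openin (quotient_topology X r) (topspace X // r)"
    by (simp add: openin_quotient_topology)
  then show ?thesis
    by (meson openin_quotient_topology openin_subset openin_topspace subset_antisym)
qed

lemma quotient_map_quotient_topology:
  "quotient_map X (quotient_topology X r) (\<lambda>x. r `` {x})"
  by (auto simp: quotient_map_def openin_quotient_topology quotient_def)

text \<open>The torus with one coordinate circle for each element of \<open>I\<close>.\<close>

definition torus :: "'i set \<Rightarrow> ('i \<Rightarrow> complex) topology" where
  "torus I = product_topology (\<lambda>_. top_of_set (sphere 0 1)) I"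

definition face_torus :: "'a::euclidean_space set \<Rightarrow> 'a set \<Rightarrow> ('a set \<Rightarrow> complex) set" where
  "face_torus P G = {t \<in> topspace (torus (facets P)). \<forall>F\<in>facets P. \<not> G \<subseteq> F \<longrightarrow> t F = 1}"

definition minimal_face :: "'a::euclidean_space set \<Rightarrow> 'a \<Rightarrow> 'a set" where
  "minimal_face P p = \<Inter>{G. G face_of P \<and> p \<in> G}"

definition ma_rel ::
  "'a::euclidean_space set \<Rightarrow> ((('a set \<Rightarrow> complex) \<times> 'a) \<times> (('a set \<Rightarrow> complex) \<times> 'a)) set"
where
  "ma_rel P = {((t, p), (u, q)).
     t \<in> topspace (torus (facets P)) \<and> u \<in> topspace (torus (facets P)) \<and> p \<in> P \<and> q \<in> P \<and>
     p = q \<and> (\<lambda>F\<in>facets P. t F * inverse (u F)) \<in> face_torus P (minimal_face P p)}"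

definition moment_angle_manifold ::
  "'a::euclidean_space set \<Rightarrow> (('a set \<Rightarrow> complex) \<times> 'a) set topology" where
  "moment_angle_manifold P =
     quotient_topology (prod_topology (torus (facets P)) (top_of_set P)) (ma_rel P)"

text \<open>\<open>K\<close> is a simplicial complex, given by its simplices, on the set \<open>W\<close> of vertices.\<close>

definition moment_angle_complex :: "'i set \<Rightarrow> 'i set set \<Rightarrow> ('i \<Rightarrow> complex) topology" where
  "moment_angle_complex W K =
     subtopology (product_topology (\<lambda>_. top_of_set (cball 0 1)) W)
       (\<Union>\<sigma>\<in>K. \<Pi>\<^sub>E i\<in>W. if i \<in> \<sigma> then cball 0 1 else sphere 0 1)"


section \<open>The maps of the diagram\<close>

text \<open>
  Here \<open>i\<close> identifies the polytope \<open>Q\<close> with a face of the simple polytope \<open>P\<close>.  A facet \<open>F\<close>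
  of \<open>Q\<close> is the intersection of that face with a unique facet of \<open>P\<close>, and this defines the
  inclusion of coordinate tori.
\<close>

definition ambient_facet ::
  "'a::euclidean_space set \<Rightarrow> 'b::euclidean_space set \<Rightarrow> ('a \<Rightarrow> 'b) \<Rightarrow> 'a set \<Rightarrow> 'b set" where
  "ambient_facet Q P i F = (THE F'. F' facet_of P \<and> i ` F = i ` Q \<inter> F')"

definition torus_inclusion ::
  "'a::euclidean_space set \<Rightarrow> 'b::euclidean_space set \<Rightarrow> ('a \<Rightarrow> 'b) \<Rightarrow>
     ('a set \<Rightarrow> complex) \<Rightarrow> ('b set \<Rightarrow> complex)" where
  "torus_inclusion Q P i t =
     (\<lambda>F'\<in>facets P. if F' \<in> ambient_facet Q P i ` facets Q
                    then t (inv_into (facets Q) (ambient_facet Q P i) F') else 1)"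

text \<open>
  The map \<open>[t, x] \<mapsto> [\<iota> t, i x]\<close>: the class \<open>c\<close> is sent to the union of the classes of all
  \<open>(\<iota> t, i x)\<close> with \<open>(t, x) \<in> c\<close>, which is a single class because \<open>(t, x) \<mapsto> (\<iota> t, i x)\<close>
  respects the equivalence relations.
\<close>

definition induced_ma_map ::
  "'a::euclidean_space set \<Rightarrow> 'b::euclidean_space set \<Rightarrow> ('a \<Rightarrow> 'b) \<Rightarrow>
     (('a set \<Rightarrow> complex) \<times> 'a) set \<Rightarrow> (('b set \<Rightarrow> complex) \<times> 'b) set" where
  "induced_ma_map Q P i c = ma_rel P `` ((\<lambda>(t, x). (torus_inclusion Q P i t, i x)) ` c)"

text \<open>
  Under the combinatorial equivalence of the facet \<open>F\<^sub>S\<close> with \<open>P\<^bsub>B|S\<^esub> \<times> P\<^bsub>B/S\<^esub>\<close>, the facet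
  \<open>F\<^sub>T \<times> P\<^bsub>B/S\<^esub>\<close> of the product corresponds to \<open>F\<^sub>S \<inter> F\<^sub>T\<close>, and the facet \<open>P\<^bsub>B|S\<^esub> \<times> F\<^sub>U\<close>
  corresponds to \<open>F\<^sub>S \<inter> F\<^sub>W\<close>, where \<open>W\<close> is \<open>U \<union> S\<close> if this belongs to \<open>B\<close> and \<open>U\<close> otherwise
  (if both belong to \<open>B\<close>, then \<open>F\<^sub>S\<close> and \<open>F\<^sub>U\<close> are disjoint).  Hence the face
  \<open>P\<^bsub>B|S\<^esub> \<times> {v}\<close>, for \<open>v\<close> a vertex of \<open>P\<^bsub>B/S\<^esub>\<close>, is the following face of \<open>P\<^sub>B\<close>.
\<close>

definition product_face ::
  "'v::finite set \<Rightarrow> 'v set set \<Rightarrow> 'v set \<Rightarrow> real ^ 'v \<Rightarrow> (real ^ 'v) set" where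
  "product_face V B S v = nesto_facet B S \<inter>
     (\<Inter>U \<in> {U \<in> bs_contract V B S - {V - S}. v \<in> nesto_facet (bs_contract V B S) U}.
        nesto_facet B (if U \<union> S \<in> B then U \<union> S else U))"

text \<open>
  An identification of \<open>P\<^bsub>B|S\<^esub>\<close> with \<open>P\<^bsub>B|S\<^esub> \<times> {v}\<close> is a homeomorphism that carries every
  facet \<open>F\<^sub>T\<close> to the facet \<open>F\<^sub>T \<times> {v}\<close>.  The face is in fact a translate of \<open>P\<^bsub>B|S\<^esub>\<close>, since
  \<open>F\<^sub>S\<close> is the Minkowski sum of \<open>P\<^bsub>B|S\<^esub>\<close> and the simplices \<open>conv (e\<^sub>i | i \<in> T - S)\<close> for
  \<open>T \<in> B\<close> with \<open>\<not> T \<subseteq> S\<close>; so one such identification is a translation.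
\<close>

definition face_identification ::
  "'v::finite set \<Rightarrow> 'v set set \<Rightarrow> 'v set \<Rightarrow> real ^ 'v \<Rightarrow> (real ^ 'v \<Rightarrow> real ^ 'v) \<Rightarrow> bool" where
  "face_identification V B S v i \<longleftrightarrow>
     (\<exists>g. homeomorphism (nestohedron (bs_restrict B S)) (product_face V B S v) i g) \<and>
     (\<forall>T\<in>bs_restrict B S - {S}.
        i ` nesto_facet (bs_restrict B S) T = product_face V B S v \<inter> nesto_facet B T)"

text \<open>The embedding induced by the inclusion of a full subcomplex with vertex set \<open>W \<subseteq> W'\<close>.\<close>

definition full_subcomplex_map :: "'i set \<Rightarrow> 'i set \<Rightarrow> ('i \<Rightarrow> complex) \<Rightarrow> ('i \<Rightarrow> complex)" where
  "full_subcomplex_map W W' z = (\<lambda>T\<in>W'. if T \<in> W then z T else 1)"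


section \<open>Singular cohomology rings\<close>

text \<open>
  Singular cochains with coefficients in a commutative ring, as functions on the singular
  simplices, that is, on the basis of the singular chain group.
\<close>

type_synonym ('a, 'k) cochain = "((nat \<Rightarrow> real) \<Rightarrow> 'a) \<Rightarrow> 'k"

definition singular_cochain :: "nat \<Rightarrow> 'a topology \<Rightarrow> ('a, 'k::comm_ring_1) cochain \<Rightarrow> bool" where
  "singular_cochain p X c \<longleftrightarrow> (\<forall>\<sigma>. \<not> singular_simplex p X \<sigma> \<longrightarrow> c \<sigma> = 0)"

definition cochain_coboundary ::
  "nat \<Rightarrow> 'a topology \<Rightarrow> ('a, 'k::comm_ring_1) cochain \<Rightarrow> ('a, 'k) cochain" where
  "cochain_coboundary p X c =
     (\<lambda>\<sigma>. if singular_simplex (Suc p) X \<sigma>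
          then (\<Sum>k\<le>Suc p. (-1) ^ k * c (singular_face (Suc p) k \<sigma>)) else 0)"

definition cocycle_group ::
  "nat \<Rightarrow> 'a topology \<Rightarrow> ('a, 'k::comm_ring_1) cochain monoid" where
  "cocycle_group p X =
     \<lparr>carrier = {c. singular_cochain p X c \<and> cochain_coboundary p X c = (\<lambda>_. 0)},
      mult = (\<lambda>a b \<sigma>. a \<sigma> + b \<sigma>), one = (\<lambda>_. 0)\<rparr>"

definition coboundary_set ::
  "nat \<Rightarrow> 'a topology \<Rightarrow> ('a, 'k::comm_ring_1) cochain set" where
  "coboundary_set p X =
     (case p of 0 \<Rightarrow> {\<lambda>_. 0} | Suc q \<Rightarrow> cochain_coboundary q X ` {c. singular_cochain q X c})"

definition cohomology_group ::
  "nat \<Rightarrow> 'a topology \<Rightarrow> ('a, 'k::comm_ring_1) cochain set monoid" where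
  "cohomology_group p X = cocycle_group p X Mod coboundary_set p X"

definition cohomology_class ::
  "nat \<Rightarrow> 'a topology \<Rightarrow> ('a, 'k::comm_ring_1) cochain \<Rightarrow> ('a, 'k) cochain set" where
  "cohomology_class p X c = coboundary_set p X #>\<^bsub>cocycle_group p X\<^esub> c"

text \<open>
  Operations on cohomology classes are unions over representatives of the resulting classes;
  each such union is a single class by the usual well-definedness.

  In the cup product, the front \<open>p\<close>-face of a \<open>(p + q)\<close>-simplex is a plain restriction because
  \<^term>\<open>standard_simplex p\<close> consists of sequences vanishing beyond \<open>p\<close>; the back \<open>q\<close>-face shifts
  coordinates by \<open>p\<close>.
\<close>

definition cochain_cup ::
  "nat \<Rightarrow> nat \<Rightarrow> 'a topology \<Rightarrow> ('a, 'k::comm_ring_1) cochain \<Rightarrow> ('a, 'k) cochain \<Rightarrow>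
     ('a, 'k) cochain" where
  "cochain_cup p q X a b =
     (\<lambda>\<sigma>. if singular_simplex (p + q) X \<sigma>
          then a (restrict \<sigma> (standard_simplex p)) *
               b (\<lambda>x\<in>standard_simplex q. \<sigma> (\<lambda>i. if i < p then 0 else x (i - p)))
          else 0)"

definition cup_product ::
  "nat \<Rightarrow> nat \<Rightarrow> 'a topology \<Rightarrow> ('a, 'k::comm_ring_1) cochain set \<Rightarrow> ('a, 'k) cochain set \<Rightarrow>
     ('a, 'k) cochain set" where
  "cup_product p q X \<alpha> \<beta> = (\<Union>a\<in>\<alpha>. \<Union>b\<in>\<beta>. cohomology_class (p + q) X (cochain_cup p q X a b))"

definition cohomology_unit :: "'a topology \<Rightarrow> ('a, 'k::comm_ring_1) cochain set" where
  "cohomology_unit X = cohomology_class 0 X (\<lambda>\<sigma>. if singular_simplex 0 X \<sigma> then 1 else 0)"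

definition cohomology_scale ::
  "nat \<Rightarrow> 'a topology \<Rightarrow> 'k::comm_ring_1 \<Rightarrow> ('a, 'k) cochain set \<Rightarrow> ('a, 'k) cochain set" where
  "cohomology_scale p X r \<alpha> = (\<Union>a\<in>\<alpha>. cohomology_class p X (\<lambda>\<sigma>. r * a \<sigma>))"

definition cochain_pullback ::
  "nat \<Rightarrow> 'a topology \<Rightarrow> ('a \<Rightarrow> 'b) \<Rightarrow> ('b, 'k::comm_ring_1) cochain \<Rightarrow> ('a, 'k) cochain" where
  "cochain_pullback p X f c = (\<lambda>\<sigma>. if singular_simplex p X \<sigma> then c (simplex_map p f \<sigma>) else 0)"

definition cohomology_induced ::
  "'a topology \<Rightarrow> ('a \<Rightarrow> 'b) \<Rightarrow> nat \<Rightarrow> ('b, 'k::comm_ring_1) cochain set \<Rightarrow>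
     ('a, 'k) cochain set" where
  "cohomology_induced X f p \<alpha> = (\<Union>c\<in>\<alpha>. cohomology_class p X (cochain_pullback p X f c))"

text \<open>Homomorphisms \<open>H\<^sup>*(Y; k) \<rightarrow> H\<^sup>*(X; k)\<close> of graded \<open>k\<close>-algebras, given degreewise.\<close>

definition cohomology_ring_hom ::
  "'b topology \<Rightarrow> 'a topology \<Rightarrow>
     (nat \<Rightarrow> ('b, 'k::comm_ring_1) cochain set \<Rightarrow> ('a, 'k) cochain set) \<Rightarrow> bool" where
  "cohomology_ring_hom Y X h \<longleftrightarrow>
     (\<forall>p. h p \<in> hom (cohomology_group p Y) (cohomology_group p X)) \<and>
     (\<forall>p r. \<forall>\<alpha>\<in>carrier (cohomology_group p Y).
        h p (cohomology_scale p Y r \<alpha>) = cohomology_scale p X r (h p \<alpha>)) \<and>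
     (\<forall>p q. \<forall>\<alpha>\<in>carrier (cohomology_group p Y). \<forall>\<beta>\<in>carrier (cohomology_group q Y).
        h (p + q) (cup_product p q Y \<alpha> \<beta>) = cup_product p q X (h p \<alpha>) (h q \<beta>)) \<and>
     h 0 (cohomology_unit Y) = cohomology_unit X"

text \<open>
  The map \<open>f: X \<rightarrow> Y\<close> induces a split epimorphism \<open>H\<^sup>*(Y; k) \<rightarrow> H\<^sup>*(X; k)\<close>, in the category of
  graded \<open>k\<close>-algebras.
\<close>

definition induces_split_epi_cohomology ::
  "'k::comm_ring_1 itself \<Rightarrow> 'a topology \<Rightarrow> 'b topology \<Rightarrow> ('a \<Rightarrow> 'b) \<Rightarrow> bool" where
  "induces_split_epi_cohomology _ X Y f \<longleftrightarrow>
     cohomology_ring_hom Y X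
       (cohomology_induced X f :: nat \<Rightarrow> ('b, 'k) cochain set \<Rightarrow> ('a, 'k) cochain set) \<and>
     (\<exists>s. cohomology_ring_hom X Y s \<and>
          (\<forall>p. \<forall>\<alpha>\<in>carrier (cohomology_group p X :: ('a, 'k) cochain set monoid).
             cohomology_induced X f p (s p \<alpha>) = \<alpha>))"

end

theory Submission
  imports Defs
begin

text \<open>
  A point of the cubical complex of the nested set complex has homogeneous coordinates
  \<open>y\<^sub>T \<in> [0, 1]\<close>, and the moment map of the toric variety of \<open>P\<^sub>B\<close>, composed with a
  translation \<open>\<beta>\<close> of the dense torus, sends it to a point of \<open>P\<^sub>B\<close> lying on \<open>F\<^sub>T\<close> iff
  \<open>y\<^sub>T = 0\<close>.  This is a homeomorphism, because the moment map is the gradient of a convex function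
  and its value determines all barycentric coordinates of the Minkowski summands.  Adding the
  phases gives a homeomorphism \<open>h\<^sub>\<beta>\<close> from the moment-angle manifold to the moment-angle
  complex for every \<open>\<beta>\<close>.

  Let \<open>\<sigma>\<close> be the nested set of the face \<open>P\<^bsub>B|S\<^esub> \<times> {v}\<close>.  Under \<open>h\<^sub>\<beta>\<close> the image of the
  induced map is the locus where the coordinates in \<open>\<sigma>\<close> are \<open>0\<close>, while the image of
  \<open>j\<close> is the locus where they are \<open>1\<close>, on the boundary of the discs.  Take
  \<open>\<beta>\<close> such that \<open>h\<^sub>\<beta>\<^sup>-\<^sup>1\<close> at a point with coordinates \<open>1/2\<close> on \<open>\<sigma>\<close> agrees with \<open>h\<^sub>1\<^sup>-\<^sup>1\<close>
  (trivial \<open>\<beta>\<close>) at the point with these coordinates doubled, and let \<open>D\<close> move \<open>0\<close> to \<open>1/2\<close> in the discs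
  of \<open>\<sigma>\<close>, fixing their boundaries.  Then \<open>h\<^sub>1 \<circ> h\<^sub>\<beta>\<^sup>-\<^sup>1 \<circ> D \<circ> h\<^sub>\<beta>\<close> carries the first
  locus to the second one.  The cohomology statement follows since restriction of coordinates is
  a retraction onto a full subcomplex.
\<close>

section \<open>Induced homomorphisms of singular cohomology rings\<close>

text \<open>No homeomorphism of the disc takes its centre to a boundary point, so the two loci
  cannot be matched by moving disc coordinates in a single chart. The chart on the polytope is
  therefore changed as well. A barycentric coordinate depends only on the products of \<beta> i with
  all y_R such that i is in R, up to a common factor. Hence doubling the y_T with T in \<sigma>,
  where the doubled values stay in [0, 1], has the same effect as multiplying the weight of i by 2
  for each T in \<sigma> that contains i. A coordinate that is 1/2 in one chart is then 1 in
  another: interior points become boundary points without the disc being deformed. The number 1/2 is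
  a choice; a value strictly between 0 and 1 and its inverse would serve equally well.

  The left vertical map does not come from a moment map of the smaller nestohedron. Its coordinates
  are those of the face, pulled back along the given identification. This makes the square commute
  exactly, for each admissible identification and not just for a translation.\<close>

lemma singular_face_simplex_map_commute:
  assumes "k \<le> Suc p"
  shows "singular_face (Suc p) k (simplex_map (Suc p) f \<sigma>) = simplex_map p f (singular_face (Suc p) k \<sigma>)"
proof
  fix x
  show "singular_face (Suc p) k (simplex_map (Suc p) f \<sigma>) x = simplex_map p f (singular_face (Suc p) k \<sigma>) x"
    using simplical_face_in_standard_simplex[of "Suc p" k x] assms
    by (cases "x \<in> standard_simplex p") (auto simp: singular_face_def simplex_map_def)
qed

text \<open>Dual to the identity of coface maps: inserting a zero at position i and then at
  \<open>Suc j\<close> is the same as inserting it at j and then at i.\<close>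

lemma singular_face_singular_face:
  assumes "i \<le> j" "j \<le> Suc p"
  shows "singular_face (Suc p) i (singular_face (Suc (Suc p)) (Suc j) \<sigma>) =
    singular_face (Suc p) j (singular_face (Suc (Suc p)) i \<sigma>)"
proof
  fix t
  show "singular_face (Suc p) i (singular_face (Suc (Suc p)) (Suc j) \<sigma>) t =
    singular_face (Suc p) j (singular_face (Suc (Suc p)) i \<sigma>) t"
  proof (cases "t \<in> standard_simplex p")
    case True
    have "simplical_face i t \<in> standard_simplex (Suc p)" "simplical_face j t \<in> standard_simplex (Suc p)"
      using simplical_face_in_standard_simplex[of "Suc p" _ t] True assms by auto
    moreover have "simplical_face (Suc j) (simplical_face i t) = simplical_face i (simplical_face j t)"
      using assms(1) by (auto simp: simplical_face_def fun_eq_iff)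
    ultimately show ?thesis using True by (simp add: singular_face_def)
  qed (simp add: singular_face_def)
qed

text \<open>The combinatorial core of d d = 0. The terms with y < x cancel those with x \<le> y
  under (x, y) \<mapsto> (y, x - 1), which changes the parity of x + y.\<close>

lemma alternating_double_sum_zero:
  fixes F :: "nat \<Rightarrow> nat \<Rightarrow> 'k::comm_ring_1"
  assumes F: "\<And>i j. i \<le> j \<Longrightarrow> j \<le> n \<Longrightarrow> F (Suc j) i = F i j"
  shows "(\<Sum>x\<le>Suc n. (-1) ^ x * (\<Sum>y\<le>n. (-1) ^ y * F x y)) = 0"
proof -
  let ?g = "\<lambda>(x, y). (-1) ^ (x + y) * F x y"
  let ?A = "{(x, y). y < x \<and> x \<le> Suc n}" and ?B = "{(x, y). x \<le> y \<and> y \<le> n}"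
  have fin: "finite ?A" "finite ?B"
    by (rule finite_subset[of _ "{..Suc n} \<times> {..Suc n}"]; auto)+
  have "(\<Sum>x\<le>Suc n. (-1) ^ x * (\<Sum>y\<le>n. (-1) ^ y * F x y)) = (\<Sum>z\<in>{..Suc n} \<times> {..n}. ?g z)"
    by (simp add: sum.cartesian_product[symmetric] sum_distrib_left power_add mult.assoc del: sum.atMost_Suc)
  also have "{..Suc n} \<times> {..n} = ?A \<union> ?B" by auto
  also have "(\<Sum>z\<in>?A \<union> ?B. ?g z) = (\<Sum>z\<in>?A. ?g z) + (\<Sum>z\<in>?B. ?g z)"
    by (rule sum.union_disjoint[OF fin]) auto
  also have "(\<Sum>z\<in>?A. ?g z) = (\<Sum>z\<in>?B. - ?g z)"
  proof (rule sum.reindex_bij_witness[of _ "\<lambda>(i, j). (Suc j, i)" "\<lambda>(x, y). (y, x - 1)"])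
    fix z assume "z \<in> ?A"
    then obtain x y where "z = (Suc x, y)" "y \<le> x" "x \<le> n"
      by (cases z) (auto simp: less_Suc_eq_le elim: less_natE)
    then show "- ?g (case z of (x, y) \<Rightarrow> (y, x - 1)) = ?g z" by (simp add: F add.commute)
  qed auto
  finally show ?thesis by (simp add: sum_negf)
qed

lemma cochain_coboundary_coboundary:
  "cochain_coboundary (Suc p) X (cochain_coboundary p X c) = (\<lambda>_. 0)"
proof
  fix \<sigma>
  show "cochain_coboundary (Suc p) X (cochain_coboundary p X c) \<sigma> = 0"
  proof (cases "singular_simplex (Suc (Suc p)) X \<sigma>")
    case True
    have "singular_simplex (Suc p) X (singular_face (Suc (Suc p)) x \<sigma>)" if "x \<le> Suc (Suc p)" for x
      using singular_simplex_singular_face[OF True _ that] by simp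
    then have "cochain_coboundary (Suc p) X (cochain_coboundary p X c) \<sigma> =
        (\<Sum>x\<le>Suc (Suc p). (-1) ^ x * (\<Sum>y\<le>Suc p. (-1) ^ y *
          c (singular_face (Suc p) y (singular_face (Suc (Suc p)) x \<sigma>))))"
      using True by (simp add: cochain_coboundary_def del: sum.atMost_Suc)
    also have "\<dots> = 0"
      by (rule alternating_double_sum_zero) (simp add: singular_face_singular_face)
    finally show ?thesis .
  qed (simp add: cochain_coboundary_def)
qed

section \<open>Coboundaries and cohomology classes\<close>

lemma cochain_coboundary_add:
  "cochain_coboundary p X (\<lambda>\<sigma>. a \<sigma> + b \<sigma>) = (\<lambda>\<sigma>. cochain_coboundary p X a \<sigma> + cochain_coboundary p X b \<sigma>)"
  by (auto simp: cochain_coboundary_def fun_eq_iff sum.distrib distrib_left simp del: sum.atMost_Suc)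

lemma cochain_coboundary_scale:
  "cochain_coboundary p X (\<lambda>\<sigma>. r * a \<sigma>) = (\<lambda>\<sigma>. r * cochain_coboundary p X a \<sigma>)"
  by (auto simp: cochain_coboundary_def fun_eq_iff sum_distrib_left mult.left_commute simp del: sum.atMost_Suc)

lemma singular_cochain_coboundary: "singular_cochain (Suc p) X (cochain_coboundary p X c)"
  by (simp add: singular_cochain_def cochain_coboundary_def)

lemma zero_in_coboundary_set: "(\<lambda>_. 0) \<in> coboundary_set p X"
proof (cases p)
  case (Suc q)
  have "(\<lambda>_. 0) = cochain_coboundary q X (\<lambda>_. 0)" by (auto simp: cochain_coboundary_def)
  then show ?thesis by (auto simp: coboundary_set_def Suc singular_cochain_def)
qed (simp add: coboundary_set_def)

lemma coboundary_set_add: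
  assumes "a \<in> coboundary_set p X" "b \<in> coboundary_set p X"
  shows "(\<lambda>\<sigma>. a \<sigma> + b \<sigma>) \<in> coboundary_set p X"
proof (cases p)
  case (Suc q)
  then obtain c d where "singular_cochain q X c" "singular_cochain q X d"
      "a = cochain_coboundary q X c" "b = cochain_coboundary q X d"
    using assms by (auto simp: coboundary_set_def)
  then have "(\<lambda>\<sigma>. a \<sigma> + b \<sigma>) = cochain_coboundary q X (\<lambda>\<sigma>. c \<sigma> + d \<sigma>)" "singular_cochain q X (\<lambda>\<sigma>. c \<sigma> + d \<sigma>)"
    by (auto simp: cochain_coboundary_add singular_cochain_def)
  then show ?thesis by (auto simp: coboundary_set_def Suc)
qed (use assms in \<open>simp add: coboundary_set_def\<close>)

lemma coboundary_set_scale: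
  assumes "a \<in> coboundary_set p X"
  shows "(\<lambda>\<sigma>. r * a \<sigma>) \<in> coboundary_set p X"
proof (cases p)
  case (Suc q)
  then obtain c where "singular_cochain q X c" "a = cochain_coboundary q X c"
    using assms by (auto simp: coboundary_set_def)
  then have "(\<lambda>\<sigma>. r * a \<sigma>) = cochain_coboundary q X (\<lambda>\<sigma>. r * c \<sigma>)" "singular_cochain q X (\<lambda>\<sigma>. r * c \<sigma>)"
    by (auto simp: cochain_coboundary_scale singular_cochain_def)
  then show ?thesis by (auto simp: coboundary_set_def Suc)
qed (use assms in \<open>simp add: coboundary_set_def\<close>)

lemma coboundary_set_minus:
  "a \<in> coboundary_set p X \<Longrightarrow> (\<lambda>\<sigma>. - a \<sigma>) \<in> coboundary_set p X"
  using coboundary_set_scale[of a p X "-1"] by simp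

lemma coboundary_set_cocycle:
  assumes "a \<in> coboundary_set p X"
  shows "singular_cochain p X a" "cochain_coboundary p X a = (\<lambda>_. 0)"
proof -
  have "singular_cochain p X a \<and> cochain_coboundary p X a = (\<lambda>_. 0)"
  proof (cases p)
    case 0
    then show ?thesis using assms
      by (auto simp: coboundary_set_def singular_cochain_def cochain_coboundary_def)
  next
    case (Suc q)
    then obtain c where "a = cochain_coboundary q X c" using assms by (auto simp: coboundary_set_def)
    then show ?thesis by (simp add: Suc cochain_coboundary_coboundary singular_cochain_coboundary)
  qed
  then show "singular_cochain p X a" "cochain_coboundary p X a = (\<lambda>_. 0)" by auto
qed

text \<open>Allows cosets to be handled by subtraction of functions, so that
  \<open>cocycle_group\<close> is not first shown to be a group.\<close>

lemma mem_cohomology_class_iff: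
  "x \<in> cohomology_class p X c \<longleftrightarrow> (\<lambda>\<sigma>. x \<sigma> - c \<sigma>) \<in> coboundary_set p X"
proof -
  have "x \<in> cohomology_class p X c \<longleftrightarrow> (\<exists>b\<in>coboundary_set p X. x = (\<lambda>\<sigma>. b \<sigma> + c \<sigma>))"
    by (simp add: cohomology_class_def r_coset_def cocycle_group_def)
  also have "\<dots> \<longleftrightarrow> (\<lambda>\<sigma>. x \<sigma> - c \<sigma>) \<in> coboundary_set p X"
  proof
    assume "(\<lambda>\<sigma>. x \<sigma> - c \<sigma>) \<in> coboundary_set p X"
    then show "\<exists>b\<in>coboundary_set p X. x = (\<lambda>\<sigma>. b \<sigma> + c \<sigma>)" by (rule bexI[rotated]) simp
  qed auto
  finally show ?thesis .
qed

lemma cohomology_class_self: "c \<in> cohomology_class p X c"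
  by (simp add: mem_cohomology_class_iff zero_in_coboundary_set)

lemma cohomology_class_eqI:
  assumes "(\<lambda>\<sigma>. a \<sigma> - b \<sigma>) \<in> coboundary_set p X"
  shows "cohomology_class p X a = cohomology_class p X b"
proof (rule Set.set_eqI)
  fix x
  have "(\<lambda>\<sigma>. x \<sigma> - b \<sigma>) \<in> coboundary_set p X" if "(\<lambda>\<sigma>. x \<sigma> - a \<sigma>) \<in> coboundary_set p X"
    using coboundary_set_add[OF that assms] by simp
  moreover have "(\<lambda>\<sigma>. x \<sigma> - a \<sigma>) \<in> coboundary_set p X" if "(\<lambda>\<sigma>. x \<sigma> - b \<sigma>) \<in> coboundary_set p X"
    using coboundary_set_add[OF that coboundary_set_minus[OF assms]] by simp
  ultimately show "x \<in> cohomology_class p X a \<longleftrightarrow> x \<in> cohomology_class p X b"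
    unfolding mem_cohomology_class_iff by blast
qed

lemma carrier_cohomology_group:
  "carrier (cohomology_group p X) =
    cohomology_class p X ` {c. singular_cochain p X c \<and> cochain_coboundary p X c = (\<lambda>_. 0)}"
  by (auto simp: cohomology_group_def FactGroup_def RCOSETS_def cohomology_class_def cocycle_group_def)

lemma mult_cohomology_group:
  "cohomology_class p X a \<otimes>\<^bsub>cohomology_group p X\<^esub> cohomology_class p X b =
    cohomology_class p X (\<lambda>\<sigma>. a \<sigma> + b \<sigma>)"
proof -
  have "cohomology_class p X a \<otimes>\<^bsub>cohomology_group p X\<^esub> cohomology_class p X b =
      {(\<lambda>\<sigma>. x \<sigma> + y \<sigma>) | x y. x \<in> cohomology_class p X a \<and> y \<in> cohomology_class p X b}"
    by (auto simp: cohomology_group_def FactGroup_def set_mult_def cocycle_group_def)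
  also have "\<dots> = cohomology_class p X (\<lambda>\<sigma>. a \<sigma> + b \<sigma>)"
  proof (rule equalityI; rule subsetI)
    fix z assume "z \<in> {(\<lambda>\<sigma>. x \<sigma> + y \<sigma>) | x y. x \<in> cohomology_class p X a \<and> y \<in> cohomology_class p X b}"
    then obtain x y where xy: "z = (\<lambda>\<sigma>. x \<sigma> + y \<sigma>)" "(\<lambda>\<sigma>. x \<sigma> - a \<sigma>) \<in> coboundary_set p X"
        "(\<lambda>\<sigma>. y \<sigma> - b \<sigma>) \<in> coboundary_set p X"
      by (auto simp: mem_cohomology_class_iff)
    then show "z \<in> cohomology_class p X (\<lambda>\<sigma>. a \<sigma> + b \<sigma>)"
      using coboundary_set_add[OF xy(2,3)] by (simp add: mem_cohomology_class_iff algebra_simps)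
  next
    fix z assume "z \<in> cohomology_class p X (\<lambda>\<sigma>. a \<sigma> + b \<sigma>)"
    then have "(\<lambda>\<sigma>. z \<sigma> - b \<sigma>) \<in> cohomology_class p X a"
      by (simp add: mem_cohomology_class_iff algebra_simps)
    then show "z \<in> {(\<lambda>\<sigma>. x \<sigma> + y \<sigma>) | x y. x \<in> cohomology_class p X a \<and> y \<in> cohomology_class p X b}"
      using cohomology_class_self[of b p X] by (intro CollectI exI[of _ "\<lambda>\<sigma>. z \<sigma> - b \<sigma>"] exI[of _ b]) simp
  qed
  finally show ?thesis .
qed

section \<open>Pullbacks and scalar multiples of classes\<close>

lemma cochain_pullback_coboundary:
  assumes f: "continuous_map X Y f"
  shows "cochain_pullback (Suc p) X f (cochain_coboundary p Y c) = cochain_coboundary p X (cochain_pullback p X f c)"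
proof
  fix \<sigma>
  show "cochain_pullback (Suc p) X f (cochain_coboundary p Y c) \<sigma> = cochain_coboundary p X (cochain_pullback p X f c) \<sigma>"
  proof (cases "singular_simplex (Suc p) X \<sigma>")
    case True
    have "singular_simplex p X (singular_face (Suc p) k \<sigma>)" if "k \<le> Suc p" for k
      using singular_simplex_singular_face[OF True _ that] by simp
    then show ?thesis
      using True singular_simplex_simplex_map[OF True f]
      by (simp add: cochain_pullback_def cochain_coboundary_def singular_face_simplex_map_commute del: sum.atMost_Suc)
  qed (simp add: cochain_pullback_def cochain_coboundary_def)
qed

lemma singular_cochain_pullback: "singular_cochain p X (cochain_pullback p X f c)"
  by (simp add: singular_cochain_def cochain_pullback_def)

lemma cochain_pullback_in_coboundary_set:
  assumes f: "continuous_map X Y f" and c: "c \<in> coboundary_set p Y"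
  shows "cochain_pullback p X f c \<in> coboundary_set p X"
proof (cases p)
  case 0
  then have "c = (\<lambda>_. 0)" using c by (simp add: coboundary_set_def)
  then have "cochain_pullback p X f c = (\<lambda>_. 0)" by (auto simp: cochain_pullback_def)
  then show ?thesis by (simp add: zero_in_coboundary_set)
next
  case (Suc q)
  then obtain d where "c = cochain_coboundary q Y d" using c by (auto simp: coboundary_set_def)
  then show ?thesis
    by (auto simp: Suc cochain_pullback_coboundary[OF f] coboundary_set_def singular_cochain_pullback)
qed

lemma cochain_pullback_cocycle:
  assumes f: "continuous_map X Y f" and c: "cochain_coboundary p Y c = (\<lambda>_. 0)"
  shows "cochain_coboundary p X (cochain_pullback p X f c) = (\<lambda>_. 0)"
  unfolding cochain_pullback_coboundary[OF f, symmetric] c by (auto simp: cochain_pullback_def)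

text \<open>The union in the definition collapses: representatives differ by a coboundary, and the
  pullback of a coboundary is a coboundary.\<close>

lemma cohomology_induced_class:
  assumes f: "continuous_map X Y f"
  shows "cohomology_induced X f p (cohomology_class p Y c) = cohomology_class p X (cochain_pullback p X f c)"
  unfolding cohomology_induced_def
proof (rule SUP_eq_const)
  show "cohomology_class p Y c \<noteq> {}" using cohomology_class_self by blast
  fix d assume "d \<in> cohomology_class p Y c"
  then have "cochain_pullback p X f (\<lambda>\<sigma>. d \<sigma> - c \<sigma>) \<in> coboundary_set p X"
    unfolding mem_cohomology_class_iff by (rule cochain_pullback_in_coboundary_set[OF f])
  moreover have "cochain_pullback p X f (\<lambda>\<sigma>. d \<sigma> - c \<sigma>) =
      (\<lambda>\<sigma>. cochain_pullback p X f d \<sigma> - cochain_pullback p X f c \<sigma>)"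
    by (auto simp: cochain_pullback_def)
  ultimately show "cohomology_class p X (cochain_pullback p X f d) = cohomology_class p X (cochain_pullback p X f c)"
    by (simp add: cohomology_class_eqI)
qed

lemma cohomology_scale_class:
  "cohomology_scale p X r (cohomology_class p X c) = cohomology_class p X (\<lambda>\<sigma>. r * c \<sigma>)"
  unfolding cohomology_scale_def
proof (rule SUP_eq_const)
  show "cohomology_class p X c \<noteq> {}" using cohomology_class_self by blast
  fix d assume "d \<in> cohomology_class p X c"
  then have "(\<lambda>\<sigma>. r * (d \<sigma> - c \<sigma>)) \<in> coboundary_set p X"
    unfolding mem_cohomology_class_iff by (rule coboundary_set_scale)
  then show "cohomology_class p X (\<lambda>\<sigma>. r * d \<sigma>) = cohomology_class p X (\<lambda>\<sigma>. r * c \<sigma>)"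
    by (intro cohomology_class_eqI) (simp add: right_diff_distrib)
qed

section \<open>Front and back faces and the cup product\<close>

definition shift_simplex :: "nat \<Rightarrow> (nat \<Rightarrow> real) \<Rightarrow> nat \<Rightarrow> real" where
  "shift_simplex p x = (\<lambda>i. if i < p then 0 else x (i - p))"

definition front_face :: "nat \<Rightarrow> ((nat \<Rightarrow> real) \<Rightarrow> 'a) \<Rightarrow> (nat \<Rightarrow> real) \<Rightarrow> 'a" where
  "front_face p \<sigma> = restrict \<sigma> (standard_simplex p)"

definition back_face :: "nat \<Rightarrow> nat \<Rightarrow> ((nat \<Rightarrow> real) \<Rightarrow> 'a) \<Rightarrow> (nat \<Rightarrow> real) \<Rightarrow> 'a" where
  "back_face p q \<sigma> = (\<lambda>x\<in>standard_simplex q. \<sigma> (shift_simplex p x))"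

lemma cochain_cup_eq:
  "cochain_cup p q X a b = (\<lambda>\<sigma>. if singular_simplex (p + q) X \<sigma>
    then a (front_face p \<sigma>) * b (back_face p q \<sigma>) else 0)"
  unfolding cochain_cup_def front_face_def back_face_def shift_simplex_def by (rule refl)

lemma shift_simplex_in_standard_simplex:
  assumes x: "x \<in> standard_simplex q"
  shows "shift_simplex p x \<in> standard_simplex (p + q)"
proof -
  have "(\<Sum>i\<le>p + q. shift_simplex p x i) = (\<Sum>i\<in>{p..p + q}. x (i - p))"
    by (rule sum.mono_neutral_cong_right) (auto simp: shift_simplex_def)
  also have "\<dots> = (\<Sum>i\<le>q. x i)"
    by (rule sum.reindex_bij_witness[of _ "\<lambda>i. i + p" "\<lambda>i. i - p"]) auto
  finally show ?thesis using x by (auto simp: standard_simplex_def shift_simplex_def)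
qed

lemma continuous_map_shift_simplex:
  "continuous_map (subtopology (powertop_real UNIV) (standard_simplex q))
    (subtopology (powertop_real UNIV) (standard_simplex (p + q))) (shift_simplex p)"
proof (rule continuous_map_into_subtopology)
  show "shift_simplex p \<in> topspace (subtopology (powertop_real UNIV) (standard_simplex q)) \<rightarrow> standard_simplex (p + q)"
    by (auto simp: shift_simplex_in_standard_simplex)
  have "continuous_map (powertop_real UNIV) euclideanreal (\<lambda>x. shift_simplex p x i)" for i
    by (cases "i < p") (auto simp: shift_simplex_def intro: continuous_map_product_projection)
  then show "continuous_map (subtopology (powertop_real UNIV) (standard_simplex q)) (powertop_real UNIV) (shift_simplex p)"
    by (simp add: continuous_map_componentwise_UNIV continuous_map_from_subtopology)
qed

lemma singular_simplex_front_face: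
  assumes "singular_simplex (p + q) X \<sigma>"
  shows "singular_simplex p X (front_face p \<sigma>)"
proof -
  have "continuous_map (subtopology (powertop_real UNIV) (standard_simplex p)) X \<sigma>"
    using assms continuous_map_from_subtopology_mono[OF _ standard_simplex_mono[of p "p + q"]]
    unfolding singular_simplex_def by auto
  then have "continuous_map (subtopology (powertop_real UNIV) (standard_simplex p)) X (front_face p \<sigma>)"
    by (rule continuous_map_eq) (simp add: front_face_def)
  then show ?thesis by (simp add: singular_simplex_def front_face_def)
qed

lemma singular_simplex_back_face:
  assumes "singular_simplex (p + q) X \<sigma>"
  shows "singular_simplex q X (back_face p q \<sigma>)"
proof -
  have "continuous_map (subtopology (powertop_real UNIV) (standard_simplex q)) X (\<sigma> \<circ> shift_simplex p)"
    using assms unfolding singular_simplex_def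
    by (blast intro: continuous_map_compose[OF continuous_map_shift_simplex])
  then have "continuous_map (subtopology (powertop_real UNIV) (standard_simplex q)) X (back_face p q \<sigma>)"
    by (rule continuous_map_eq) (simp add: back_face_def)
  then show ?thesis by (simp add: singular_simplex_def back_face_def)
qed

lemma front_face_singular_face:
  assumes "k \<le> Suc p"
  shows "front_face p (singular_face (Suc (p + q)) k \<sigma>) = singular_face (Suc p) k (front_face (Suc p) \<sigma>)"
proof
  fix x
  show "front_face p (singular_face (Suc (p + q)) k \<sigma>) x = singular_face (Suc p) k (front_face (Suc p) \<sigma>) x"
    using simplical_face_in_standard_simplex[of "Suc p" k x] standard_simplex_mono[of p "p + q"] assms
    by (cases "x \<in> standard_simplex p") (auto simp: front_face_def singular_face_def)
qed

text \<open>At k = \<open>Suc p\<close> both this and \<open>front_face_singular_face\<close> apply.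
  The last face of the front (p+1)-face is therefore the front p-face of \<sigma> itself, one of the
  two boundary terms of the Leibniz rule.\<close>

lemma front_face_singular_face_above:
  assumes "p < k"
  shows "front_face p (singular_face (Suc (p + q)) k \<sigma>) = front_face p \<sigma>"
proof
  fix x
  show "front_face p (singular_face (Suc (p + q)) k \<sigma>) x = front_face p \<sigma> x"
  proof (cases "x \<in> standard_simplex p")
    case True
    have "x i = 0" if "i > p" for i using True that by (simp add: standard_simplex_def)
    then have "simplical_face k x = x" using assms by (auto simp: simplical_face_def fun_eq_iff)
    then show ?thesis using True standard_simplex_mono[of p "p + q"] by (auto simp: front_face_def singular_face_def)
  qed (simp add: front_face_def)
qed

lemma back_face_singular_face_below:
  assumes "k \<le> p"
  shows "back_face p q (singular_face (Suc (p + q)) k \<sigma>) = back_face (Suc p) q \<sigma>"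
proof
  fix x
  have "simplical_face k (shift_simplex p x) = shift_simplex (Suc p) x"
    using assms by (auto simp: simplical_face_def shift_simplex_def fun_eq_iff)
  then show "back_face p q (singular_face (Suc (p + q)) k \<sigma>) x = back_face (Suc p) q \<sigma> x"
    using shift_simplex_in_standard_simplex[of x q p]
    by (cases "x \<in> standard_simplex q") (auto simp: back_face_def singular_face_def)
qed

lemma back_face_singular_face:
  assumes "j \<le> Suc q"
  shows "back_face p q (singular_face (Suc (p + q)) (p + j) \<sigma>) = singular_face (Suc q) j (back_face p (Suc q) \<sigma>)"
proof
  fix x
  have "simplical_face (p + j) (shift_simplex p x) = shift_simplex p (simplical_face j x)"
    by (auto simp: simplical_face_def shift_simplex_def fun_eq_iff diff_right_commute intro!: arg_cong[of _ _ x])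
  then show "back_face p q (singular_face (Suc (p + q)) (p + j) \<sigma>) x = singular_face (Suc q) j (back_face p (Suc q) \<sigma>) x"
    using shift_simplex_in_standard_simplex[of x q p] simplical_face_in_standard_simplex[of "Suc q" j x] assms
    by (cases "x \<in> standard_simplex q") (auto simp: back_face_def singular_face_def)
qed

text \<open>
  The two terms with no counterpart on the left-hand side, the last face in the first factor and
  the face \<open>0\<close> in the second one, cancel each other.
\<close>

lemma cochain_coboundary_cup:
  fixes a b :: "('a, 'k::comm_ring_1) cochain"
  shows "cochain_coboundary (p + q) X (cochain_cup p q X a b) \<sigma> =
    cochain_cup (Suc p) q X (cochain_coboundary p X a) b \<sigma> +
    (-1) ^ p * cochain_cup p (Suc q) X a (cochain_coboundary q X b) \<sigma>"
proof (cases "singular_simplex (Suc (p + q)) X \<sigma>")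
  case True
  let ?d = "\<lambda>k. singular_face (Suc (p + q)) k \<sigma>"
  let ?A = "\<lambda>k. a (front_face p (?d k))" and ?B = "\<lambda>k. b (back_face p q (?d k))"
  have reindex: "(\<Sum>j\<le>q. H (Suc p + j)) = (\<Sum>k\<in>{Suc p..Suc (p + q)}. H k)" for H :: "nat \<Rightarrow> 'k"
    by (rule sum.reindex_bij_witness[of _ "\<lambda>k. k - Suc p" "\<lambda>j. Suc p + j"]) auto
  have sf: "singular_simplex (p + q) X (?d k)" if "k \<le> Suc (p + q)" for k
    using singular_simplex_singular_face[OF True _ that] by simp
  have fr: "singular_simplex (Suc p) X (front_face (Suc p) \<sigma>)"
    using singular_simplex_front_face[of "Suc p" q] True by simp
  have bk: "singular_simplex (Suc q) X (back_face p (Suc q) \<sigma>)"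
    using singular_simplex_back_face[of p "Suc q"] True by simp
  have "cochain_coboundary (p + q) X (cochain_cup p q X a b) \<sigma> =
      (\<Sum>k\<le>Suc (p + q). (-1) ^ k * (?A k * ?B k))"
    using True sf by (simp add: cochain_coboundary_def cochain_cup_eq del: sum.atMost_Suc)
  also have "{..Suc (p + q)} = {..p} \<union> {Suc p..Suc (p + q)}" by auto
  also have "(\<Sum>k\<in>{..p} \<union> {Suc p..Suc (p + q)}. (-1) ^ k * (?A k * ?B k)) =
      (\<Sum>k\<le>p. (-1) ^ k * (?A k * ?B k)) + (\<Sum>k\<in>{Suc p..Suc (p + q)}. (-1) ^ k * (?A k * ?B k))"
    by (rule sum.union_disjoint) auto
  finally have L: "cochain_coboundary (p + q) X (cochain_cup p q X a b) \<sigma> =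
      (\<Sum>k\<le>p. (-1) ^ k * (?A k * ?B k)) + (\<Sum>k\<in>{Suc p..Suc (p + q)}. (-1) ^ k * (?A k * ?B k))" .
  have "cochain_cup (Suc p) q X (cochain_coboundary p X a) b \<sigma> =
      (\<Sum>k\<le>Suc p. (-1) ^ k * (a (singular_face (Suc p) k (front_face (Suc p) \<sigma>)) * b (back_face (Suc p) q \<sigma>)))"
    using True fr
    by (simp add: cochain_cup_eq cochain_coboundary_def sum_distrib_right mult.assoc del: sum.atMost_Suc)
  also have "\<dots> = (\<Sum>k\<le>p. (-1) ^ k * (?A k * ?B k)) + (-1) ^ Suc p * (a (front_face p \<sigma>) * b (back_face (Suc p) q \<sigma>))"
    unfolding sum.atMost_Suc
    by (simp add: front_face_singular_face[of _ p q, symmetric] front_face_singular_face_above back_face_singular_face_below)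
  finally have R1: "cochain_cup (Suc p) q X (cochain_coboundary p X a) b \<sigma> =
      (\<Sum>k\<le>p. (-1) ^ k * (?A k * ?B k)) + (-1) ^ Suc p * (a (front_face p \<sigma>) * b (back_face (Suc p) q \<sigma>))" .
  have "cochain_cup p (Suc q) X a (cochain_coboundary q X b) \<sigma> =
      (\<Sum>j\<le>Suc q. (-1) ^ j * (a (front_face p \<sigma>) * b (singular_face (Suc q) j (back_face p (Suc q) \<sigma>))))"
    using True bk
    by (simp add: cochain_cup_eq cochain_coboundary_def sum_distrib_left mult.left_commute del: sum.atMost_Suc)
  also have "\<dots> = a (front_face p \<sigma>) * b (back_face (Suc p) q \<sigma>) +
      (\<Sum>j\<le>q. (-1) ^ Suc j * (?A (Suc p + j) * ?B (Suc p + j)))"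
  proof -
    \<comment> \<open>Index p is in the range of both lemmas on back faces; comparing their
      right-hand sides identifies face 0.\<close>
    have "singular_face (Suc q) 0 (back_face p (Suc q) \<sigma>) = back_face (Suc p) q \<sigma>"
      using back_face_singular_face[of 0 q p \<sigma>] back_face_singular_face_below[of p p q \<sigma>] by simp
    moreover have "a (front_face p \<sigma>) * b (singular_face (Suc q) (Suc j) (back_face p (Suc q) \<sigma>)) =
        ?A (Suc p + j) * ?B (Suc p + j)" if "j \<le> q" for j
      using back_face_singular_face[of "Suc j" q p \<sigma>] front_face_singular_face_above[of p "Suc p + j" q \<sigma>] that by simp
    ultimately show ?thesis
      unfolding sum.atMost_Suc_shift by simp
  qed
  finally have cup: "cochain_cup p (Suc q) X a (cochain_coboundary q X b) \<sigma> =
      a (front_face p \<sigma>) * b (back_face (Suc p) q \<sigma>) +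
      (\<Sum>j\<le>q. (-1) ^ Suc j * (?A (Suc p + j) * ?B (Suc p + j)))" .
  have "(-1) ^ p * cochain_cup p (Suc q) X a (cochain_coboundary q X b) \<sigma> =
      (-1) ^ p * (a (front_face p \<sigma>) * b (back_face (Suc p) q \<sigma>)) +
      (\<Sum>j\<le>q. (-1) ^ (Suc p + j) * (?A (Suc p + j) * ?B (Suc p + j)))"
    unfolding cup by (simp add: right_diff_distrib distrib_left sum_distrib_left power_add mult.assoc sum_negf)
  then have R2: "(-1) ^ p * cochain_cup p (Suc q) X a (cochain_coboundary q X b) \<sigma> =
      (-1) ^ p * (a (front_face p \<sigma>) * b (back_face (Suc p) q \<sigma>)) +
      (\<Sum>k\<in>{Suc p..Suc (p + q)}. (-1) ^ k * (?A k * ?B k))"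
    unfolding reindex[of "\<lambda>k. (-1) ^ k * (?A k * ?B k)"] .
  show ?thesis unfolding L R1 R2 by simp
qed (simp add: cochain_coboundary_def cochain_cup_eq)

lemma singular_cochain_cup: "singular_cochain (p + q) X (cochain_cup p q X a b)"
  by (simp add: singular_cochain_def cochain_cup_def)

lemma cochain_cup_coboundary_left:
  fixes a b :: "('a, 'k::comm_ring_1) cochain"
  assumes a: "a \<in> coboundary_set p X" and b: "cochain_coboundary q X b = (\<lambda>_. 0)"
  shows "cochain_cup p q X a b \<in> coboundary_set (p + q) X"
proof (cases p)
  case 0
  then have "cochain_cup p q X a b = (\<lambda>_. 0)" using a by (auto simp: coboundary_set_def cochain_cup_def)
  then show ?thesis by (simp add: zero_in_coboundary_set)
next
  case (Suc r)
  then obtain d where d: "singular_cochain r X d" "a = cochain_coboundary r X d"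
    using a by (auto simp: coboundary_set_def)
  have "cochain_cup p q X a b = cochain_coboundary (r + q) X (cochain_cup r q X d b)"
    by (rule ext) (simp add: cochain_coboundary_cup b d Suc, simp add: cochain_cup_def)
  then show ?thesis by (auto simp: Suc coboundary_set_def singular_cochain_cup)
qed

lemma cochain_cup_coboundary_right:
  fixes a b :: "('a, 'k::comm_ring_1) cochain"
  assumes b: "b \<in> coboundary_set q X" and a: "cochain_coboundary p X a = (\<lambda>_. 0)"
  shows "cochain_cup p q X a b \<in> coboundary_set (p + q) X"
proof (cases q)
  case 0
  then have "cochain_cup p q X a b = (\<lambda>_. 0)" using b by (auto simp: coboundary_set_def cochain_cup_def)
  then show ?thesis by (simp add: zero_in_coboundary_set)
next
  case (Suc r)
  then obtain d where d: "singular_cochain r X d" "b = cochain_coboundary r X d"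
    using b by (auto simp: coboundary_set_def)
  have "cochain_coboundary (p + r) X (cochain_cup p r X a d) = (\<lambda>\<sigma>. (-1) ^ p * cochain_cup p q X a b \<sigma>)"
    by (rule ext) (simp add: cochain_coboundary_cup a d Suc, simp add: cochain_cup_def)
  then have "(\<lambda>\<sigma>. (-1) ^ p * cochain_cup p q X a b \<sigma>) \<in> coboundary_set (p + q) X"
    by (auto simp: Suc coboundary_set_def singular_cochain_cup intro!: image_eqI[of _ _ "cochain_cup p r X a d"])
  \<comment> \<open>Multiplying by the sign of the Leibniz rule a second time removes it.\<close>
  from coboundary_set_scale[OF this, of "(-1) ^ p"] show ?thesis
    by (simp add: mult.assoc[symmetric] power_mult_distrib[symmetric])
qed

text \<open>Well-definedness: the difference of a' cup b' and a cup b is (a' - a) cup b' plus a cup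
  (b' - b), and each of the two pairs a coboundary with a cocycle.\<close>

lemma cup_product_class:
  fixes a b :: "('a, 'k::comm_ring_1) cochain"
  assumes a: "cochain_coboundary p X a = (\<lambda>_. 0)" and b: "cochain_coboundary q X b = (\<lambda>_. 0)"
  shows "cup_product p q X (cohomology_class p X a) (cohomology_class q X b) =
    cohomology_class (p + q) X (cochain_cup p q X a b)"
  unfolding cup_product_def
proof (rule SUP_eq_const)
  show "cohomology_class p X a \<noteq> {}" using cohomology_class_self by blast
  fix a' assume a': "a' \<in> cohomology_class p X a"
  show "(\<Union>b'\<in>cohomology_class q X b. cohomology_class (p + q) X (cochain_cup p q X a' b')) =
      cohomology_class (p + q) X (cochain_cup p q X a b)"
  proof (rule SUP_eq_const)
    show "cohomology_class q X b \<noteq> {}" using cohomology_class_self by blast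
    fix b' assume b': "b' \<in> cohomology_class q X b"
    let ?x = "\<lambda>\<sigma>. a' \<sigma> - a \<sigma>" and ?y = "\<lambda>\<sigma>. b' \<sigma> - b \<sigma>"
    have x: "?x \<in> coboundary_set p X" and y: "?y \<in> coboundary_set q X"
      using a' b' by (simp_all add: mem_cohomology_class_iff)
    have "cochain_coboundary q X (\<lambda>\<sigma>. ?y \<sigma> + b \<sigma>) = (\<lambda>_. 0)"
      unfolding cochain_coboundary_add coboundary_set_cocycle(2)[OF y] b by simp
    then have b'0: "cochain_coboundary q X b' = (\<lambda>_. 0)" by simp
    have "cochain_cup p q X ?x b' \<in> coboundary_set (p + q) X"
      by (rule cochain_cup_coboundary_left[OF x b'0])
    moreover have "cochain_cup p q X a ?y \<in> coboundary_set (p + q) X"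
      by (rule cochain_cup_coboundary_right[OF y a])
    ultimately have "(\<lambda>\<sigma>. cochain_cup p q X ?x b' \<sigma> + cochain_cup p q X a ?y \<sigma>) \<in> coboundary_set (p + q) X"
      by (rule coboundary_set_add)
    moreover have "(\<lambda>\<sigma>. cochain_cup p q X ?x b' \<sigma> + cochain_cup p q X a ?y \<sigma>) =
        (\<lambda>\<sigma>. cochain_cup p q X a' b' \<sigma> - cochain_cup p q X a b \<sigma>)"
      by (auto simp: cochain_cup_def algebra_simps)
    ultimately show "cohomology_class (p + q) X (cochain_cup p q X a' b') =
        cohomology_class (p + q) X (cochain_cup p q X a b)"
      by (intro cohomology_class_eqI) simp
  qed
qed

section \<open>Induced ring homomorphisms and retractions\<close>

lemma cochain_pullback_cup:
  assumes f: "continuous_map X Y f"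
  shows "cochain_pullback (p + q) X f (cochain_cup p q Y a b) =
    cochain_cup p q X (cochain_pullback p X f a) (cochain_pullback q X f b)"
proof
  fix \<sigma>
  show "cochain_pullback (p + q) X f (cochain_cup p q Y a b) \<sigma> =
    cochain_cup p q X (cochain_pullback p X f a) (cochain_pullback q X f b) \<sigma>"
  proof (cases "singular_simplex (p + q) X \<sigma>")
    case True
    have "front_face p (simplex_map (p + q) f \<sigma>) = simplex_map p f (front_face p \<sigma>)"
      using standard_simplex_mono[of p "p + q"] by (auto simp: front_face_def simplex_map_def fun_eq_iff)
    moreover have "back_face p q (simplex_map (p + q) f \<sigma>) = simplex_map q f (back_face p q \<sigma>)"
      using shift_simplex_in_standard_simplex[of _ q p] by (auto simp: back_face_def simplex_map_def fun_eq_iff)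
    ultimately show ?thesis
      using True singular_simplex_simplex_map[OF True f] singular_simplex_front_face[OF True] singular_simplex_back_face[OF True]
      by (simp add: cochain_pullback_def cochain_cup_eq)
  qed (simp add: cochain_pullback_def cochain_cup_def)
qed

lemma cohomology_ring_hom_induced:
  assumes f: "continuous_map X Y f"
  shows "cohomology_ring_hom Y X
    (cohomology_induced X f :: nat \<Rightarrow> ('b, 'k::comm_ring_1) cochain set \<Rightarrow> ('a, 'k) cochain set)"
proof -
  let ?h = "cohomology_induced X f :: nat \<Rightarrow> ('b, 'k) cochain set \<Rightarrow> ('a, 'k) cochain set"
  have rep: "\<exists>c. singular_cochain p Y c \<and> cochain_coboundary p Y c = (\<lambda>_. 0) \<and> \<alpha> = cohomology_class p Y c"
    if "\<alpha> \<in> carrier (cohomology_group p Y)" for p and \<alpha> :: "('b, 'k) cochain set"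
    using that unfolding carrier_cohomology_group by blast
  have "?h p \<in> hom (cohomology_group p Y) (cohomology_group p X)" for p
  proof (rule homI)
    fix \<alpha> :: "('b, 'k) cochain set" assume "\<alpha> \<in> carrier (cohomology_group p Y)"
    then obtain c where "cochain_coboundary p Y c = (\<lambda>_. 0)" "\<alpha> = cohomology_class p Y c" using rep by blast
    then show "?h p \<alpha> \<in> carrier (cohomology_group p X)"
      unfolding carrier_cohomology_group
      by (auto simp: cohomology_induced_class[OF f] cochain_pullback_cocycle[OF f] singular_cochain_pullback)
  next
    fix \<alpha> \<alpha>' :: "('b, 'k) cochain set"
    assume "\<alpha> \<in> carrier (cohomology_group p Y)" "\<alpha>' \<in> carrier (cohomology_group p Y)"
    then obtain c d where cd: "\<alpha> = cohomology_class p Y c" "\<alpha>' = cohomology_class p Y d" using rep by meson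
    have "cochain_pullback p X f (\<lambda>\<sigma>. c \<sigma> + d \<sigma>) = (\<lambda>\<sigma>. cochain_pullback p X f c \<sigma> + cochain_pullback p X f d \<sigma>)"
      by (auto simp: cochain_pullback_def)
    then show "?h p (\<alpha> \<otimes>\<^bsub>cohomology_group p Y\<^esub> \<alpha>') = ?h p \<alpha> \<otimes>\<^bsub>cohomology_group p X\<^esub> ?h p \<alpha>'"
      unfolding cd by (simp add: mult_cohomology_group cohomology_induced_class[OF f])
  qed
  moreover have "?h p (cohomology_scale p Y r \<alpha>) = cohomology_scale p X r (?h p \<alpha>)"
    if \<alpha>: "\<alpha> \<in> carrier (cohomology_group p Y)" for p r \<alpha>
  proof -
    obtain c where c: "\<alpha> = cohomology_class p Y c" using rep[OF \<alpha>] by blast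
    have "cochain_pullback p X f (\<lambda>\<sigma>. r * c \<sigma>) = (\<lambda>\<sigma>. r * cochain_pullback p X f c \<sigma>)"
      by (auto simp: cochain_pullback_def)
    then show ?thesis unfolding c by (simp add: cohomology_scale_class cohomology_induced_class[OF f])
  qed
  moreover have "?h (p + q) (cup_product p q Y \<alpha> \<alpha>') = cup_product p q X (?h p \<alpha>) (?h q \<alpha>')"
    if \<alpha>: "\<alpha> \<in> carrier (cohomology_group p Y)" and \<alpha>': "\<alpha>' \<in> carrier (cohomology_group q Y)" for p q \<alpha> \<alpha>'
  proof -
    obtain c where c: "cochain_coboundary p Y c = (\<lambda>_. 0)" "\<alpha> = cohomology_class p Y c" using rep[OF \<alpha>] by blast
    obtain d where d: "cochain_coboundary q Y d = (\<lambda>_. 0)" "\<alpha>' = cohomology_class q Y d" using rep[OF \<alpha>'] by blast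
    show ?thesis
      unfolding c(2) d(2) cup_product_class[OF c(1) d(1)] cohomology_induced_class[OF f]
        cup_product_class[OF cochain_pullback_cocycle[OF f c(1)] cochain_pullback_cocycle[OF f d(1)]]
      by (simp add: cochain_pullback_cup[OF f])
  qed
  moreover have "?h 0 (cohomology_unit Y) = cohomology_unit X"
  proof -
    have "cochain_pullback 0 X f (\<lambda>\<sigma>. if singular_simplex 0 Y \<sigma> then 1 else 0) =
        (\<lambda>\<sigma>. if singular_simplex 0 X \<sigma> then 1 else 0 :: 'k)"
      using singular_simplex_simplex_map[OF _ f] by (auto simp: cochain_pullback_def)
    then show ?thesis by (simp add: cohomology_unit_def cohomology_induced_class[OF f])
  qed
  ultimately show ?thesis unfolding cohomology_ring_hom_def by blast
qed

text \<open>The splitting is the homomorphism induced by r. Pulling back along r and then along f is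
  the identity already on cochains, since r after f fixes every singular simplex of X.\<close>

lemma induces_split_epi_cohomology_retract:
  assumes f: "continuous_map X Y f" and r: "continuous_map Y X r"
    and rf: "\<And>x. x \<in> topspace X \<Longrightarrow> r (f x) = x"
  shows "induces_split_epi_cohomology TYPE('k::comm_ring_1) X Y f"
proof -
  have "cohomology_induced X f p (cohomology_induced Y r p \<alpha>) = \<alpha>"
    if \<alpha>: "\<alpha> \<in> carrier (cohomology_group p X)" for p and \<alpha> :: "('a, 'k) cochain set"
  proof -
    obtain c where c: "singular_cochain p X c" "\<alpha> = cohomology_class p X c"
      using \<alpha> unfolding carrier_cohomology_group by blast
    have "cochain_pullback p X f (cochain_pullback p Y r c) = c"
    proof
      fix \<sigma>
      show "cochain_pullback p X f (cochain_pullback p Y r c) \<sigma> = c \<sigma>"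
      proof (cases "singular_simplex p X \<sigma>")
        case True
        have "simplex_map p r (simplex_map p f \<sigma>) = simplex_map p (r \<circ> f) \<sigma>"
          by (simp add: simplex_map_compose)
        also have "\<dots> = \<sigma>" by (rule simplex_map_id_gen[OF True]) (simp add: rf)
        finally show ?thesis
          using True singular_simplex_simplex_map[OF True f] by (simp add: cochain_pullback_def)
      qed (use c(1) in \<open>simp add: cochain_pullback_def singular_cochain_def\<close>)
    qed
    then show ?thesis unfolding c(2) by (simp add: cohomology_induced_class[OF f] cohomology_induced_class[OF r])
  qed
  then show ?thesis
    unfolding induces_split_epi_cohomology_def
    using cohomology_ring_hom_induced[OF f, where 'k='k] cohomology_ring_hom_induced[OF r, where 'k='k] by blast
qed

section \<open>The moment map on the cubical complex of nested sets\<close>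

lemma mem_axis_hull_iff:
  fixes x :: "real ^ 'v::finite"
  shows "x \<in> convex hull ((\<lambda>i. axis i 1) ` S) \<longleftrightarrow>
    (\<forall>i. 0 \<le> x $ i) \<and> (\<forall>i. i \<notin> S \<longrightarrow> x $ i = 0) \<and> (\<Sum>i\<in>S. x $ i) = 1"
proof -
  let ?e = "\<lambda>i::'v. axis i (1::real)"
  have fin: "finite (?e ` S)" by simp
  have inj: "inj_on ?e S" by (auto simp: inj_on_def axis_eq_axis)
  have comp: "(\<Sum>k\<in>S. u k *\<^sub>R ?e k) $ i = (if i \<in> S then u i else 0)" for u :: "'v \<Rightarrow> real" and i
  proof -
    have "(\<Sum>k\<in>S. u k *\<^sub>R ?e k) $ i = (\<Sum>k\<in>S. if i = k then u k else 0)"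
      by (auto simp: axis_def if_distrib cong: if_cong intro!: sum.cong)
    then show ?thesis by simp
  qed
  show ?thesis
  proof
    assume "x \<in> convex hull (?e ` S)"
    then obtain u where u: "\<forall>y\<in>?e ` S. 0 \<le> u y" "sum u (?e ` S) = 1"
      "(\<Sum>y\<in>?e ` S. u y *\<^sub>R y) = x"
      by (auto simp: convex_hull_finite[OF fin])
    have "x = (\<Sum>k\<in>S. u (?e k) *\<^sub>R ?e k)"
      using u(3) by (simp add: sum.reindex[OF inj])
    then have xi: "x $ i = (if i \<in> S then u (?e i) else 0)" for i
      by (simp only: comp)
    show "(\<forall>i. 0 \<le> x $ i) \<and> (\<forall>i. i \<notin> S \<longrightarrow> x $ i = 0) \<and> (\<Sum>i\<in>S. x $ i) = 1"
      using u(1,2) by (auto simp: xi sum.reindex[OF inj])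
  next
    assume a: "(\<forall>i. 0 \<le> x $ i) \<and> (\<forall>i. i \<notin> S \<longrightarrow> x $ i = 0) \<and> (\<Sum>i\<in>S. x $ i) = 1"
    have "(\<Sum>k\<in>S. x $ k *\<^sub>R ?e k) = x"
      using a by (simp add: vec_eq_iff comp del: sum_component vector_scaleR_component)
    moreover have "(\<Sum>k\<in>S. x $ k *\<^sub>R ?e k) \<in> convex hull (?e ` S)"
      using a by (intro convex_sum) (auto intro: hull_inc)
    ultimately show "x \<in> convex hull (?e ` S)" by simp
  qed
qed

lemma mem_nestohedron_iff:
  fixes B :: "'v::finite set set"
  shows "x \<in> nestohedron B \<longleftrightarrow>
    (\<exists>s. (\<forall>T\<in>B. s T \<in> convex hull ((\<lambda>i. axis i 1) ` T)) \<and> x = (\<Sum>T\<in>B. s T))"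
  unfolding nestohedron_def by (subst set_sum_alt) auto

text \<open>Convex hulls commute with Minkowski sums, so the nestohedron is the hull of a finite set
  of sums of basis vectors.\<close>

lemma polytope_nestohedron: "polytope (nestohedron (B :: 'v::finite set set))"
proof -
  have fin: "finite (\<Sum>S\<in>C. (\<lambda>i. axis i 1) ` S :: (real ^ 'v) set)" for C :: "'v set set"
    by (rule finite_set_sum) auto
  show ?thesis
    unfolding nestohedron_def convex_hull_set_sum[symmetric] by (rule polytope_convex_hull[OF fin])
qed

text \<open>A summand at T \<subseteq> R contributes exactly 1, the others a nonnegative amount. The
  criterion for equality is available for every decomposition into summands: it is applied both to
  barycentric coordinates and to an arbitrary decomposition.\<close>

lemma sum_ge_card_bs_restrict:
  fixes B :: "'v::finite set set"
  assumes s: "\<And>T. T \<in> B \<Longrightarrow> s T \<in> convex hull ((\<lambda>i. axis i 1) ` T)"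
  shows "(\<Sum>i\<in>R. (\<Sum>T\<in>B. s T) $ i) \<ge> real (card (bs_restrict B R))"
    and "(\<Sum>i\<in>R. (\<Sum>T\<in>B. s T) $ i) = real (card (bs_restrict B R)) \<longleftrightarrow>
      (\<forall>T\<in>B. \<not> T \<subseteq> R \<longrightarrow> (\<forall>i\<in>R. s T $ i = 0))"
proof -
  have nn: "0 \<le> s T $ i" if "T \<in> B" for T i
    using s[OF that] by (simp add: mem_axis_hull_iff)
  have one: "(\<Sum>i\<in>R. s T $ i) = 1" if "T \<in> B" "T \<subseteq> R" for T
  proof -
    have "(\<Sum>i\<in>R. s T $ i) = (\<Sum>i\<in>T. s T $ i)"
      using s[OF that(1)] that(2)
      by (intro sum.mono_neutral_right) (auto simp: mem_axis_hull_iff)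
    then show ?thesis
      using s[OF that(1)] by (simp add: mem_axis_hull_iff)
  qed
  have "(\<Sum>i\<in>R. (\<Sum>T\<in>B. s T) $ i) = (\<Sum>T\<in>B. \<Sum>i\<in>R. s T $ i)"
    by (simp add: sum.swap[of _ R])
  also have "\<dots> = (\<Sum>T\<in>{T\<in>B. T \<subseteq> R}. \<Sum>i\<in>R. s T $ i) + (\<Sum>T\<in>{T\<in>B. \<not> T \<subseteq> R}. \<Sum>i\<in>R. s T $ i)"
    by (subst sum.union_disjoint[symmetric]) (auto intro!: sum.cong)
  also have "(\<Sum>T\<in>{T\<in>B. T \<subseteq> R}. \<Sum>i\<in>R. s T $ i) = real (card (bs_restrict B R))"
    by (simp add: one bs_restrict_def)
  finally have eq: "(\<Sum>i\<in>R. (\<Sum>T\<in>B. s T) $ i) =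
    real (card (bs_restrict B R)) + (\<Sum>T\<in>{T\<in>B. \<not> T \<subseteq> R}. \<Sum>i\<in>R. s T $ i)" .
  show "(\<Sum>i\<in>R. (\<Sum>T\<in>B. s T) $ i) \<ge> real (card (bs_restrict B R))"
    unfolding eq by (auto intro!: sum_nonneg nn)
  show "(\<Sum>i\<in>R. (\<Sum>T\<in>B. s T) $ i) = real (card (bs_restrict B R)) \<longleftrightarrow>
      (\<forall>T\<in>B. \<not> T \<subseteq> R \<longrightarrow> (\<forall>i\<in>R. s T $ i = 0))"
  proof -
    have "(\<Sum>T\<in>{T\<in>B. \<not> T \<subseteq> R}. \<Sum>i\<in>R. s T $ i) = 0 \<longleftrightarrow>
        (\<forall>T\<in>{T\<in>B. \<not> T \<subseteq> R}. (\<Sum>i\<in>R. s T $ i) = 0)"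
      by (rule sum_nonneg_eq_0_iff) (auto intro: sum_nonneg nn)
    also have "\<dots> \<longleftrightarrow> (\<forall>T\<in>{T\<in>B. \<not> T \<subseteq> R}. \<forall>i\<in>R. s T $ i = 0)"
      by (intro ball_cong refl sum_nonneg_eq_0_iff) (auto intro: nn)
    finally show ?thesis unfolding eq by auto
  qed
qed

lemma nesto_facet_face_of: "nesto_facet B R face_of nestohedron (B :: 'v::finite set set)"
proof -
  let ?a = "(\<chi> i. if i \<in> R then 1 else 0) :: real ^ 'v"
  have a: "?a \<bullet> x = (\<Sum>i\<in>R. x $ i)" for x
  proof -
    have "?a \<bullet> x = (\<Sum>i\<in>UNIV. if i \<in> R then x $ i else 0)"
      by (auto simp: inner_vec_def intro!: sum.cong)
    then show ?thesis by (simp add: sum.If_cases)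
  qed
  have "nestohedron B \<inter> {x. ?a \<bullet> x = real (card (bs_restrict B R))} face_of nestohedron B"
    by (rule face_of_Int_supporting_hyperplane_ge)
      (auto simp: a mem_nestohedron_iff polytope_nestohedron polytope_imp_convex
        intro: sum_ge_card_bs_restrict)
  then show ?thesis
    by (simp add: nesto_facet_def a Collect_conj_eq)
qed

section \<open>Building sets and nested sets\<close>

lemma building_set_subset: "building_set V B \<Longrightarrow> T \<in> B \<Longrightarrow> T \<subseteq> V"
  and building_set_nonempty: "building_set V B \<Longrightarrow> T \<in> B \<Longrightarrow> T \<noteq> {}"
  and building_set_Un:
    "building_set V B \<Longrightarrow> S \<in> B \<Longrightarrow> T \<in> B \<Longrightarrow> S \<inter> T \<noteq> {} \<Longrightarrow> S \<union> T \<in> B"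
  and building_set_singleton: "building_set V B \<Longrightarrow> x \<in> V \<Longrightarrow> {x} \<in> B"
  and connected_building_set_top: "connected_building_set V B \<Longrightarrow> V \<in> B"
  and connected_building_set_imp: "connected_building_set V B \<Longrightarrow> building_set V B"
  by (auto simp: building_set_def connected_building_set_def)

text \<open>In place of conditions on pairs and on disjoint unions, there is one condition per R:
  some vertex e_i of the summand at R is allowed by all facets F_T with T in \<tau>, since F_T
  forces the coordinates in T of that summand to vanish unless R \<subseteq> T. That this means that
  the facets meet is \<open>nested_iff_facets_meet\<close>.\<close>

definition nested :: "'v set set \<Rightarrow> 'v set set \<Rightarrow> bool" where
  "nested B \<tau> \<longleftrightarrow> (\<forall>R\<in>B. \<exists>i\<in>R. \<forall>T\<in>\<tau>. i \<in> T \<longrightarrow> R \<subseteq> T)"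

lemma nested_subset: "nested B \<tau> \<Longrightarrow> \<tau>' \<subseteq> \<tau> \<Longrightarrow> nested B \<tau>'"
  unfolding nested_def by (meson subsetD)

text \<open>
  In the product \<open>num\<close>, the coordinates of \<open>y\<close> at sets that are not vertices of the nested set
  complex are \<open>1\<close>, so only nonmaximal elements of the building set contribute.  The point
  \<open>moment \<beta> y\<close> is the value of the moment map of the toric variety of the nestohedron at the
  point with homogeneous coordinates \<open>y\<close>, and \<open>\<beta>\<close> is the effect of a translation in the dense
  torus: the summand at \<open>T\<close> has barycentric coordinates proportional to
  \<open>\<beta> i * (\<Prod>R\<ni>i. y R)\<close>, with the common factors of these products cancelled.
\<close>

definition num :: "'v::finite set \<Rightarrow> real ^ ('v set) \<Rightarrow> 'v \<Rightarrow> real" where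
  "num T y i = (\<Prod>R | i \<in> R \<and> \<not> T \<subseteq> R. y $ R)"

definition bary :: "('v::finite \<Rightarrow> real) \<Rightarrow> 'v set \<Rightarrow> real ^ ('v set) \<Rightarrow> real ^ 'v" where
  "bary \<beta> T y = (\<chi> i. if i \<in> T then \<beta> i * num T y i / (\<Sum>k\<in>T. \<beta> k * num T y k) else 0)"

definition moment :: "'v set set \<Rightarrow> ('v::finite \<Rightarrow> real) \<Rightarrow> real ^ ('v set) \<Rightarrow> real ^ 'v" where
  "moment B \<beta> y = (\<Sum>T\<in>B. bary \<beta> T y)"

definition cubes :: "'v::finite set \<Rightarrow> 'v set set \<Rightarrow> (real ^ ('v set)) set" where
  "cubes V B = {y. (\<forall>T. 0 \<le> y $ T \<and> y $ T \<le> 1) \<and> (\<forall>T. T \<notin> B - {V} \<longrightarrow> y $ T = 1) \<and>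
                   nested B {T. y $ T < 1}}"

section \<open>Positivity and vanishing of barycentric coordinates\<close>

lemma num_nonneg: "y \<in> cubes V B \<Longrightarrow> 0 \<le> num T y i"
  by (auto simp: num_def cubes_def intro!: prod_nonneg)

lemma num_le_1: "y \<in> cubes V B \<Longrightarrow> num T y i \<le> 1"
  by (auto simp: num_def cubes_def intro!: prod_le_1)

text \<open>At the index that nestedness provides for T, every factor of the product is 1. Together
  with \<open>num_le_1\<close> this normalises the maximum of \<open>num T y\<close> over T to 1,
  and it keeps the denominators in \<open>bary\<close> positive.\<close>

lemma num_eq_1: "y \<in> cubes V B \<Longrightarrow> T \<in> B \<Longrightarrow> \<exists>i\<in>T. num T y i = 1"
proof -
  assume y: "y \<in> cubes V B" and T: "T \<in> B"
  then obtain i where i: "i \<in> T" "\<And>R. y $ R < 1 \<Longrightarrow> i \<in> R \<Longrightarrow> T \<subseteq> R"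
    by (force simp: cubes_def nested_def)
  have "y $ R = 1" if "i \<in> R" "\<not> T \<subseteq> R" for R
  proof -
    have "\<not> y $ R < 1" using i(2) that by blast
    moreover have "y $ R \<le> 1" using y by (simp add: cubes_def)
    ultimately show ?thesis by simp
  qed
  then have "num T y i = 1" by (simp add: num_def)
  with i(1) show ?thesis by blast
qed

lemma num_zero_iff: "num T y i = 0 \<longleftrightarrow> (\<exists>R. i \<in> R \<and> \<not> T \<subseteq> R \<and> y $ R = 0)"
  by (auto simp: num_def)

lemma bary_denom_pos:
  assumes "y \<in> cubes V B" "T \<in> B" "\<forall>i. \<beta> i > 0"
  shows "(\<Sum>k\<in>T. \<beta> k * num T y k) > 0"
proof -
  obtain i where i: "i \<in> T" "num T y i = 1" using num_eq_1 assms by blast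
  have "0 < \<beta> i * num T y i" using i assms by simp
  also have "\<dots> \<le> (\<Sum>k\<in>T. \<beta> k * num T y k)"
    using i num_nonneg[OF assms(1)] assms(3) by (intro member_le_sum) (simp_all add: less_imp_le)
  finally show ?thesis .
qed

lemma bary_in_hull:
  assumes "y \<in> cubes V B" "T \<in> B" "\<forall>i. \<beta> i > 0"
  shows "bary \<beta> T y \<in> convex hull ((\<lambda>i. axis i 1) ` T)"
proof -
  have "0 \<le> \<beta> i * num T y i" for i
    using num_nonneg[OF assms(1)] assms(3) by (simp add: less_imp_le)
  moreover have "(\<Sum>k\<in>T. \<beta> k * num T y k) \<noteq> 0"
    using bary_denom_pos[OF assms] by linarith
  ultimately show ?thesis
    using bary_denom_pos[OF assms]
    by (auto simp: mem_axis_hull_iff bary_def sum_divide_distrib[symmetric])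
qed

lemma moment_in_nestohedron:
  assumes "y \<in> cubes V B" "\<forall>i. \<beta> i > 0"
  shows "moment B \<beta> y \<in> nestohedron B"
  unfolding mem_nestohedron_iff moment_def 
  using bary_in_hull[OF assms(1) _ assms(2)] by (intro exI[of _ "\<lambda>T. bary \<beta> T y"]) simp

lemma bary_zero_iff:
  assumes "y \<in> cubes V B" "T \<in> B" "\<forall>i. \<beta> i > 0" "i \<in> T"
  shows "bary \<beta> T y $ i = 0 \<longleftrightarrow> (\<exists>R. i \<in> R \<and> \<not> T \<subseteq> R \<and> y $ R = 0)"
proof -
  have "(\<Sum>k\<in>T. \<beta> k * num T y k) \<noteq> 0" "\<beta> i \<noteq> 0"
    using bary_denom_pos[OF assms(1-3)] assms(3) by (metis less_irrefl)+
  then show ?thesis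
    using assms(4) by (simp add: bary_def num_zero_iff)
qed

text \<open>The index provided for R \<union> T lies in R or in T, and that set must then contain
  the union.\<close>

lemma nested_comparable:
  assumes "building_set V B" "nested B \<tau>" "R \<in> \<tau>" "T \<in> \<tau>" "R \<in> B" "T \<in> B" "R \<inter> T \<noteq> {}"
  shows "R \<subseteq> T \<or> T \<subseteq> R"
proof -
  have "R \<union> T \<in> B" using assms by (auto simp: building_set_def)
  then obtain i where "i \<in> R \<union> T" "\<forall>Q\<in>\<tau>. i \<in> Q \<longrightarrow> R \<union> T \<subseteq> Q"
    using assms(2) unfolding nested_def by meson
  then show ?thesis using assms(3,4) by blast
qed

lemma nested_insert_top:
  assumes "building_set V B" "nested B \<tau>"
  shows "nested B (insert V \<tau>)"
  unfolding nested_def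
proof
  fix R assume R: "R \<in> B"
  then obtain i where "i \<in> R" "\<forall>T\<in>\<tau>. i \<in> T \<longrightarrow> R \<subseteq> T"
    using assms(2) by (auto simp: nested_def)
  moreover have "R \<subseteq> V" using R assms(1) by (auto simp: building_set_def)
  ultimately show "\<exists>i\<in>R. \<forall>T\<in>insert V \<tau>. i \<in> T \<longrightarrow> R \<subseteq> T" by auto
qed

text \<open>The members that contain R share its points, so they form a chain by
  \<open>nested_comparable\<close> and have a least element. Adding V guarantees that there is
  one.\<close>

lemma nested_parent:
  assumes cb: "connected_building_set V B" and n: "nested B \<tau>" and \<tau>: "\<tau> \<subseteq> B" and R: "R \<in> B - {V}"
  obtains T where "T \<in> insert V \<tau>" "R \<subset> T" "\<And>Q. Q \<in> insert V \<tau> \<Longrightarrow> R \<subset> Q \<Longrightarrow> T \<subseteq> Q"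
proof -
  have bs: "building_set V B" and V: "V \<in> B" using cb by (auto simp: connected_building_set_def)
  have nV: "nested B (insert V \<tau>)"
    by (rule nested_insert_top[OF bs n])
  have R': "R \<subset> V" "R \<noteq> {}"
    using R building_set_subset[OF bs, of R] building_set_nonempty[OF bs, of R] by blast+
  let ?C = "{T \<in> insert V \<tau>. R \<subset> T}"
  have "finite V" using bs by (simp add: building_set_def)
  moreover have "insert V \<tau> \<subseteq> Pow V" using \<tau> building_set_subset[OF bs] by blast
  ultimately have "finite ?C" using finite_subset[of ?C "Pow V"] by auto
  moreover have "?C \<noteq> {}" using R' by blast
  ultimately obtain T where T0: "T \<in> ?C" and T1: "\<forall>Q\<in>?C. Q \<subseteq> T \<longrightarrow> T = Q"
    using finite_has_minimal[of ?C] by (elim meta_impE bexE) metis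
  have "T \<subseteq> Q" if "Q \<in> insert V \<tau>" "R \<subset> Q" for Q
  proof -
    have "Q \<inter> T \<noteq> {}" using that T0 R' by blast
    moreover have "Q \<in> B" "T \<in> B" using that T0 \<tau> V by auto
    ultimately have "Q \<subseteq> T \<or> T \<subseteq> Q"
      using nested_comparable[OF bs nV, of Q T] that(1) T0 by simp
    then show ?thesis using T1 that by blast
  qed
  then show thesis using that[of T] T0 by simp
qed

lemma moment_in_facet_iff:
  assumes cb: "connected_building_set V B" and y: "y \<in> cubes V B" and \<beta>: "\<forall>i. \<beta> i > 0"
    and R: "R \<in> B - {V}"
  shows "moment B \<beta> y \<in> nesto_facet B R \<longleftrightarrow> y $ R = 0"
proof -
  have bs: "building_set V B" and V: "V \<in> B" using cb by (auto simp: connected_building_set_def)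
  have "moment B \<beta> y \<in> nesto_facet B R \<longleftrightarrow>
      (\<forall>T\<in>B. \<not> T \<subseteq> R \<longrightarrow> (\<forall>i\<in>R. bary \<beta> T y $ i = 0))"
    unfolding nesto_facet_def using moment_in_nestohedron[OF y \<beta>]
      sum_ge_card_bs_restrict(2)[where s="\<lambda>T. bary \<beta> T y" and R=R, OF bary_in_hull[OF y _ \<beta>]]
    by (simp add: moment_def)
  also have "\<dots> \<longleftrightarrow> y $ R = 0"
  proof
    assume "y $ R = 0"
    then have "bary \<beta> T y $ i = 0" if "T \<in> B" "\<not> T \<subseteq> R" "i \<in> R" for T i
    proof (cases "i \<in> T")
      case True
      then show ?thesis using bary_zero_iff[OF y that(1) \<beta> True] that \<open>y $ R = 0\<close> by blast
    qed (simp add: bary_def)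
    then show "\<forall>T\<in>B. \<not> T \<subseteq> R \<longrightarrow> (\<forall>i\<in>R. bary \<beta> T y $ i = 0)" by blast
  next
    assume a: "\<forall>T\<in>B. \<not> T \<subseteq> R \<longrightarrow> (\<forall>i\<in>R. bary \<beta> T y $ i = 0)"
    show "y $ R = 0"
    proof (rule ccontr)
      assume yR: "y $ R \<noteq> 0"
      \<comment> \<open>T will be the least set strictly above R among V and the zero sets of y. The
        summand at T cannot vanish on all of R: a zero at the index i needs a zero set Q that
        contains i, hence R, but not T. As y_R is nonzero, Q lies strictly above R, against the
        choice of T.\<close>
      let ?N = "{Q. y $ Q = 0}"
      have N: "nested B ?N" "?N \<subseteq> B - {V}"
        using y nested_subset[of B "{T. y $ T < 1}" ?N]
        by (auto simp: cubes_def subset_iff)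
      obtain T where T: "T \<in> insert V ?N" "R \<subset> T"
          "\<And>Q. Q \<in> insert V ?N \<Longrightarrow> R \<subset> Q \<Longrightarrow> T \<subseteq> Q"
        using nested_parent[OF cb N(1) _ R] N(2) by blast
      obtain i where i: "i \<in> R" "\<And>Q. y $ Q = 0 \<Longrightarrow> i \<in> Q \<Longrightarrow> R \<subseteq> Q"
        using N(1) R by (auto simp: nested_def)
      have TB: "T \<in> B" using T(1) N(2) V by blast
      then have "bary \<beta> T y $ i = 0" using a T(2) i(1) by blast
      then obtain Q where "i \<in> Q" "\<not> T \<subseteq> Q" "y $ Q = 0"
        using bary_zero_iff[OF y TB \<beta>] i(1) T(2) by blast
      then show False using i(2)[of Q] T(3)[of Q] yR by blast
    qed
  qed
  finally show ?thesis .
qed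

section \<open>Injectivity of the moment map\<close>

lemma diff_mult_ln_diff_nonneg:
  fixes a b :: real
  assumes "a > 0" "b > 0"
  shows "(a - b) * (ln a - ln b) \<ge> 0"
    and "(a - b) * (ln a - ln b) = 0 \<longleftrightarrow> a = b"
  using assms by (auto simp: mult_nonneg_nonneg mult_nonpos_nonpos linear zero_le_mult_iff)

text \<open>Restores the factors cancelled in \<open>num\<close>: the numerator depends on i alone
  and, for i in T, the denominator on T alone. Leaving out the zero coordinates is harmless, as
  those at sets containing i also contain T.\<close>

lemma num_eq_exp:
  assumes y: "y \<in> cubes V B" and nz: "num T y i \<noteq> 0"
  shows "num T y i = exp (\<Sum>R | i \<in> R \<and> y $ R \<noteq> 0. ln (y $ R)) /
      exp (\<Sum>R | T \<subseteq> R \<and> i \<in> R \<and> y $ R \<noteq> 0. ln (y $ R))"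
proof -
  have pos: "y $ R > 0" if "y $ R \<noteq> 0" for R
    using y that by (auto simp: cubes_def order_less_le)
  have nz': "y $ R \<noteq> 0" if "i \<in> R" "\<not> T \<subseteq> R" for R
    using nz that by (auto simp: num_zero_iff)
  have "{R. i \<in> R \<and> y $ R \<noteq> 0} = {R. i \<in> R \<and> \<not> T \<subseteq> R} \<union> {R. T \<subseteq> R \<and> i \<in> R \<and> y $ R \<noteq> 0}"
    using nz' by auto
  then have "(\<Sum>R | i \<in> R \<and> y $ R \<noteq> 0. ln (y $ R)) =
      (\<Sum>R | i \<in> R \<and> \<not> T \<subseteq> R. ln (y $ R)) + (\<Sum>R | T \<subseteq> R \<and> i \<in> R \<and> y $ R \<noteq> 0. ln (y $ R))"
    by (simp add: sum.union_disjoint[symmetric] Int_def)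
  moreover have "num T y i = exp (\<Sum>R | i \<in> R \<and> \<not> T \<subseteq> R. ln (y $ R))"
    unfolding num_def using nz' pos by (simp add: exp_sum)
  ultimately show ?thesis by (simp add: exp_add)
qed

text \<open>Up to a constant depending on T, the logarithms are the coordinates of one vector that
  is the same for all summands. This lets the summands be added up in the pairing below.\<close>

lemma ln_bary:
  assumes y: "y \<in> cubes V B" and T: "T \<in> B" and \<beta>: "\<forall>i. \<beta> i > 0"
  shows "\<exists>c. \<forall>i\<in>T. bary \<beta> T y $ i \<noteq> 0 \<longrightarrow>
    ln (bary \<beta> T y $ i) = ln (\<beta> i) + (\<Sum>R | i \<in> R \<and> y $ R \<noteq> 0. ln (y $ R)) + c"
proof -
  let ?d = "\<Sum>k\<in>T. \<beta> k * num T y k"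
  let ?e = "\<Sum>R | T \<subseteq> R \<and> y $ R \<noteq> 0. ln (y $ R)"
  have d: "?d > 0" by (rule bary_denom_pos[OF y T \<beta>])
  have "ln (bary \<beta> T y $ i) =
      ln (\<beta> i) + (\<Sum>R | i \<in> R \<and> y $ R \<noteq> 0. ln (y $ R)) + (- ?e - ln ?d)"
    if i: "i \<in> T" "bary \<beta> T y $ i \<noteq> 0" for i
  proof -
    have b: "bary \<beta> T y $ i = \<beta> i * num T y i / ?d" using i(1) by (simp add: bary_def)
    then have nz: "num T y i \<noteq> 0" using i(2) by auto
    have "{R. T \<subseteq> R \<and> i \<in> R \<and> y $ R \<noteq> 0} = {R. T \<subseteq> R \<and> y $ R \<noteq> 0}" using i(1) by auto
    then have e: "num T y i = exp (\<Sum>R | i \<in> R \<and> y $ R \<noteq> 0. ln (y $ R)) / exp ?e"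
      using num_eq_exp[OF y nz] by simp
    have "\<beta> i > 0" using \<beta> by simp
    then show ?thesis using d unfolding b e
      by (simp add: ln_div ln_mult)
  qed
  then show ?thesis by (intro exI[of _ "- ?e - ln ?d"]) simp
qed

text \<open>
  Pairing the difference of the two moments with the difference of the logarithms of the
  homogeneous coordinates gives a sum of terms \<open>(a - b) * (ln a - ln b)\<close>, all of which must vanish.
\<close>

lemma moment_eq_imp_bary_eq:
  assumes cb: "connected_building_set V B" and y: "y \<in> cubes V B" and z: "z \<in> cubes V B"
    and \<beta>: "\<forall>i. \<beta> i > 0" and eq: "moment B \<beta> y = moment B \<beta> z" and T: "T \<in> B"
  shows "bary \<beta> T y = bary \<beta> T z"
proof -
  \<comment> \<open>Both points lie on the same facets, so the same coordinates vanish and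
    logarithms are only compared where both arguments are positive.\<close>
  have zero: "y $ R = 0 \<longleftrightarrow> z $ R = 0" for R
  proof (cases "R \<in> B - {V}")
    case True
    then show ?thesis using moment_in_facet_iff[OF cb y \<beta>] moment_in_facet_iff[OF cb z \<beta>] eq by metis
  next
    case False
    then have "y $ R = 1" "z $ R = 1" using y z by (simp_all add: cubes_def)
    then show ?thesis by simp
  qed
  define w where "w = (\<lambda>i. (\<Sum>R | i \<in> R \<and> y $ R \<noteq> 0. ln (y $ R)) - (\<Sum>R | i \<in> R \<and> z $ R \<noteq> 0. ln (z $ R)))"
  let ?a = "\<lambda>T i. bary \<beta> T y $ i" and ?b = "\<lambda>T i. bary \<beta> T z $ i"
  have nn: "0 \<le> ?a T i" "0 \<le> ?b T i" if "T \<in> B" for T i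
    using bary_in_hull[OF y that \<beta>] bary_in_hull[OF z that \<beta>] by (auto simp: mem_axis_hull_iff)
  have z0: "?a T i = 0 \<longleftrightarrow> ?b T i = 0" if "T \<in> B" for T i
    using bary_zero_iff[OF y that \<beta>] bary_zero_iff[OF z that \<beta>] zero
    by (cases "i \<in> T") (auto simp: bary_def)
  \<comment> \<open>The constants of \<open>ln_bary\<close> contribute (c - d) times the difference
    of two coordinate sums, both of which are 1.\<close>
  have pair: "(\<Sum>i\<in>UNIV. (?a T i - ?b T i) * w i) =
      (\<Sum>i\<in>UNIV. (?a T i - ?b T i) * (ln (?a T i) - ln (?b T i)))" if TB: "T \<in> B" for T
  proof -
    obtain c where c: "\<forall>i\<in>T. ?a T i \<noteq> 0 \<longrightarrow>
        ln (?a T i) = ln (\<beta> i) + (\<Sum>R | i \<in> R \<and> y $ R \<noteq> 0. ln (y $ R)) + c"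
      using ln_bary[OF y TB \<beta>] ..
    obtain d where d: "\<forall>i\<in>T. ?b T i \<noteq> 0 \<longrightarrow>
        ln (?b T i) = ln (\<beta> i) + (\<Sum>R | i \<in> R \<and> z $ R \<noteq> 0. ln (z $ R)) + d"
      using ln_bary[OF z TB \<beta>] ..
    have "(?a T i - ?b T i) * (ln (?a T i) - ln (?b T i)) =
        (?a T i - ?b T i) * w i + (c - d) * (?a T i - ?b T i)" for i
    proof (cases "i \<in> T \<and> ?a T i \<noteq> 0")
      case True
      then have "ln (?a T i) - ln (?b T i) = w i + (c - d)"
        using c d z0[OF TB, of i] by (simp add: w_def)
      then show ?thesis by (simp only: distrib_left mult.commute[of "c - d"])
    next
      case False
      then have "?a T i = 0" "?b T i = 0" using z0[OF TB, of i] by (auto simp: bary_def)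
      then show ?thesis by simp
    qed
    then have "(\<Sum>i\<in>UNIV. (?a T i - ?b T i) * (ln (?a T i) - ln (?b T i))) =
        (\<Sum>i\<in>UNIV. (?a T i - ?b T i) * w i) + (c - d) * ((\<Sum>i\<in>UNIV. ?a T i) - (\<Sum>i\<in>UNIV. ?b T i))"
      by (simp only: sum.distrib sum_distrib_left[symmetric] sum_subtractf[symmetric])
    moreover have "(\<Sum>i\<in>UNIV. ?a T i) = (\<Sum>i\<in>T. ?a T i)" "(\<Sum>i\<in>UNIV. ?b T i) = (\<Sum>i\<in>T. ?b T i)"
      by (simp_all add: bary_def sum.If_cases)
    moreover have "(\<Sum>i\<in>T. ?a T i) = 1" "(\<Sum>i\<in>T. ?b T i) = 1"
      using bary_in_hull[OF y TB \<beta>] bary_in_hull[OF z TB \<beta>] by (auto simp: mem_axis_hull_iff)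
    ultimately show ?thesis by simp
  qed
  have pos: "0 \<le> (?a T i - ?b T i) * (ln (?a T i) - ln (?b T i))" 
    "(?a T i - ?b T i) * (ln (?a T i) - ln (?b T i)) = 0 \<Longrightarrow> ?a T i = ?b T i" if "T \<in> B" for T i
    using diff_mult_ln_diff_nonneg[of "?a T i" "?b T i"] nn[OF that, of i] z0[OF that, of i]
    by (cases "?a T i = 0"; simp)+
  \<comment> \<open>Since w does not depend on T, summing over T leaves the pairing of w with the
    difference of the two moments.\<close>
  have "(\<Sum>T\<in>B. \<Sum>i\<in>UNIV. (?a T i - ?b T i) * (ln (?a T i) - ln (?b T i))) =
      (\<Sum>T\<in>B. \<Sum>i\<in>UNIV. (?a T i - ?b T i) * w i)"
    using pair by simp
  also have "\<dots> = (\<Sum>i\<in>UNIV. (\<Sum>T\<in>B. ?a T i - ?b T i) * w i)"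
    by (subst sum.swap) (simp add: sum_distrib_right)
  also have "\<dots> = (\<Sum>i\<in>UNIV. (moment B \<beta> y $ i - moment B \<beta> z $ i) * w i)"
    by (simp add: moment_def sum_subtractf)
  also have "\<dots> = 0" using eq by simp
  finally have "\<forall>T\<in>B. (\<Sum>i\<in>UNIV. (?a T i - ?b T i) * (ln (?a T i) - ln (?b T i))) = 0"
    by (subst (asm) sum_nonneg_eq_0_iff) (auto intro!: sum_nonneg pos(1))
  then have "(\<Sum>i\<in>UNIV. (?a T i - ?b T i) * (ln (?a T i) - ln (?b T i))) = 0" using T by blast
  then have "\<forall>i\<in>UNIV. (?a T i - ?b T i) * (ln (?a T i) - ln (?b T i)) = 0"
    by (subst (asm) sum_nonneg_eq_0_iff) (auto intro!: pos(1)[OF T])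
  then show ?thesis using pos(2)[OF T] by (simp add: vec_eq_iff)
qed

text \<open>Equal barycentric coordinates make the two families proportional; both have maximum 1
  over T, so the factor is 1.\<close>

lemma bary_eq_imp_num_eq:
  assumes y: "y \<in> cubes V B" and z: "z \<in> cubes V B"
    and \<beta>: "\<forall>i. \<beta> i > 0" and T: "T \<in> B" and eq: "bary \<beta> T y = bary \<beta> T z" and i: "i \<in> T"
  shows "num T y i = num T z i"
proof -
  let ?d = "\<Sum>k\<in>T. \<beta> k * num T y k" and ?e = "\<Sum>k\<in>T. \<beta> k * num T z k"
  have de: "?d > 0" "?e > 0" using bary_denom_pos[OF y T \<beta>] bary_denom_pos[OF z T \<beta>] .
  have k: "num T y k = num T z k * (?d / ?e)" if "k \<in> T" for k
  proof -
    have "\<beta> k \<noteq> 0" using \<beta> by (metis less_irrefl)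
    moreover have "\<beta> k * num T y k / ?d = \<beta> k * num T z k / ?e"
      using arg_cong[OF eq, of "\<lambda>x. x $ k"] that by (simp add: bary_def)
    ultimately show ?thesis using de by (simp add: field_simps)
  qed
  obtain k l where kl: "k \<in> T" "num T y k = 1" "l \<in> T" "num T z l = 1"
    using num_eq_1[OF y T] num_eq_1[OF z T] by blast
  have "1 \<le> ?d / ?e"
  proof -
    have "1 = num T z k * (?d / ?e)" using k[OF kl(1)] unfolding kl(2) .
    also have "\<dots> \<le> 1 * (?d / ?e)"
      using de num_le_1[OF z, of T k] by (intro mult_right_mono) auto
    finally show ?thesis by simp
  qed
  moreover have "?d / ?e \<le> 1"
    using k[OF kl(3)] num_le_1[OF y, of T l] unfolding kl(4) by linarith
  ultimately show ?thesis using k[OF i] by simp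
qed

lemma num_mult:
  assumes "R \<subseteq> T" "i \<in> R"
  shows "num T y i = num R y i * (\<Prod>Q | R \<subseteq> Q \<and> \<not> T \<subseteq> Q. y $ Q)"
proof -
  have "{Q. i \<in> Q \<and> \<not> T \<subseteq> Q} = {Q. i \<in> Q \<and> \<not> R \<subseteq> Q} \<union> {Q. R \<subseteq> Q \<and> \<not> T \<subseteq> Q}"
    using assms by auto
  moreover have "{Q. i \<in> Q \<and> \<not> R \<subseteq> Q} \<inter> {Q. R \<subseteq> Q \<and> \<not> T \<subseteq> Q} = {}" by auto
  ultimately show ?thesis
    by (simp add: num_def prod.union_disjoint)
qed

text \<open>By \<open>num_mult\<close> and \<open>num_eq_1\<close>, the product is the maximum of
  \<open>num T y i\<close> over i in R, hence determined by these numbers.\<close>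

lemma prod_eq_of_num_eq:
  assumes y: "y \<in> cubes V B" and z: "z \<in> cubes V B" and RT: "R \<in> B" "R \<subseteq> T"
    and eq: "\<And>i. i \<in> T \<Longrightarrow> num T y i = num T z i"
  shows "(\<Prod>Q | R \<subseteq> Q \<and> \<not> T \<subseteq> Q. y $ Q) = (\<Prod>Q | R \<subseteq> Q \<and> \<not> T \<subseteq> Q. z $ Q)"
    (is "?p = ?q")
proof -
  obtain k l where kl: "k \<in> R" "num R y k = 1" "l \<in> R" "num R z l = 1"
    using num_eq_1[OF y RT(1)] num_eq_1[OF z RT(1)] by blast
  have pq: "0 \<le> ?p" "0 \<le> ?q" using y z by (auto simp: cubes_def intro!: prod_nonneg)
  have "?p = num R z k * ?q"
    using eq[of k] num_mult[OF RT(2) kl(1), of y] num_mult[OF RT(2) kl(1), of z] kl RT(2) by auto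
  also have "\<dots> \<le> ?q" using num_le_1[OF z, of R k] pq by (simp add: mult_left_le_one_le num_nonneg[OF z])
  finally have "?p \<le> ?q" .
  moreover have "?q = num R y l * ?p"
    using eq[of l] num_mult[OF RT(2) kl(3), of y] num_mult[OF RT(2) kl(3), of z] kl RT(2) by auto
  then have "?q \<le> ?p" using num_le_1[OF y, of R l] pq by (simp add: mult_left_le_one_le num_nonneg[OF y])
  ultimately show ?thesis by simp
qed

text \<open>Coordinates are recovered from large sets down to small ones. With T the parent of R
  among the zero sets, \<open>prod_eq_of_num_eq\<close> fixes a product in which all factors but y_R
  are known by induction, and nonzero by the choice of T.\<close>

lemma moment_inj_on:
  assumes cb: "connected_building_set V B" and \<beta>: "\<forall>i. \<beta> i > 0"
  shows "inj_on (moment B \<beta>) (cubes V B)"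
proof
  fix y z assume y: "y \<in> cubes V B" and z: "z \<in> cubes V B" and eq: "moment B \<beta> y = moment B \<beta> z"
  have V: "V \<in> B" using cb by (rule connected_building_set_top)
  have num: "num T y i = num T z i" if "T \<in> B" "i \<in> T" for T i
    using bary_eq_imp_num_eq[OF y z \<beta> that(1) _ that(2)] moment_eq_imp_bary_eq[OF cb y z \<beta> eq that(1)]
    by blast
  have "y $ R = z $ R" for R
  proof (induction "card (UNIV - R)" arbitrary: R rule: less_induct)
    case less
    show ?case
    proof (cases "R \<in> B - {V}")
      case False
      then have "y $ R = 1" "z $ R = 1" using y z by (simp_all add: cubes_def)
      then show ?thesis by simp
    next
      case True
      let ?N = "{Q. y $ Q = 0}"
      have N: "nested B ?N" "?N \<subseteq> B - {V}"
        using y nested_subset[of B "{T. y $ T < 1}" ?N] by (auto simp: cubes_def subset_iff)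
      obtain T where T: "T \<in> insert V ?N" "R \<subset> T"
          "\<And>Q. Q \<in> insert V ?N \<Longrightarrow> R \<subset> Q \<Longrightarrow> T \<subseteq> Q"
        using nested_parent[OF cb N(1) _ True] N(2) by blast
      have TB: "T \<in> B" using T(1) N(2) V by blast
      have IH: "y $ Q = z $ Q" if "R \<subset> Q" for Q
        by (rule less) (use that in \<open>auto intro!: psubset_card_mono\<close>)
      let ?s = "{Q. R \<subset> Q \<and> \<not> T \<subseteq> Q}"
      have s: "{Q. R \<subseteq> Q \<and> \<not> T \<subseteq> Q} = insert R ?s" using T(2) by auto
      have "(\<Prod>Q\<in>insert R ?s. y $ Q) = (\<Prod>Q\<in>insert R ?s. z $ Q)"
        using prod_eq_of_num_eq[OF y z _ _ num[OF TB], of R] True T(2) unfolding s by blast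
      then have "y $ R * (\<Prod>Q\<in>?s. y $ Q) = z $ R * (\<Prod>Q\<in>?s. y $ Q)"
        using IH by simp
      moreover have "(\<Prod>Q\<in>?s. y $ Q) \<noteq> 0" using T(3) by auto
      ultimately show ?thesis by simp
    qed
  qed
  then show "y = z" by (simp add: vec_eq_iff)
qed

section \<open>Surjectivity of the moment map: the cones of nested sets cover the orthant, and
  positive weights are realised\<close>

lemma nested_decomposition:
  fixes w :: "'v::finite \<Rightarrow> real"
  assumes bs: "building_set V B" and nn: "\<And>i. i \<in> V \<Longrightarrow> 0 \<le> w i"
  shows "\<exists>u. (\<forall>T. 0 \<le> u T) \<and> (\<forall>T. u T \<noteq> 0 \<longrightarrow> T \<in> B \<and> T \<subseteq> {i \<in> V. 0 < w i}) \<and>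
    nested B {T. u T \<noteq> 0} \<and> (\<forall>i\<in>V. w i = (\<Sum>T | i \<in> T. u T))"
  using nn
proof (induction "card {i \<in> V. 0 < w i}" arbitrary: w rule: less_induct)
  case less
  let ?A = "\<lambda>w. {i \<in> V. (0::real) < w i}"
  show ?case
  proof (cases "?A w = {}")
    case True
    then have "w i = 0" if "i \<in> V" for i using less.prems[OF that] that by force
    moreover have "nested B {}" using building_set_nonempty[OF bs] by (auto simp: nested_def)
    ultimately show ?thesis by (intro exI[of _ "\<lambda>_. 0"]) auto
  next
    case False
    let ?C = "{T \<in> B. T \<subseteq> ?A w}"
    obtain x where "x \<in> ?A w" using False by blast
    then have "{x} \<in> ?C" using building_set_singleton[OF bs, of x] by simp
    then have "?C \<noteq> {}" by blast
    moreover have "finite ?C" by simp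
    \<comment> \<open>A greedy step: the minimum of w on a maximal element T of the building set
      inside the support is subtracted from w on T, which shrinks the support.\<close>
    ultimately obtain T where T0: "T \<in> ?C" and T1: "\<forall>Q\<in>?C. T \<subseteq> Q \<longrightarrow> T = Q"
      using finite_has_maximal[of ?C] by (elim meta_impE bexE) metis
    have T: "T \<in> B" "T \<subseteq> ?A w" "T \<noteq> {}" "T \<subseteq> V"
      using T0 building_set_nonempty[OF bs] by auto
    define \<mu> where "\<mu> = Min (w ` T)"
    have "\<mu> \<in> w ` T" unfolding \<mu>_def using T(3) by (intro Min_in) auto
    then obtain i0 where i0: "i0 \<in> T" "w i0 = \<mu>" by blast
    have \<mu>: "\<mu> > 0" using i0 T(2) by auto
    have \<mu>_le: "\<mu> \<le> w i" if "i \<in> T" for i using that by (simp add: \<mu>_def)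
    define w' where "w' = (\<lambda>i. if i \<in> T then w i - \<mu> else w i)"
    have sub: "?A w' \<subseteq> ?A w" using \<mu> by (auto simp: w'_def split: if_splits)
    have "i0 \<in> ?A w - ?A w'" using i0 T(2) by (auto simp: w'_def)
    then have "card (?A w') < card (?A w)" using sub by (intro psubset_card_mono) auto
    moreover have "0 \<le> w' i" if "i \<in> V" for i
      using \<mu>_le[of i] less.prems[OF that] by (simp add: w'_def)
    ultimately have "\<exists>u. (\<forall>T. 0 \<le> u T) \<and> (\<forall>T. u T \<noteq> 0 \<longrightarrow> T \<in> B \<and> T \<subseteq> ?A w') \<and>
        nested B {T. u T \<noteq> 0} \<and> (\<forall>i\<in>V. w' i = (\<Sum>T | i \<in> T. u T))" (is "\<exists>u. ?Q u")
      by (rule less.hyps)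
    then obtain u where "?Q u" ..
    then have u: "\<forall>T. 0 \<le> u T" "\<forall>T. u T \<noteq> 0 \<longrightarrow> T \<in> B \<and> T \<subseteq> ?A w'"
      "nested B {T. u T \<noteq> 0}" "\<forall>i\<in>V. w' i = (\<Sum>T | i \<in> T. u T)" by simp_all
    define u' where "u' = (\<lambda>Q. u Q + (if Q = T then \<mu> else 0))"
    have u'0: "u' Q \<noteq> 0 \<longleftrightarrow> u Q \<noteq> 0 \<or> Q = T" for Q
      using u(1)[rule_format, of Q] \<mu> by (cases "Q = T") (simp_all add: u'_def)
    have sum: "w i = (\<Sum>Q | i \<in> Q. u' Q)" if "i \<in> V" for i
    proof -
      have "(\<Sum>Q | i \<in> Q. u' Q) = w' i + (\<Sum>Q | i \<in> Q. if Q = T then \<mu> else 0)"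
        using u(4) that by (simp add: u'_def sum.distrib)
      then show ?thesis by (simp add: w'_def sum.delta)
    qed
    have "nested B {Q. u' Q \<noteq> 0}"
      unfolding nested_def
    proof
      fix R assume R: "R \<in> B"
      obtain i where i: "i \<in> R" "\<And>Q. u Q \<noteq> 0 \<Longrightarrow> i \<in> Q \<Longrightarrow> R \<subseteq> Q"
        using u(3) R by (auto simp: nested_def)
      show "\<exists>i\<in>R. \<forall>Q\<in>{Q. u' Q \<noteq> 0}. i \<in> Q \<longrightarrow> R \<subseteq> Q"
      proof (cases "R \<subseteq> T \<or> R \<inter> T = {}")
        case True
        then show ?thesis using i by (intro bexI[of _ i]) (auto simp: u'0)
      next
        case False
        \<comment> \<open>By maximality of T the union leaves the support of w, so R has a point
          outside it. All sets in use lie inside the support and miss that point.\<close>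
        then have "R \<union> T \<in> B" using building_set_Un[OF bs R T(1)] by blast
        then have "\<not> R \<union> T \<subseteq> ?A w" using T1 False by blast
        then obtain k where k: "k \<in> R" "k \<notin> ?A w" using T(2) by blast
        then have "k \<notin> Q" if "u' Q \<noteq> 0" for Q
          using that u(2) sub T(2) unfolding u'0 by blast
        then show ?thesis using k(1) by blast
      qed
    qed
    moreover have "\<forall>Q. u' Q \<noteq> 0 \<longrightarrow> Q \<in> B \<and> Q \<subseteq> ?A w"
      using u(2) sub T(1,2) unfolding u'0 by blast
    moreover have "\<forall>Q. 0 \<le> u' Q" using u(1) \<mu> by (simp add: u'_def)
    ultimately show ?thesis using sum by blast
  qed
qed

text \<open>Logarithms turn the factorisation into \<open>nested_decomposition\<close>. Dividing by
  the maximum c makes - ln (q / c) nonnegative with a zero in V, so V receives the coefficient 0 and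
  its coordinate is 1, as \<open>cubes\<close> demands.\<close>

lemma cubes_of_weights:
  fixes q :: "'v::finite \<Rightarrow> real"
  assumes cb: "connected_building_set V B" and q': "\<forall>i. q i > 0"
  obtains y c where "y \<in> cubes V B" "\<And>T. y $ T > 0" "c > 0" "\<And>i. i \<in> V \<Longrightarrow> q i = c * (\<Prod>T | i \<in> T. y $ T)"
proof -
  have q: "q i > 0" for i using q' by simp
  have bs: "building_set V B" using cb by (rule connected_building_set_imp)
  then have V: "V \<noteq> {}" by (auto simp: building_set_def)
  define c where "c = Max (q ` V)"
  have "c \<in> q ` V" unfolding c_def using V by (intro Max_in) auto
  then obtain k where k: "k \<in> V" "q k = c" by blast
  have le: "q i \<le> c" if "i \<in> V" for i using that by (simp add: c_def)
  have c: "c > 0" using k q[of k] by simp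
  have "0 \<le> ln c - ln (q i)" if "i \<in> V" for i using le[OF that] q[of i] c by simp
  then have "\<exists>u. (\<forall>T. 0 \<le> u T) \<and>
      (\<forall>T. u T \<noteq> 0 \<longrightarrow> T \<in> B \<and> T \<subseteq> {i \<in> V. 0 < ln c - ln (q i)}) \<and>
      nested B {T. u T \<noteq> 0} \<and> (\<forall>i\<in>V. ln c - ln (q i) = (\<Sum>T | i \<in> T. u T))" (is "\<exists>u. ?Q u")
    by (rule nested_decomposition[OF bs])
  then obtain u where "?Q u" ..
  then have u: "\<forall>T. 0 \<le> u T"
    "\<forall>T. u T \<noteq> 0 \<longrightarrow> T \<in> B \<and> T \<subseteq> {i \<in> V. 0 < ln c - ln (q i)}"
    "nested B {T. u T \<noteq> 0}" "\<forall>i\<in>V. ln c - ln (q i) = (\<Sum>T | i \<in> T. u T)"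
    by simp_all
  have uV: "u V = 0" using u(2) k by force
  have u0: "u T = 0" if "T \<notin> B - {V}" for T using u(2) uV that by blast
  define y :: "real ^ ('v set)" where "y = (\<chi> T. exp (- u T))"
  have lt: "y $ T < 1 \<longleftrightarrow> u T \<noteq> 0" for T
    using u(1)[rule_format, of T] by (simp add: y_def order_less_le)
  have "nested B {T. y $ T < 1}" using u(3) by (simp only: lt)
  then have "y \<in> cubes V B" unfolding cubes_def by (simp add: y_def u0 u(1))
  moreover have "q i = c * (\<Prod>T | i \<in> T. y $ T)" if "i \<in> V" for i
  proof -
    have "(\<Prod>T | i \<in> T. y $ T) = exp (- (\<Sum>T | i \<in> T. u T))"
      by (simp add: y_def exp_sum[symmetric] sum_negf)
    also have "\<dots> = exp (ln (q i) - ln c)" using u(4) that by (metis minus_diff_eq)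
    also have "\<dots> = q i / c" using c q[of i] by (simp add: exp_diff)
    finally show ?thesis using c by simp
  qed
  ultimately show thesis using that[of y c] c by (simp add: y_def)
qed

text \<open>The quotients q / \<beta> are factored. The constant c and the y_R with T \<subseteq> R
  occur for all indices in T alike and cancel.\<close>

lemma bary_of_weights:
  fixes q :: "'v::finite \<Rightarrow> real"
  assumes cb: "connected_building_set V B" and q: "\<forall>i. q i > 0" and \<beta>: "\<forall>i. \<beta> i > 0"
  obtains y where "y \<in> cubes V B"
    "\<And>T. T \<in> B \<Longrightarrow> bary \<beta> T y = (\<chi> i. if i \<in> T then q i / (\<Sum>k\<in>T. q k) else 0)"
proof -
  obtain y c where y: "y \<in> cubes V B" "\<And>T. y $ T > 0" "c > 0"
    "\<And>i. i \<in> V \<Longrightarrow> q i / \<beta> i = c * (\<Prod>T | i \<in> T. y $ T)"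
    by (rule cubes_of_weights[OF cb, of "\<lambda>i. q i / \<beta> i"]) (use q \<beta> in auto)
  have "bary \<beta> T y = (\<chi> i. if i \<in> T then q i / (\<Sum>k\<in>T. q k) else 0)" if T: "T \<in> B" for T
  proof -
    have TV: "T \<subseteq> V" using T connected_building_set_imp[OF cb] building_set_subset by blast
    define p where "p = c * (\<Prod>R | T \<subseteq> R. y $ R)"
    have p: "p > 0" using y(2,3) by (simp add: p_def prod_pos)
    have qi: "q i = p * (\<beta> i * num T y i)" if i: "i \<in> T" for i
    proof -
      have "{R. i \<in> R} = {R. i \<in> R \<and> \<not> T \<subseteq> R} \<union> {R. T \<subseteq> R}" using i by auto
      then have "(\<Prod>R | i \<in> R. y $ R) = num T y i * (\<Prod>R | T \<subseteq> R. y $ R)"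
        by (simp add: num_def prod.union_disjoint[symmetric] Int_def)
      moreover have "\<beta> i \<noteq> 0" using \<beta> by (metis less_irrefl)
      ultimately show ?thesis using y(4)[of i] i TV by (auto simp: p_def field_simps)
    qed
    have "(\<Sum>k\<in>T. q k) = p * (\<Sum>k\<in>T. \<beta> k * num T y k)"
      by (simp add: qi sum_distrib_left)
    then show ?thesis using p by (auto simp: bary_def vec_eq_iff qi)
  qed
  then show thesis by (rule that[OF y(1)])
qed

text \<open>The logarithm dominates every - x i, hence also their convex combinations.\<close>

lemma ln_sum_exp_ge:
  fixes x :: "'v::finite \<Rightarrow> real"
  assumes T: "T \<noteq> {}" and s: "\<And>i. i \<in> T \<Longrightarrow> 0 \<le> s i" "(\<Sum>i\<in>T. s i) = 1"
  shows "0 \<le> (\<Sum>i\<in>T. s i * x i) + ln (\<Sum>k\<in>T. exp (- x k))"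
proof -
  let ?L = "ln (\<Sum>k\<in>T. exp (- x k))"
  have "- x i \<le> ?L" if "i \<in> T" for i
  proof -
    have "exp (- x i) \<le> (\<Sum>k\<in>T. exp (- x k))" using that by (intro member_le_sum) auto
    then have "ln (exp (- x i)) \<le> ?L" by (subst ln_le_cancel_iff) (auto intro: less_le_trans[OF exp_gt_zero])
    then show ?thesis by simp
  qed
  then have "(\<Sum>i\<in>T. s i * (- x i)) \<le> (\<Sum>i\<in>T. s i * ?L)"
    by (intro sum_mono mult_left_mono s(1))
  also have "\<dots> = ?L" using s(2) by (simp add: sum_distrib_right[symmetric])
  finally show ?thesis by (simp add: sum_negf)
qed

text \<open>
  The weights \<open>q\<close> come from a minimum of the convex function
  \<open>w \<mapsto> \<langle>x, w\<rangle> + (\<Sum>T\<in>B. ln (\<Sum>k\<in>T. exp (- w k)))\<close>, where \<open>x\<close> is the given point; positivity of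
  the barycentric coordinates makes it proper modulo constants.
\<close>

lemma weights_of_positive_bary:
  fixes s :: "'v::finite set \<Rightarrow> real ^ 'v"
  assumes cb: "connected_building_set V B"
    and s: "\<And>T. T \<in> B \<Longrightarrow> s T \<in> convex hull ((\<lambda>i. axis i 1) ` T)"
    and pos: "\<And>T i. T \<in> B \<Longrightarrow> i \<in> T \<Longrightarrow> s T $ i > 0"
  shows "\<exists>q. (\<forall>i. q i > 0) \<and>
    (\<Sum>T\<in>B. s T) = (\<Sum>T\<in>B. \<chi> i. if i \<in> T then q i / (\<Sum>k\<in>T. q k) else 0)"
proof -
  have bs: "building_set V B" and V: "V \<in> B" "V \<noteq> {}"
    using cb by (auto simp: connected_building_set_def building_set_def)
  define F where "F = (\<lambda>T (w :: real ^ 'v). (\<Sum>i\<in>T. s T $ i * w $ i) + ln (\<Sum>k\<in>T. exp (- w $ k)))"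
  define f where "f = (\<lambda>w. \<Sum>T\<in>B. F T w)"
  have s1: "(\<Sum>i\<in>T. s T $ i) = 1" "0 \<le> s T $ i" if "T \<in> B" for T i
    using s[OF that] by (auto simp: mem_axis_hull_iff)
  have ne: "T \<noteq> {}" if "T \<in> B" for T using building_set_nonempty[OF bs that] .
  have F0: "0 \<le> F T w" if "T \<in> B" for T w
    unfolding F_def by (rule ln_sum_exp_ge) (use that s1 ne in auto)
  define d where "d = Min ((\<lambda>i. s V $ i) ` V)"
  have "d \<in> (\<lambda>i. s V $ i) ` V" unfolding d_def using V by (intro Min_in) auto
  then have d: "d > 0" using pos[OF V(1)] by auto
  have d_le: "d \<le> s V $ i" if "i \<in> V" for i using that by (simp add: d_def)
  \<comment> \<open>Shifting the mass d from k to l keeps the summand at V a probability vector;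
    \<open>ln_sum_exp_ge\<close> for the shifted vector yields linear growth of f in every
    coordinate difference.\<close>
  have FV: "d * (w $ k - w $ l) \<le> F V w" if kl: "k \<in> V" "l \<in> V" for w k l
  proof -
    let ?t = "\<lambda>i. s V $ i - (if i = k then d else 0) + (if i = l then d else 0)"
    have "0 \<le> (\<Sum>i\<in>V. ?t i * w $ i) + ln (\<Sum>k\<in>V. exp (- w $ k))"
    proof (rule ln_sum_exp_ge[OF V(2)])
      show "0 \<le> ?t i" if "i \<in> V" for i using d_le[OF that] d by auto
      show "(\<Sum>i\<in>V. ?t i) = 1" using kl s1[OF V(1)] by (simp add: sum.distrib sum_subtractf)
    qed
    also have "(\<Sum>i\<in>V. ?t i * w $ i) = (\<Sum>i\<in>V. s V $ i * w $ i) - d * w $ k + d * w $ l"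
    proof -
      have "(\<Sum>i\<in>V. ?t i * w $ i) = (\<Sum>i\<in>V. s V $ i * w $ i - (if i = k then d * w $ i else 0) +
          (if i = l then d * w $ i else 0))"
        by (intro sum.cong) (auto simp: algebra_simps)
      then show ?thesis using kl by (simp add: sum.distrib sum_subtractf)
    qed
    finally show ?thesis by (simp add: F_def algebra_simps)
  qed
  have f_ge: "d * (w $ k - w $ l) \<le> f w" if "k \<in> V" "l \<in> V" for w k l
  proof -
    have "F V w \<le> f w" unfolding f_def by (rule member_le_sum) (auto simp: V(1) F0)
    then show ?thesis using FV[OF that, of w] by linarith
  qed
  obtain i0 where i0: "i0 \<in> V" using V by blast
  \<comment> \<open>Where f is at most f 0, coordinates with indices in V differ by at most
    M.\<close>
  define M where "M = f 0 / d"
  have M0: "0 \<le> M" using f_ge[OF i0 i0, of 0] d by (simp add: M_def)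
  let ?K = "cbox (\<chi> i. - M) (\<chi> i. M) :: (real ^ 'v) set"
  have "continuous_on ?K f"
    unfolding f_def F_def
    by (intro continuous_intros) (auto simp: sum_pos ne less_imp_neq[symmetric])
  moreover have "0 \<in> ?K" using M0 by (simp add: mem_box_cart)
  then have "?K \<noteq> {}" by blast
  ultimately obtain w where w: "w \<in> ?K" "\<And>v. v \<in> ?K \<Longrightarrow> f w \<le> f v"
    using continuous_attains_inf[of ?K f] by (metis compact_cbox)
  have min: "f w \<le> f v" for v
  proof (cases "f v \<le> f 0")
    case True
    \<comment> \<open>f is unchanged when a constant is added to the coordinates in V, and it
      ignores the others. Normalising both brings v into the box.\<close>
    define v' :: "real ^ 'v" where "v' = (\<chi> i. if i \<in> V then v $ i - v $ i0 else 0)"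
    have "\<bar>v' $ i\<bar> \<le> M" for i
    proof (cases "i \<in> V")
      case True
      have "d * (v $ i - v $ i0) \<le> f 0" "d * (v $ i0 - v $ i) \<le> f 0"
        using f_ge[OF True i0, of v] f_ge[OF i0 True, of v] \<open>f v \<le> f 0\<close> by linarith+
      then have "v $ i - v $ i0 \<le> M" "v $ i0 - v $ i \<le> M"
        using d by (auto simp: M_def field_simps)
      then show ?thesis using True by (simp add: v'_def)
    qed (use M0 in \<open>simp add: v'_def\<close>)
    then have "v' \<in> ?K" by (simp add: mem_box_cart abs_le_iff) (metis minus_le_iff)
    moreover have "F T v' = F T v" if T: "T \<in> B" for T
    proof -
      have TV: "i \<in> V" if "i \<in> T" for i using building_set_subset[OF bs T] that by blast
      have "(\<Sum>i\<in>T. s T $ i * v' $ i) = (\<Sum>i\<in>T. s T $ i * v $ i - s T $ i * v $ i0)"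
        by (intro sum.cong) (auto simp: v'_def TV algebra_simps)
      also have "\<dots> = (\<Sum>i\<in>T. s T $ i * v $ i) - v $ i0"
        using s1[OF T] by (simp add: sum_subtractf sum_distrib_right[symmetric])
      finally have 1: "(\<Sum>i\<in>T. s T $ i * v' $ i) = (\<Sum>i\<in>T. s T $ i * v $ i) - v $ i0" .
      have "(\<Sum>k\<in>T. exp (- v' $ k)) = (\<Sum>k\<in>T. exp (- v $ k) * exp (v $ i0))"
        by (intro sum.cong) (auto simp: v'_def TV exp_add[symmetric])
      also have "\<dots> = (\<Sum>k\<in>T. exp (- v $ k)) * exp (v $ i0)" by (simp add: sum_distrib_right)
      finally have "ln (\<Sum>k\<in>T. exp (- v' $ k)) = ln (\<Sum>k\<in>T. exp (- v $ k)) + v $ i0"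
        using ne[OF T] by (simp add: ln_mult sum_pos less_imp_neq[symmetric])
      with 1 show ?thesis by (simp add: F_def)
    qed
    ultimately show ?thesis using w(2)[of v'] by (simp add: f_def)
  next
    case False
    moreover have "f w \<le> f 0" using M0 by (intro w(2)) (simp add: mem_box_cart)
    ultimately show ?thesis by simp
  qed
  define q where "q = (\<lambda>i. exp (- w $ i))"
  have crit: "(\<Sum>T\<in>B. s T $ i) = (\<Sum>T\<in>B. if i \<in> T then q i / (\<Sum>k\<in>T. q k) else 0)" for i
  proof -
    let ?w = "\<lambda>t k. w $ k + (if k = i then t else 0)"
    define g where "g = (\<lambda>t. \<Sum>T\<in>B. (\<Sum>k\<in>T. s T $ k * ?w t k) + ln (\<Sum>k\<in>T. exp (- ?w t k)))"
    have "(w + t *\<^sub>R axis i 1) $ k = ?w t k" for t k by (simp add: axis_def)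
    then have g: "g t = f (w + t *\<^sub>R axis i 1)" for t
      unfolding g_def f_def F_def by presburger
    have DF: "((\<lambda>t. (\<Sum>k\<in>T. s T $ k * ?w t k) + ln (\<Sum>k\<in>T. exp (- ?w t k))) has_real_derivative
        s T $ i - (if i \<in> T then q i / (\<Sum>k\<in>T. q k) else 0)) (at 0)" if T: "T \<in> B" for T
    proof -
      have dw: "((\<lambda>t. ?w t k) has_real_derivative (if k = i then 1 else 0)) (at 0)" for k
        by (cases "k = i") (auto intro!: derivative_eq_intros)
      have "((\<lambda>t. (\<Sum>k\<in>T. s T $ k * ?w t k) + ln (\<Sum>k\<in>T. exp (- ?w t k))) has_real_derivative
          (\<Sum>k\<in>T. s T $ k * (if k = i then 1 else 0)) +
          (\<Sum>k\<in>T. exp (- ?w 0 k) * - (if k = i then 1 else 0)) / (\<Sum>k\<in>T. exp (- ?w 0 k))) (at 0)"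
      proof (rule DERIV_add)
        show "((\<lambda>t. \<Sum>k\<in>T. s T $ k * ?w t k) has_real_derivative
            (\<Sum>k\<in>T. s T $ k * (if k = i then 1 else 0))) (at 0)"
          by (intro DERIV_sum DERIV_cmult dw)
        have "((\<lambda>t. \<Sum>k\<in>T. exp (- ?w t k)) has_real_derivative
            (\<Sum>k\<in>T. exp (- ?w 0 k) * - (if k = i then 1 else 0))) (at 0)"
          by (intro DERIV_sum DERIV_chain2[OF DERIV_exp] DERIV_minus dw)
        moreover have "(\<Sum>k\<in>T. exp (- ?w 0 k)) > 0"
          by (intro sum_pos) (auto simp: ne[OF T])
        ultimately have "((\<lambda>t. ln (\<Sum>k\<in>T. exp (- ?w t k))) has_real_derivative
            inverse (\<Sum>k\<in>T. exp (- ?w 0 k)) *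
              (\<Sum>k\<in>T. exp (- ?w 0 k) * - (if k = i then 1 else 0))) (at 0)"
          by (intro DERIV_chain2[OF DERIV_ln])
        then show "((\<lambda>t. ln (\<Sum>k\<in>T. exp (- ?w t k))) has_real_derivative
            (\<Sum>k\<in>T. exp (- ?w 0 k) * - (if k = i then 1 else 0)) / (\<Sum>k\<in>T. exp (- ?w 0 k))) (at 0)"
          by (simp only: divide_inverse mult.commute)
      qed
      also have "(\<Sum>k\<in>T. s T $ k * (if k = i then 1 else 0)) = s T $ i"
        using s[OF T] by (auto simp: mem_axis_hull_iff if_distrib cong: if_cong)
      also have "(\<Sum>k\<in>T. exp (- ?w 0 k) * - (if k = i then 1 else 0)) = - (if i \<in> T then q i else 0)"
      proof -
        have "(\<Sum>k\<in>T. exp (- ?w 0 k) * - (if k = i then 1 else 0)) = (\<Sum>k\<in>T. if k = i then - q i else 0)"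
          by (intro sum.cong) (auto simp: q_def)
        then show ?thesis by simp
      qed
      also have "(\<Sum>k\<in>T. exp (- ?w 0 k)) = (\<Sum>k\<in>T. q k)"
        by (intro sum.cong) (auto simp: q_def)
      also have "s T $ i + - (if i \<in> T then q i else 0) / (\<Sum>k\<in>T. q k) =
          s T $ i - (if i \<in> T then q i / (\<Sum>k\<in>T. q k) else 0)" by simp
      finally show ?thesis .
    qed
    have "(g has_real_derivative
        (\<Sum>T\<in>B. s T $ i - (if i \<in> T then q i / (\<Sum>k\<in>T. q k) else 0))) (at 0)"
      unfolding g_def by (rule DERIV_sum) (rule DF)
    then have "(\<Sum>T\<in>B. s T $ i - (if i \<in> T then q i / (\<Sum>k\<in>T. q k) else 0)) = 0"
      by (rule DERIV_local_min[where d=1]) (auto simp: g min)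
    then show ?thesis by (simp add: sum_subtractf)
  qed
  have "(\<Sum>T\<in>B. s T) = (\<Sum>T\<in>B. \<chi> i. if i \<in> T then q i / (\<Sum>k\<in>T. q k) else 0)"
    by (simp add: vec_eq_iff crit)
  moreover have "q i > 0" for i by (simp add: q_def)
  ultimately show ?thesis by blast
qed

text \<open>The condition on the set where y < 1 is not visibly closed. As nestedness passes to
  subsets, the set is a finite union of closed boxes, one per nested set.\<close>

lemma compact_cubes: "compact (cubes V B :: (real ^ ('v::finite set)) set)"
proof -
  let ?a = "\<lambda>\<tau>. (\<chi> T. if T \<in> \<tau> then 0 else 1) :: real ^ ('v set)"
  have "cubes V B = (\<Union>\<tau>\<in>{\<tau>. nested B \<tau> \<and> \<tau> \<subseteq> B - {V}}. cbox (?a \<tau>) (\<chi> T. 1))"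
  proof (rule equalityI; rule subsetI)
    fix y assume y: "y \<in> cubes V B"
    let ?\<tau> = "{T. y $ T < 1}"
    have "nested B ?\<tau>" "?\<tau> \<subseteq> B - {V}" using y by (auto simp: cubes_def subset_iff)
    moreover have "y \<in> cbox (?a ?\<tau>) (\<chi> T. 1)" using y by (auto simp: cubes_def mem_box_cart not_less)
    ultimately show "y \<in> (\<Union>\<tau>\<in>{\<tau>. nested B \<tau> \<and> \<tau> \<subseteq> B - {V}}. cbox (?a \<tau>) (\<chi> T. 1))" by blast
  next
    fix y assume "y \<in> (\<Union>\<tau>\<in>{\<tau>. nested B \<tau> \<and> \<tau> \<subseteq> B - {V}}. cbox (?a \<tau>) (\<chi> T. 1))"
    then obtain \<tau> where \<tau>: "nested B \<tau>" "\<tau> \<subseteq> B - {V}" and y: "y \<in> cbox (?a \<tau>) (\<chi> T. 1)" by blast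
    have 1: "0 \<le> y $ T" "y $ T \<le> 1" "T \<notin> \<tau> \<Longrightarrow> y $ T = 1" for T
      using y[unfolded mem_box_cart, rule_format, of T] by (auto split: if_splits)
    have "{T. y $ T < 1} \<subseteq> \<tau>" using 1(3) by force
    then show "y \<in> cubes V B"
      using 1 \<tau> nested_subset[OF \<tau>(1)] unfolding cubes_def by blast
  qed
  then show ?thesis by (simp add: compact_UN)
qed

lemma continuous_on_moment:
  assumes \<beta>: "\<forall>i. \<beta> i > 0"
  shows "continuous_on (cubes V B) (moment B \<beta>)"
proof -
  have "continuous_on (cubes V B) (\<lambda>y. \<chi> i. if i \<in> T then \<beta> i * num T y i / (\<Sum>k\<in>T. \<beta> k * num T y k) else 0)"
    if T: "T \<in> B" for T
  proof (rule continuous_on_vec_lambda)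
    fix i
    have "(\<Sum>k\<in>T. \<beta> k * num T y k) \<noteq> 0" if "y \<in> cubes V B" for y
      using bary_denom_pos[OF that T \<beta>] by simp
    then show "continuous_on (cubes V B) (\<lambda>y. if i \<in> T then \<beta> i * num T y i / (\<Sum>k\<in>T. \<beta> k * num T y k) else 0)"
      by (cases "i \<in> T") (auto simp: num_def intro!: continuous_intros)
  qed
  then show ?thesis unfolding moment_def bary_def by (intro continuous_on_sum)
qed

text \<open>Points with positive barycentric coordinates are reached through weights. An arbitrary
  point is a limit of such points, by mixing its summands with their barycentres, and the image is
  closed by compactness.\<close>

lemma moment_image:
  assumes cb: "connected_building_set V B" and \<beta>: "\<forall>i. \<beta> i > 0"
  shows "moment B \<beta> ` cubes V B = nestohedron B"
proof
  show "moment B \<beta> ` cubes V B \<subseteq> nestohedron B" using moment_in_nestohedron[OF _ \<beta>] by blast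
  show "nestohedron B \<subseteq> moment B \<beta> ` cubes V B"
  proof
    fix x assume "x \<in> nestohedron B"
    then obtain a where a: "\<And>T. T \<in> B \<Longrightarrow> a T \<in> convex hull ((\<lambda>i. axis i 1) ` T)" and x: "x = (\<Sum>T\<in>B. a T)"
      unfolding mem_nestohedron_iff by blast
    define b :: "'a set \<Rightarrow> real ^ 'a" where "b = (\<lambda>T. \<chi> i. if i \<in> T then 1 / real (card T) else 0)"
    have ne: "T \<noteq> {}" if "T \<in> B" for T
      using building_set_nonempty[OF connected_building_set_imp[OF cb] that] .
    have b: "b T \<in> convex hull ((\<lambda>i. axis i 1) ` T)" if "T \<in> B" for T
      using ne[OF that] by (simp add: mem_axis_hull_iff b_def)
    have img: "(1 - e) *\<^sub>R x + e *\<^sub>R (\<Sum>T\<in>B. b T) \<in> moment B \<beta> ` cubes V B" if e: "0 < e" "e \<le> 1" for e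
    proof -
      let ?s = "\<lambda>T. (1 - e) *\<^sub>R a T + e *\<^sub>R b T"
      have s: "?s T \<in> convex hull ((\<lambda>i. axis i 1) ` T)" if "T \<in> B" for T
        using a[OF that] b[OF that] e by (intro convexD) auto
      have pos: "?s T $ i > 0" if "T \<in> B" "i \<in> T" for T i
      proof -
        have "0 \<le> a T $ i" using a[OF that(1)] by (simp add: mem_axis_hull_iff)
        then have "0 \<le> (1 - e) * a T $ i" using e by simp
        moreover have "0 < e * b T $ i" using e that ne[OF that(1)] by (simp add: b_def card_gt_0_iff)
        ultimately show ?thesis by simp
      qed
      have ex: "\<exists>q. (\<forall>i. q i > 0) \<and>
          (\<Sum>T\<in>B. ?s T) = (\<Sum>T\<in>B. \<chi> i. if i \<in> T then q i / (\<Sum>k\<in>T. q k) else 0)"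
        by (rule weights_of_positive_bary[OF cb]) (fact s pos)+
      obtain q where "(\<forall>i. q i > 0) \<and>
          (\<Sum>T\<in>B. ?s T) = (\<Sum>T\<in>B. \<chi> i. if i \<in> T then q i / (\<Sum>k\<in>T. q k) else 0)" using ex ..
      then have q: "\<forall>i. q i > 0"
        "(\<Sum>T\<in>B. ?s T) = (\<Sum>T\<in>B. \<chi> i. if i \<in> T then q i / (\<Sum>k\<in>T. q k) else 0)"
        by simp_all
      obtain y where y: "y \<in> cubes V B"
        "\<And>T. T \<in> B \<Longrightarrow> bary \<beta> T y = (\<chi> i. if i \<in> T then q i / (\<Sum>k\<in>T. q k) else 0)"
        using bary_of_weights[OF cb q(1) \<beta>] by metis
      have "moment B \<beta> y = (\<Sum>T\<in>B. ?s T)" using y(2) q(2) by (simp add: moment_def)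
      also have "\<dots> = (1 - e) *\<^sub>R x + e *\<^sub>R (\<Sum>T\<in>B. b T)"
        by (simp add: x sum.distrib scaleR_sum_right)
      finally show ?thesis using y(1) by (metis imageI)
    qed
    have "closed (moment B \<beta> ` cubes V B)"
      by (intro compact_imp_closed compact_continuous_image continuous_on_moment \<beta> compact_cubes)
    moreover have "(1 - inverse (real (Suc n))) *\<^sub>R x + inverse (real (Suc n)) *\<^sub>R (\<Sum>T\<in>B. b T) \<in> moment B \<beta> ` cubes V B" for n
      by (rule img) (auto simp: field_simps)
    moreover have "(\<lambda>n. (1 - inverse (real (Suc n))) *\<^sub>R x + inverse (real (Suc n)) *\<^sub>R (\<Sum>T\<in>B. b T))
        \<longlonglongrightarrow> (1 - 0) *\<^sub>R x + 0 *\<^sub>R (\<Sum>T\<in>B. b T)"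
      by (intro tendsto_intros LIMSEQ_inverse_real_of_nat)
    ultimately show "x \<in> moment B \<beta> ` cubes V B"
      by (metis (no_types, lifting) closed_sequentially diff_zero scaleR_one scaleR_zero_left add.right_neutral)
  qed
qed

section \<open>Facets of nestohedra\<close>

lemma nested_singleton: "building_set V B \<Longrightarrow> nested B {T}"
  using building_set_nonempty unfolding nested_def by blast

text \<open>For nested \<tau> its moment is a test point lying on the facets F_T with T in \<tau>
  and on no others.\<close>

definition cube_vertex :: "'v::finite set set \<Rightarrow> real ^ ('v set)" where
  "cube_vertex \<tau> = (\<chi> T. if T \<in> \<tau> then 0 else 1)"

lemma cube_vertex_in_cubes: "nested B \<tau> \<Longrightarrow> \<tau> \<subseteq> B - {V} \<Longrightarrow> cube_vertex \<tau> \<in> cubes V B"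
  by (auto simp: cubes_def cube_vertex_def)

lemma moment_cube_vertex_in_facet_iff:
  assumes cb: "connected_building_set V B" and \<tau>: "nested B \<tau>" "\<tau> \<subseteq> B - {V}" and R: "R \<in> B - {V}"
  shows "moment B (\<lambda>_. 1) (cube_vertex \<tau>) \<in> nesto_facet B R \<longleftrightarrow> R \<in> \<tau>"
proof -
  have "cube_vertex \<tau> $ R = 0 \<longleftrightarrow> R \<in> \<tau>" by (simp add: cube_vertex_def)
  then show ?thesis
    using moment_in_facet_iff[OF cb cube_vertex_in_cubes[OF \<tau>] _ R, of "\<lambda>_. 1"] by simp
qed

lemma inj_on_nesto_facet:
  assumes cb: "connected_building_set V B"
  shows "inj_on (nesto_facet B) (B - {V})"
proof (rule inj_onI)
  fix T R assume T: "T \<in> B - {V}" and R: "R \<in> B - {V}" and eq: "nesto_facet B T = nesto_facet B R"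
  have n: "nested B {T}" "{T} \<subseteq> B - {V}"
    using T nested_singleton[OF connected_building_set_imp[OF cb]] by auto
  show "T = R"
    using moment_cube_vertex_in_facet_iff[OF cb n T] moment_cube_vertex_in_facet_iff[OF cb n R]
    unfolding eq by simp
qed

text \<open>Every p in the polytope is an endpoint of a segment in the polytope with the moment of y
  in its interior: all relevant barycentric coordinates are positive, so each summand can be
  prolonged a little. A face through the moment thus contains p.\<close>

lemma positive_moment_in_face:
  assumes cb: "connected_building_set V B" and y: "y \<in> cubes V B" and pos: "\<And>T. y $ T > 0"
    and C: "C face_of nestohedron B" "moment B (\<lambda>_. 1) y \<in> C"
  shows "C = nestohedron B"
proof
  let ?x = "moment B (\<lambda>_. 1) y" and ?b = "\<lambda>T. bary (\<lambda>_. 1) T y"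
  show "C \<subseteq> nestohedron B" using C(1) face_of_imp_subset by blast
  show "nestohedron B \<subseteq> C"
  proof
    fix p assume p: "p \<in> nestohedron B"
    then obtain a where a: "\<And>T. T \<in> B \<Longrightarrow> a T \<in> convex hull ((\<lambda>i. axis i 1) ` T)" "p = (\<Sum>T\<in>B. a T)"
      unfolding mem_nestohedron_iff by blast
    have bh: "?b T \<in> convex hull ((\<lambda>i. axis i 1) ` T)" if "T \<in> B" for T
      using bary_in_hull[OF y that] by simp
    have bpos: "0 < ?b T $ i" if "T \<in> B" "i \<in> T" for T i
    proof -
      have "?b T $ i \<noteq> 0"
        using bary_zero_iff[OF y that(1) _ that(2), of "\<lambda>_. 1"] pos by (metis less_irrefl zero_less_one)
      moreover have "0 \<le> ?b T $ i" using bh[OF that(1)] by (simp add: mem_axis_hull_iff)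
      ultimately show ?thesis by simp
    qed
    \<comment> \<open>Coordinates of \<open>a T\<close> are at most 1, so e below all positive
      barycentric coordinates keeps (1 + e) b - e a nonnegative.\<close>
    define e where "e = Min (insert 1 ((\<lambda>(T, i). ?b T $ i) ` {(T, i). T \<in> B \<and> i \<in> T}))"
    have "0 < e" unfolding e_def by (subst Min_gr_iff) (auto simp: bpos)
    have e_le: "e \<le> ?b T $ i" if "T \<in> B" "i \<in> T" for T i
      unfolding e_def by (rule Min_le) (use that in force)+
    let ?s = "\<lambda>T. (1 + e) *\<^sub>R ?b T - e *\<^sub>R a T"
    have s: "?s T \<in> convex hull ((\<lambda>i. axis i 1) ` T)" if T: "T \<in> B" for T
    proof -
      have ah: "\<forall>i. 0 \<le> a T $ i" "\<forall>i. i \<notin> T \<longrightarrow> a T $ i = 0" "(\<Sum>i\<in>T. a T $ i) = 1"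
        using a(1)[OF T] unfolding mem_axis_hull_iff by blast+
      have bh': "\<forall>i. 0 \<le> ?b T $ i" "\<forall>i. i \<notin> T \<longrightarrow> ?b T $ i = 0" "(\<Sum>i\<in>T. ?b T $ i) = 1"
        using bh[OF T] unfolding mem_axis_hull_iff by blast+
      have "0 \<le> ?s T $ i" if i: "i \<in> T" for i
      proof -
        have "a T $ i \<le> (\<Sum>i\<in>T. a T $ i)" using i ah(1) by (intro member_le_sum) auto
        then have "e * a T $ i \<le> e * 1" using ah(3) \<open>0 < e\<close> by (intro mult_left_mono) auto
        moreover have "e \<le> ?b T $ i" "0 \<le> e * ?b T $ i" using e_le[OF T i] bh'(1) \<open>0 < e\<close> by auto
        ultimately show ?thesis by (simp add: algebra_simps)
      qed
      moreover have "?s T $ i = 0" if "i \<notin> T" for i using ah(2) bh'(2) that by simp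
      moreover have "(\<Sum>i\<in>T. ?s T $ i) = 1"
        using ah(3) bh'(3) by (simp add: sum_subtractf sum_distrib_left[symmetric])
      ultimately show ?thesis unfolding mem_axis_hull_iff by (metis order_refl)
    qed
    define q where "q = (\<Sum>T\<in>B. ?s T)"
    have q: "q \<in> nestohedron B" unfolding mem_nestohedron_iff q_def using s by (intro exI[of _ ?s]) simp
    have qx: "q = (1 + e) *\<^sub>R ?x - e *\<^sub>R p"
      unfolding q_def a(2) moment_def by (simp add: sum_subtractf scaleR_sum_right)
    show "p \<in> C"
    proof (cases "p = q")
      case True
      then have "(1 + e) *\<^sub>R p = (1 + e) *\<^sub>R ?x" using qx by (simp add: algebra_simps)
      then show ?thesis using C(2) \<open>0 < e\<close> by simp
    next
      case False
      have "?x = (1 - 1 / (1 + e)) *\<^sub>R p + (1 / (1 + e)) *\<^sub>R q"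
      proof -
        have "1 - 1 / (1 + e) = e / (1 + e)" using \<open>0 < e\<close> by (simp add: field_simps)
        then have "(1 - 1 / (1 + e)) *\<^sub>R p + (1 / (1 + e)) *\<^sub>R q = ((1 + e) / (1 + e)) *\<^sub>R ?x"
          unfolding qx by (simp add: scaleR_diff_right)
        then show ?thesis using \<open>0 < e\<close> by simp
      qed
      then have "?x \<in> open_segment p q"
        unfolding in_segment using False \<open>0 < e\<close>
        by (intro conjI exI[of _ "1 / (1 + e)"]) (auto simp: field_simps)
      then show ?thesis using C p q unfolding face_of_def by blast
    qed
  qed
qed

lemma nesto_facet_ne:
  assumes cb: "connected_building_set V B" and T: "T \<in> B - {V}"
  shows "nesto_facet B T \<noteq> {}" "nesto_facet B T \<noteq> nestohedron B"
proof -
  have n: "nested B {T}" "{T} \<subseteq> B - {V}"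
    using T nested_singleton[OF connected_building_set_imp[OF cb]] by auto
  then have e: "nested B {}" using nested_subset by blast
  show "nesto_facet B T \<noteq> {}"
    using moment_cube_vertex_in_facet_iff[OF cb n T] by blast
  show "nesto_facet B T \<noteq> nestohedron B"
    using moment_cube_vertex_in_facet_iff[OF cb e _ T]
      moment_in_nestohedron[OF cube_vertex_in_cubes[OF e], of V "\<lambda>_. 1"] by auto
qed

text \<open>A relative interior point of C has a vanishing homogeneous coordinate, and a face
  containing such a point contains C.\<close>

lemma proper_face_subset_nesto_facet:
  assumes cb: "connected_building_set V B" and C: "C face_of nestohedron B" "C \<noteq> {}" "C \<noteq> nestohedron B"
  shows "\<exists>T\<in>B - {V}. C \<subseteq> nesto_facet B T"
proof -
  have "convex C" using C(1) by (rule face_of_imp_convex)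
  then obtain x where x: "x \<in> rel_interior C" using C(2) rel_interior_eq_empty by blast
  have xC: "x \<in> C" using x rel_interior_subset by blast
  then have "x \<in> nestohedron B" using C(1) face_of_imp_subset by blast
  then obtain y where y: "y \<in> cubes V B" "x = moment B (\<lambda>_. 1) y"
    using moment_image[OF cb, of "\<lambda>_. 1"] by auto
  obtain T where T: "\<not> y $ T > 0"
    using positive_moment_in_face[OF cb y(1) _ C(1)] xC C(3) y(2) by blast
  then have T0: "y $ T = 0" using y(1) by (auto simp: cubes_def not_less intro: antisym)
  then have TB: "T \<in> B - {V}" using y(1) by (metis (mono_tags, lifting) cubes_def mem_Collect_eq zero_neq_one)
  then have "x \<in> nesto_facet B T"
    using moment_in_facet_iff[OF cb y(1) _ TB, of "\<lambda>_. 1"] T0 y(2) by simp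
  then have "C \<subseteq> nesto_facet B T"
    using x subset_of_face_of[OF nesto_facet_face_of[of B T], of C] C(1) face_of_imp_subset by blast
  then show ?thesis using TB by blast
qed

text \<open>A facet lies in some F_T, and dimensions force equality. Conversely F_T lies in a facet,
  which is some F_R; the test point of {T} gives R = T.\<close>

lemma facets_nestohedron:
  assumes cb: "connected_building_set V B"
  shows "facets (nestohedron B) = nesto_facet B ` (B - {V})"
proof -
  have sub: "C \<in> nesto_facet B ` (B - {V})" if C: "C facet_of nestohedron B" for C
  proof -
    have Cf: "C face_of nestohedron B" "C \<noteq> {}" "aff_dim C = aff_dim (nestohedron B) - 1"
      using C by (auto simp: facet_of_def)
    then have "C \<noteq> nestohedron B" by auto
    then obtain T where T: "T \<in> B - {V}" "C \<subseteq> nesto_facet B T"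
      using proper_face_subset_nesto_facet[OF cb Cf(1,2)] by blast
    have conv: "convex (nestohedron B)" using polytope_nestohedron polytope_imp_convex by blast
    have "aff_dim (nesto_facet B T) < aff_dim (nestohedron B)"
      using face_of_aff_dim_lt[OF conv nesto_facet_face_of nesto_facet_ne(2)[OF cb T(1)]] .
    moreover have "C face_of nesto_facet B T"
      using Cf(1) T(2) nesto_facet_face_of[of B T] face_of_subset face_of_imp_subset by blast
    then have "C = nesto_facet B T \<or> aff_dim C < aff_dim (nesto_facet B T)"
      using face_of_aff_dim_lt[of "nesto_facet B T" C] face_of_imp_convex[OF nesto_facet_face_of] by blast
    ultimately show ?thesis using Cf(3) T(1) by auto
  qed
  have "nesto_facet B T facet_of nestohedron B" if T: "T \<in> B - {V}" for T
  proof -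
    have "polyhedron (nestohedron B)" using polytope_nestohedron polytope_imp_polyhedron by blast
    then obtain C where C: "C facet_of nestohedron B" "nesto_facet B T \<subseteq> C"
      using face_of_polyhedron_subset_facet[OF _ nesto_facet_face_of nesto_facet_ne[OF cb T]] by blast
    then obtain R where R: "R \<in> B - {V}" "C = nesto_facet B R" using sub by blast
    have n: "nested B {T}" "{T} \<subseteq> B - {V}"
      using T nested_singleton[OF connected_building_set_imp[OF cb]] by auto
    have "T = R"
      using moment_cube_vertex_in_facet_iff[OF cb n T] moment_cube_vertex_in_facet_iff[OF cb n R(1)]
        C(2) R(2) by blast
    then show ?thesis using C R by simp
  qed
  with sub show ?thesis by blast
qed

text \<open>\<open>cube_vertex\<close> supplies a common point. Given a common point, any index
  where its summand at R is nonzero is the one required for R.\<close>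

lemma nested_iff_facets_meet:
  assumes cb: "connected_building_set V B" and \<tau>: "\<tau> \<subseteq> B - {V}"
  shows "nested B \<tau> \<longleftrightarrow> nestohedron B \<inter> \<Inter>(nesto_facet B ` \<tau>) \<noteq> {}"
proof
    assume "nested B \<tau>"
    then have y: "cube_vertex \<tau> \<in> cubes V B" using \<tau> by (rule cube_vertex_in_cubes)
    have "moment B (\<lambda>_. 1) (cube_vertex \<tau>) \<in> nesto_facet B T" if "T \<in> \<tau>" for T
      using moment_cube_vertex_in_facet_iff[OF cb \<open>nested B \<tau>\<close> \<tau>, of T] \<tau> that by blast
    moreover have "moment B (\<lambda>_. 1) (cube_vertex \<tau>) \<in> nestohedron B"
      using moment_in_nestohedron[OF y] by simp
    ultimately show "nestohedron B \<inter> \<Inter>(nesto_facet B ` \<tau>) \<noteq> {}" by blast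
  next
    assume "nestohedron B \<inter> \<Inter>(nesto_facet B ` \<tau>) \<noteq> {}"
    then obtain x where x: "x \<in> nestohedron B" "\<And>T. T \<in> \<tau> \<Longrightarrow> x \<in> nesto_facet B T" by blast
    then obtain s where s: "\<And>T. T \<in> B \<Longrightarrow> s T \<in> convex hull ((\<lambda>i. axis i 1) ` T)" "x = (\<Sum>T\<in>B. s T)"
      unfolding mem_nestohedron_iff by blast
    show "nested B \<tau>"
      unfolding nested_def
    proof
      fix R assume R: "R \<in> B"
      have sR: "(\<Sum>i\<in>R. s R $ i) = 1" using s(1)[OF R] unfolding mem_axis_hull_iff by blast
      obtain i where i: "i \<in> R" "s R $ i \<noteq> 0"
        by (metis sR sum.neutral zero_neq_one)
      have "R \<subseteq> T" if "T \<in> \<tau>" "i \<in> T" for T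
        using x(2)[OF that(1)] sum_ge_card_bs_restrict(2)[OF s(1), of B T] R i that(2)
        unfolding nesto_facet_def s(2) by blast
      then show "\<exists>i\<in>R. \<forall>T\<in>\<tau>. i \<in> T \<longrightarrow> R \<subseteq> T" using i(1) by blast
    qed
qed

lemma nested_set_complex_eq:
  assumes cb: "connected_building_set V B"
  shows "nested_set_complex V B = {\<tau>. \<tau> \<subseteq> B - {V} \<and> nested B \<tau>}"
  unfolding nested_set_complex_def nerve_complex_def facets_nestohedron[OF cb]
  using nested_iff_facets_meet[OF cb] by blast

section \<open>Moment-angle manifolds and complexes\<close>

lemma continuous_map_complex_mult:
  fixes f g :: "'a \<Rightarrow> complex"
  assumes "continuous_map X euclidean f" "continuous_map X euclidean g"
  shows "continuous_map X euclidean (\<lambda>x. f x * g x)"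
proof -
  have "continuous_map X (euclidean :: (complex \<times> complex) topology) (\<lambda>x. (f x, g x))"
    using continuous_map_pairedI[OF assms] by simp
  moreover have "continuous_map (euclidean :: (complex \<times> complex) topology) euclidean (\<lambda>x. fst x * snd x)"
    by (simp add: continuous_on_fst continuous_on_snd continuous_on_mult)
  ultimately have "continuous_map X euclidean ((\<lambda>x. fst x * snd x) \<circ> (\<lambda>x. (f x, g x)))"
    by (rule continuous_map_compose)
  then show ?thesis by (simp add: o_def)
qed

lemma compact_space_quotient_topology:
  assumes "compact_space X"
  shows "compact_space (quotient_topology X r)"
  unfolding compact_space_def quotient_imp_surjective_map[OF quotient_map_quotient_topology, symmetric]
  by (rule image_compactin[OF _ quotient_imp_continuous_map[OF quotient_map_quotient_topology]])
    (use assms in \<open>simp add: compact_space_def\<close>)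

text \<open>The relation is the kernel of g, so g descends to a continuous bijection from a compact
  space to a Hausdorff one. The value on representatives is recorded because the square is checked
  there.\<close>

lemma quotient_topology_homeomorphic:
  assumes comp: "compact_space X" and haus: "Hausdorff_space Z"
    and cont: "continuous_map X Z g" and surj: "g ` topspace X = topspace Z"
    and r: "r = {(x, y). x \<in> topspace X \<and> y \<in> topspace X \<and> g x = g y}"
  shows "\<exists>h. homeomorphic_map (quotient_topology X r) Z h \<and> (\<forall>x\<in>topspace X. h (r `` {x}) = g x)"
proof -
  define h where "h = (\<lambda>c. g (SOME x. x \<in> c))"
  have cls: "r `` {x} = {y \<in> topspace X. g x = g y}" if "x \<in> topspace X" for x
    using that by (auto simp: r)
  have h: "h (r `` {x}) = g x" if "x \<in> topspace X" for x
  proof -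
    have "x \<in> r `` {x}" using that by (simp add: cls)
    then have "(SOME y. y \<in> r `` {x}) \<in> r `` {x}" by (rule someI)
    then show ?thesis unfolding h_def cls[OF that] by simp
  qed
  let ?Q = "quotient_topology X r"
  have q: "quotient_map X ?Q (\<lambda>x. r `` {x})" by (rule quotient_map_quotient_topology)
  have top: "topspace ?Q = (\<lambda>x. r `` {x}) ` topspace X"
    using quotient_imp_surjective_map[OF q] by simp
  have "continuous_map X Z (h \<circ> (\<lambda>x. r `` {x}))"
    by (rule continuous_map_eq[OF cont]) (simp add: h)
  then have 1: "continuous_map ?Q Z h" by (rule continuous_compose_quotient_map[OF q])
  have 2: "compact_space ?Q" by (rule compact_space_quotient_topology[OF comp])
  have 3: "h ` topspace ?Q = topspace Z"
    unfolding top surj[symmetric] image_image by (rule image_cong) (simp_all add: h)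
  have 4: "inj_on h (topspace ?Q)"
  proof (rule inj_onI)
    fix c d assume "c \<in> topspace ?Q" "d \<in> topspace ?Q" and eq: "h c = h d"
    then obtain x y where "x \<in> topspace X" "c = r `` {x}" "y \<in> topspace X" "d = r `` {y}"
      unfolding top by blast
    then show "c = d" using eq h cls by simp
  qed
  show ?thesis
    using continuous_imp_homeomorphic_map[OF 1 2 haus 3 4] h by blast
qed

section \<open>The identification relation and polar coordinates\<close>

lemma topspace_torus: "topspace (torus I) = (\<Pi>\<^sub>E i\<in>I. sphere 0 1)"
  by (simp add: torus_def)

lemma minimal_face_subset_iff:
  assumes "convex P" "F facet_of P" "p \<in> P"
  shows "minimal_face P p \<subseteq> F \<longleftrightarrow> p \<in> F"
  using assms by (auto simp: minimal_face_def facet_of_def)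

text \<open>The minimal face of p lies in a facet exactly when p does, so precisely the circles of
  the facets through p are collapsed.\<close>

lemma ma_rel_iff:
  assumes P: "convex P"
  shows "((t, p), (u, q)) \<in> ma_rel P \<longleftrightarrow>
    t \<in> topspace (torus (facets P)) \<and> u \<in> topspace (torus (facets P)) \<and> p \<in> P \<and> q = p \<and>
    (\<forall>F\<in>facets P. p \<notin> F \<longrightarrow> t F = u F)"
proof -
  have "(\<lambda>F\<in>facets P. t F * inverse (u F)) \<in> face_torus P (minimal_face P p) \<longleftrightarrow>
      (\<forall>F\<in>facets P. p \<notin> F \<longrightarrow> t F = u F)"
    if tu: "t \<in> topspace (torus (facets P))" "u \<in> topspace (torus (facets P))" and p: "p \<in> P"
  proof -
    have n: "norm (t F) = 1" "norm (u F) = 1" if "F \<in> facets P" for F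
      using tu that by (auto simp: topspace_torus PiE_iff)
    then have "(\<lambda>F\<in>facets P. t F * inverse (u F)) \<in> topspace (torus (facets P))"
      by (auto simp: topspace_torus PiE_iff norm_mult norm_inverse)
    moreover have "t F * inverse (u F) = 1 \<longleftrightarrow> t F = u F" if "F \<in> facets P" for F
    proof -
      have "u F \<noteq> 0" using n[OF that] by auto
      then show ?thesis by (simp add: field_simps)
    qed
    moreover have "minimal_face P p \<subseteq> F \<longleftrightarrow> p \<in> F" if "F \<in> facets P" for F
      using minimal_face_subset_iff[OF P _ p] that by simp
    ultimately show ?thesis
      unfolding face_torus_def by simp
  qed
  then show ?thesis unfolding ma_rel_def by auto
qed

text \<open>The value at 0 is an arbitrary point of the circle: the circle coordinate is collapsed
  there.\<close>

definition phase :: "complex \<Rightarrow> complex" where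
  "phase z = (if z = 0 then 1 else sgn z)"

lemma norm_phase [simp]: "norm (phase z) = 1"
  by (simp add: phase_def norm_sgn)

lemma phase_mult_norm: "phase z * of_real (norm z) = z"
  by (simp add: phase_def sgn_eq)

definition moduli :: "'v::finite set \<Rightarrow> 'v set set \<Rightarrow> ('v set \<Rightarrow> complex) \<Rightarrow> real ^ ('v set)" where
  "moduli V B z = (\<chi> T. if T \<in> B - {V} then norm (z T) else 1)"

definition coord :: "'v::finite set \<Rightarrow> 'v set set \<Rightarrow> ('v \<Rightarrow> real) \<Rightarrow> real ^ 'v \<Rightarrow> real ^ ('v set)" where
  "coord V B \<beta> = inv_into (cubes V B) (moment B \<beta>)"

definition chart ::
  "'v::finite set \<Rightarrow> 'v set set \<Rightarrow> (real ^ 'v \<Rightarrow> real ^ ('v set)) \<Rightarrow>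
    ((real ^ 'v) set \<Rightarrow> complex) \<times> (real ^ 'v) \<Rightarrow> 'v set \<Rightarrow> complex"
where
  "chart V B c = (\<lambda>(t, p). \<lambda>T\<in>B - {V}. t (nesto_facet B T) * of_real (c p $ T))"

text \<open>What the homeomorphism requires of a parametrisation. It holds for \<open>coord\<close>,
  and also for coordinates \<open>cS\<close> inherited from a face, which are not given as the
  inverse of a moment map.\<close>

definition face_coords :: "'v::finite set \<Rightarrow> 'v set set \<Rightarrow> (real ^ 'v \<Rightarrow> real ^ ('v set)) \<Rightarrow> bool" where
  "face_coords V B c \<longleftrightarrow> continuous_on (nestohedron B) c \<and>
    bij_betw c (nestohedron B) (cubes V B) \<and>
    (\<forall>p\<in>nestohedron B. \<forall>T\<in>B - {V}. c p $ T = 0 \<longleftrightarrow> p \<in> nesto_facet B T)"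

text \<open>The simplex can be taken to be the set of coordinates of modulus less than 1, as subsets
  of nested sets are nested.\<close>

lemma topspace_moment_angle_complex:
  assumes cb: "connected_building_set V B"
  shows "z \<in> topspace (moment_angle_complex (B - {V}) (nested_set_complex V B)) \<longleftrightarrow>
    z \<in> extensional (B - {V}) \<and> moduli V B z \<in> cubes V B" (is "?l \<longleftrightarrow> ?r")
proof -
  let ?W = "B - {V}"
  have lt: "{T. moduli V B z $ T < 1} = {T \<in> ?W. norm (z T) < 1}"
    by (auto simp: moduli_def)
  show ?thesis
  proof
    assume ?l
    then obtain \<sigma> where \<sigma>: "\<sigma> \<subseteq> ?W" "nested B \<sigma>" and z: "z \<in> (\<Pi>\<^sub>E i\<in>?W. if i \<in> \<sigma> then cball 0 1 else sphere 0 1)"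
      by (auto simp: moment_angle_complex_def nested_set_complex_eq[OF cb])
    have n: "norm (z T) \<le> 1" "T \<notin> \<sigma> \<Longrightarrow> norm (z T) = 1" if "T \<in> ?W" for T
      using PiE_mem[OF z that] by (auto split: if_splits)
    have "{T \<in> ?W. norm (z T) < 1} \<subseteq> \<sigma>" using n by force
    then have "nested B {T. moduli V B z $ T < 1}" unfolding lt using \<sigma>(2) nested_subset by blast
    then show ?r using n(1) z by (auto simp: cubes_def moduli_def PiE_iff)
  next
    assume r: ?r
    let ?\<sigma> = "{T \<in> ?W. norm (z T) < 1}"
    have le: "norm (z T) \<le> 1" if "T \<in> ?W" for T
    proof -
      have "moduli V B z $ T \<le> 1" using r by (simp add: cubes_def)
      then show ?thesis using that by (simp add: moduli_def)
    qed
    have "nested B ?\<sigma>" using r by (simp add: cubes_def lt)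
    then have "?\<sigma> \<in> nested_set_complex V B" by (auto simp: nested_set_complex_eq[OF cb])
    moreover have "z \<in> (\<Pi>\<^sub>E i\<in>?W. if i \<in> ?\<sigma> then cball 0 1 else sphere 0 1)"
      using r le by (force simp: PiE_iff)
    moreover have "z \<in> (\<Pi>\<^sub>E i\<in>?W. cball 0 1)" using r le by (auto simp: PiE_iff)
    ultimately show ?l
      unfolding moment_angle_complex_def topspace_subtopology topspace_product_topology
      by (intro IntI UN_I[of ?\<sigma>]) simp_all
  qed
qed

lemma coord_in_cubes:
  assumes "connected_building_set V B" "\<forall>i. \<beta> i > 0" "p \<in> nestohedron B"
  shows "coord V B \<beta> p \<in> cubes V B" "moment B \<beta> (coord V B \<beta> p) = p"
  using assms moment_image[OF assms(1,2)] unfolding coord_def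
  by (auto intro: inv_into_into f_inv_into_f)

lemma coord_moment:
  assumes "connected_building_set V B" "\<forall>i. \<beta> i > 0" "y \<in> cubes V B"
  shows "coord V B \<beta> (moment B \<beta> y) = y"
  using assms moment_inj_on[OF assms(1,2)] unfolding coord_def by simp

lemma continuous_on_coord:
  assumes "connected_building_set V B" "\<forall>i. \<beta> i > 0"
  shows "continuous_on (nestohedron B) (coord V B \<beta>)"
  using continuous_on_inv[OF continuous_on_moment[OF assms(2), of V B] compact_cubes, of "coord V B \<beta>"]
    coord_moment[OF assms] moment_image[OF assms] by simp

lemma coord_zero_iff:
  assumes "connected_building_set V B" "\<forall>i. \<beta> i > 0" "p \<in> nestohedron B" "T \<in> B - {V}"
  shows "coord V B \<beta> p $ T = 0 \<longleftrightarrow> p \<in> nesto_facet B T"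
  using moment_in_facet_iff[OF assms(1) coord_in_cubes(1)[OF assms(1-3)] assms(2,4)]
    coord_in_cubes(2)[OF assms(1-3)] by simp

lemma face_coords_coord:
  assumes "connected_building_set V B" "\<forall>i. \<beta> i > 0"
  shows "face_coords V B (coord V B \<beta>)"
  unfolding face_coords_def
proof (intro conjI)
  have "bij_betw (moment B \<beta>) (cubes V B) (nestohedron B)"
    unfolding bij_betw_def by (simp add: moment_inj_on[OF assms] moment_image[OF assms])
  then show "bij_betw (coord V B \<beta>) (nestohedron B) (cubes V B)"
    unfolding coord_def by (rule bij_betw_inv_into)
qed (simp_all add: continuous_on_coord[OF assms] coord_zero_iff[OF assms])

lemma face_coords_mem: "face_coords V B c \<Longrightarrow> p \<in> nestohedron B \<Longrightarrow> c p \<in> cubes V B"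
  unfolding face_coords_def by (blast dest: bij_betw_apply)

lemma face_coords_zero_iff:
  "face_coords V B c \<Longrightarrow> p \<in> nestohedron B \<Longrightarrow> T \<in> B - {V} \<Longrightarrow>
    c p $ T = 0 \<longleftrightarrow> p \<in> nesto_facet B T"
  unfolding face_coords_def by blast

lemma face_coords_inj: "face_coords V B c \<Longrightarrow> inj_on c (nestohedron B)"
  unfolding face_coords_def by (blast dest: bij_betw_imp_inj_on)

abbreviation torus_times ::
  "'a::euclidean_space set \<Rightarrow> (('a set \<Rightarrow> complex) \<times> 'a) topology" where
  "torus_times P \<equiv> prod_topology (torus (facets P)) (top_of_set P)"

lemma convex_nestohedron: "convex (nestohedron B)"
  using polytope_nestohedron polytope_imp_convex by blast

lemma compact_torus_times: "compact_space (torus_times (nestohedron B))"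
proof -
  have "compact (nestohedron B)" using polytope_nestohedron polytope_imp_compact by blast
  then show ?thesis
    by (simp add: compact_space_prod_topology torus_def compact_space_product_topology
        compact_space_subtopology)
qed

lemma Hausdorff_moment_angle_complex: "Hausdorff_space (moment_angle_complex W K)"
  unfolding moment_angle_complex_def
  by (simp add: Hausdorff_space_subtopology Hausdorff_space_product_topology)

lemma continuous_map_moment_angle_complex:
  assumes mem: "\<And>x. x \<in> topspace X \<Longrightarrow> f x \<in> topspace (moment_angle_complex W K)"
    and cont: "\<And>T. T \<in> W \<Longrightarrow> continuous_map X euclidean (\<lambda>x. f x T)"
  shows "continuous_map X (moment_angle_complex W K) f"
proof -
  have m: "f x \<in> (\<Pi>\<^sub>E i\<in>W. cball 0 1)" if "x \<in> topspace X" for x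
    using mem[OF that] unfolding moment_angle_complex_def by simp
  then have "f x \<in> extensional W" if "x \<in> topspace X" for x using that by (simp add: PiE_iff)
  moreover have "f x T \<in> cball 0 1" if "x \<in> topspace X" "T \<in> W" for x T
    using PiE_mem[OF m[OF that(1)] that(2)] .
  ultimately have "continuous_map X (product_topology (\<lambda>_. top_of_set (cball 0 1)) W) f"
    unfolding continuous_map_componentwise continuous_map_in_subtopology using cont by blast
  then show ?thesis
    using mem unfolding moment_angle_complex_def by (intro continuous_map_into_subtopology) auto
qed

lemma continuous_map_moment_angle_complex_component:
  assumes "T \<in> W"
  shows "continuous_map (moment_angle_complex W K) euclidean (\<lambda>z. z T)"
  using continuous_map_from_subtopology[OF continuous_map_product_projection[OF assms,
      of "\<lambda>_. top_of_set (cball (0::complex) 1)"]]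
  unfolding moment_angle_complex_def continuous_map_in_subtopology by blast

lemma torus_facet_norm:
  assumes "connected_building_set V B" "t \<in> topspace (torus (facets (nestohedron B)))" "T \<in> B - {V}"
  shows "norm (t (nesto_facet B T)) = 1"
  using assms by (auto simp: topspace_torus facets_nestohedron PiE_iff)

lemma moduli_chart:
  assumes cb: "connected_building_set V B" and c: "face_coords V B c"
    and t: "t \<in> topspace (torus (facets (nestohedron B)))" and p: "p \<in> nestohedron B"
  shows "moduli V B (chart V B c (t, p)) = c p"
  using face_coords_mem[OF c p] torus_facet_norm[OF cb t]
  by (auto simp: vec_eq_iff moduli_def chart_def norm_mult cubes_def)

lemma continuous_map_chart:
  assumes cb: "connected_building_set V B" and c: "face_coords V B c"
  shows "continuous_map (torus_times (nestohedron B))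
    (moment_angle_complex (B - {V}) (nested_set_complex V B)) (chart V B c)"
proof -
  let ?X = "torus_times (nestohedron B)" and ?Z = "moment_angle_complex (B - {V}) (nested_set_complex V B)"
  have top: "chart V B c x \<in> topspace ?Z" if "x \<in> topspace ?X" for x
  proof -
    obtain t p where x: "x = (t, p)" by (cases x)
    then have "t \<in> topspace (torus (facets (nestohedron B)))" "p \<in> nestohedron B" using that by auto
    then show ?thesis
      unfolding topspace_moment_angle_complex[OF cb] x
      using moduli_chart[OF cb c] face_coords_mem[OF c] by (simp add: chart_def)
  qed
  have "continuous_map ?X euclidean (\<lambda>x. chart V B c x T)" if T: "T \<in> B - {V}" for T
  proof -
    have F: "nesto_facet B T \<in> facets (nestohedron B)" using T facets_nestohedron[OF cb] by blast
    have "continuous_map (torus (facets (nestohedron B))) euclidean (\<lambda>t. t (nesto_facet B T))"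
      using continuous_map_product_projection[OF F, of "\<lambda>_. top_of_set (sphere 0 1)"]
      unfolding torus_def continuous_map_in_subtopology by (rule conjunct1)
    then have 1: "continuous_map ?X euclidean ((\<lambda>t. t (nesto_facet B T)) \<circ> fst)"
      by (rule continuous_map_compose[OF continuous_map_fst])
    have "continuous_on (nestohedron B) (\<lambda>p. complex_of_real (c p $ T))"
      using c unfolding face_coords_def by (intro continuous_intros) simp
    then have "continuous_map ?X euclidean ((\<lambda>p. complex_of_real (c p $ T)) \<circ> snd)"
      by (intro continuous_map_compose[OF continuous_map_snd]) simp
    from continuous_map_complex_mult[OF 1 this] show ?thesis
      using T by (simp add: chart_def case_prod_beta o_def)
  qed
  then show ?thesis using top by (intro continuous_map_moment_angle_complex) simp_all
qed

text \<open>Moduli recover the point of the polytope. A circle coordinate is recovered exactly where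
  the modulus is nonzero, that is, off the facets through that point.\<close>

lemma chart_eq_iff:
  assumes cb: "connected_building_set V B" and c: "face_coords V B c"
    and t: "t \<in> topspace (torus (facets (nestohedron B)))" and p: "p \<in> nestohedron B"
    and u: "u \<in> topspace (torus (facets (nestohedron B)))" and q: "q \<in> nestohedron B"
  shows "chart V B c (t, p) = chart V B c (u, q) \<longleftrightarrow> ((t, p), (u, q)) \<in> ma_rel (nestohedron B)"
proof
  assume eq: "chart V B c (t, p) = chart V B c (u, q)"
  then have "c p = c q"
    using moduli_chart[OF cb c t p] moduli_chart[OF cb c u q] by simp
  then have pq: "p = q" using face_coords_inj[OF c] p q by (simp add: inj_on_def)
  have "t (nesto_facet B T) = u (nesto_facet B T)" if T: "T \<in> B - {V}" "p \<notin> nesto_facet B T" for T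
  proof -
    have "t (nesto_facet B T) * of_real (c p $ T) = u (nesto_facet B T) * of_real (c p $ T)"
      using fun_cong[OF eq, of T] T(1) pq by (simp add: chart_def)
    then show ?thesis using face_coords_zero_iff[OF c p T(1)] T(2) by simp
  qed
  then show "((t, p), (u, q)) \<in> ma_rel (nestohedron B)"
    using t u p pq by (auto simp: ma_rel_iff[OF convex_nestohedron] facets_nestohedron[OF cb])
next
  assume "((t, p), (u, q)) \<in> ma_rel (nestohedron B)"
  then have pq: "q = p" and tu: "\<forall>T\<in>B - {V}. p \<notin> nesto_facet B T \<longrightarrow> t (nesto_facet B T) = u (nesto_facet B T)"
    by (auto simp: ma_rel_iff[OF convex_nestohedron] facets_nestohedron[OF cb])
  have "t (nesto_facet B T) * of_real (c p $ T) = u (nesto_facet B T) * of_real (c p $ T)"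
    if T: "T \<in> B - {V}" for T
    using face_coords_zero_iff[OF c p T] tu T by (cases "p \<in> nesto_facet B T") simp_all
  then show "chart V B c (t, p) = chart V B c (u, q)"
    unfolding pq chart_def by (auto simp: fun_eq_iff)
qed

lemma chart_phase:
  assumes cb: "connected_building_set V B" and z: "z \<in> extensional (B - {V})"
  shows "\<exists>t. t \<in> topspace (torus (facets (nestohedron B))) \<and>
     (\<forall>T\<in>B - {V}. t (nesto_facet B T) = phase (z T)) \<and>
     (\<forall>c p. c p = moduli V B z \<longrightarrow> chart V B c (t, p) = z)"
proof -
  let ?f = "inv_into (B - {V}) (nesto_facet B)"
  define t where "t = (\<lambda>F\<in>facets (nestohedron B). phase (z (?f F)))"
  have tT: "t (nesto_facet B T) = phase (z T)" if "T \<in> B - {V}" for T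
    using that by (auto simp: t_def facets_nestohedron[OF cb] inj_on_nesto_facet[OF cb])
  have "t \<in> topspace (torus (facets (nestohedron B)))" by (auto simp: t_def topspace_torus)
  moreover have "chart V B c (t, p) = z" if cp: "c p = moduli V B z" for c p
  proof
    fix T
    show "chart V B c (t, p) T = z T"
    proof (cases "T \<in> B - {V}")
      case True
      then have "moduli V B z $ T = norm (z T)" by (simp add: moduli_def)
      then show ?thesis
        using True tT[OF True] phase_mult_norm[of "z T"] by (simp add: chart_def cp)
    next
      case False
      then show ?thesis
        unfolding extensional_arb[OF z False] chart_def prod.case restrict_def by (simp only: if_False)
    qed
  qed
  ultimately show ?thesis using tT by blast
qed

lemma moment_angle_homeomorphism:
  assumes cb: "connected_building_set V B" and c: "face_coords V B c"
  shows "\<exists>h. homeomorphic_map (moment_angle_manifold (nestohedron B))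
      (moment_angle_complex (B - {V}) (nested_set_complex V B)) h \<and>
    (\<forall>x\<in>topspace (torus_times (nestohedron B)). h (ma_rel (nestohedron B) `` {x}) = chart V B c x)"
  unfolding moment_angle_manifold_def
proof (rule quotient_topology_homeomorphic)
  let ?X = "torus_times (nestohedron B)" and ?Z = "moment_angle_complex (B - {V}) (nested_set_complex V B)"
  show cont: "continuous_map ?X ?Z (chart V B c)" by (rule continuous_map_chart[OF cb c])
  show "chart V B c ` topspace ?X = topspace ?Z"
  proof
    show "chart V B c ` topspace ?X \<subseteq> topspace ?Z" using cont continuous_map_image_subset_topspace by blast
    show "topspace ?Z \<subseteq> chart V B c ` topspace ?X"
    proof
      fix z assume z: "z \<in> topspace ?Z"
      have z': "z \<in> extensional (B - {V})" "moduli V B z \<in> cubes V B"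
        using z topspace_moment_angle_complex[OF cb] by blast+
      obtain p where p: "p \<in> nestohedron B" "c p = moduli V B z"
        using z'(2) c unfolding face_coords_def bij_betw_def by (metis imageE)
      obtain t where t: "t \<in> topspace (torus (facets (nestohedron B)))" "chart V B c (t, p) = z"
        using chart_phase[OF cb z'(1)] p(2) by blast
      then show "z \<in> chart V B c ` topspace ?X" using p(1) by (intro image_eqI[of _ _ "(t, p)"]) auto
    qed
  qed
  show "ma_rel (nestohedron B) =
      {(x, y). x \<in> topspace ?X \<and> y \<in> topspace ?X \<and> chart V B c x = chart V B c y}"
  proof (rule Set.set_eqI)
    fix a :: "(((real ^ 'a) set \<Rightarrow> complex) \<times> (real ^ 'a)) \<times> (((real ^ 'a) set \<Rightarrow> complex) \<times> (real ^ 'a))"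
    obtain t p u q where a: "a = ((t, p), u, q)" by (metis surj_pair)
    show "a \<in> ma_rel (nestohedron B) \<longleftrightarrow> a \<in>
        {(x, y). x \<in> topspace ?X \<and> y \<in> topspace ?X \<and> chart V B c x = chart V B c y}"
    proof (cases "(t, p) \<in> topspace ?X \<and> (u, q) \<in> topspace ?X")
      case True
      then show ?thesis unfolding a using chart_eq_iff[OF cb c, of t p u q] by simp
    next
      case False
      then show ?thesis unfolding a ma_rel_iff[OF convex_nestohedron] by auto
    qed
  qed
qed (rule compact_torus_times Hausdorff_moment_angle_complex)+

section \<open>The face given by a vertex of the contraction\<close>

lemma connected_bs_restrict:
  assumes "building_set V B" "S \<in> B"
  shows "connected_building_set S (bs_restrict B S)"
  using assms building_set_nonempty[OF assms] building_set_subset[OF assms] finite_subset[of S V]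
  unfolding connected_building_set_def building_set_def bs_restrict_def by auto

lemma connected_bs_contract:
  assumes cb: "connected_building_set V B" and S: "S \<in> B - {V}"
  shows "connected_building_set (V - S) (bs_contract V B S)"
proof -
  have bs: "building_set V B" and V: "V \<in> B"
    using cb by (auto simp: connected_building_set_def)
  have SV: "S \<subset> V" using S building_set_subset[OF bs, of S] by blast
  have U: "T \<union> R \<in> bs_contract V B S"
    if T: "T \<in> bs_contract V B S" and R: "R \<in> bs_contract V B S" and TR: "T \<inter> R \<noteq> {}" for T R
  proof -
    obtain T' R' where "T' \<in> B" "T' = T \<or> T' = T \<union> S" "R' \<in> B" "R' = R \<or> R' = R \<union> S"
      using T R unfolding bs_contract_def by blast
    moreover have "T' \<union> R' \<in> B" using calculation TR by (intro building_set_Un[OF bs]) auto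
    moreover have "T' \<union> R' = T \<union> R \<or> T' \<union> R' = T \<union> R \<union> S" using calculation by auto
    ultimately have "T \<union> R \<in> B \<or> T \<union> R \<union> S \<in> B" by metis
    then show ?thesis using T R unfolding bs_contract_def by auto
  qed
  have "V - S \<union> S \<in> B" using SV V by (simp add: Un_absorb2 less_imp_le)
  then have "V - S \<in> bs_contract V B S" using SV by (auto simp: bs_contract_def)
  moreover have "{x} \<in> bs_contract V B S" if "x \<in> V - S" for x
    using that building_set_singleton[OF bs, of x] by (auto simp: bs_contract_def)
  moreover have "bs_contract V B S \<subseteq> Pow (V - S) - {{}}" by (auto simp: bs_contract_def)
  moreover have "finite (V - S)" "V - S \<noteq> {}"
    using SV bs by (auto simp: building_set_def)
  ultimately show ?thesis
    unfolding connected_building_set_def building_set_def using U by simp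
qed

text \<open>
  The nested set of a vertex is maximal: a set of it that had two elements outside the
  smaller ones would contribute a segment through the vertex.
\<close>

lemma extreme_point_nested:
  assumes cb: "connected_building_set V B" and p: "p extreme_point_of nestohedron B"
    and U: "U = V \<or> (U \<in> B - {V} \<and> p \<in> nesto_facet B U)"
    and i: "i \<in> U" "\<And>T. T \<in> B - {V} \<Longrightarrow> p \<in> nesto_facet B T \<Longrightarrow> i \<in> T \<Longrightarrow> U \<subseteq> T"
    and k: "k \<in> U" "\<And>T. T \<in> B - {V} \<Longrightarrow> p \<in> nesto_facet B T \<Longrightarrow> k \<in> T \<Longrightarrow> U \<subseteq> T"
  shows "i = k"
proof (rule ccontr)
  assume ik: "i \<noteq> k"
  have \<beta>: "\<forall>i. (\<lambda>_. 1 :: real) i > 0" by simp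
  have pP: "p \<in> nestohedron B" using p by (simp add: extreme_point_of_def)
  define y where "y = coord V B (\<lambda>_. 1) p"
  have y: "y \<in> cubes V B" "moment B (\<lambda>_. 1) y = p"
    using coord_in_cubes[OF cb \<beta> pP] by (auto simp: y_def)
  have UB: "U \<in> B" using U connected_building_set_top[OF cb] by auto
  have y0: "U \<subseteq> R" if "y $ R = 0" "i \<in> R \<or> k \<in> R" for R
  proof -
    have R: "R \<in> B - {V}" using y(1) that(1) by (metis (mono_tags, lifting) cubes_def mem_Collect_eq zero_neq_one)
    then have "p \<in> nesto_facet B R" using moment_in_facet_iff[OF cb y(1) \<beta> R] that(1) y(2) by simp
    then show ?thesis using i(2) k(2) R that(2) by blast
  qed
  let ?b = "\<lambda>T. bary (\<lambda>_. 1) T y"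
  have bh: "?b T \<in> convex hull ((\<lambda>i. axis i 1) ` T)" if "T \<in> B" for T
    using bary_in_hull[OF y(1) that \<beta>] .
  have bU: "\<forall>j. 0 \<le> ?b U $ j" "\<forall>j. j \<notin> U \<longrightarrow> ?b U $ j = 0" "(\<Sum>j\<in>U. ?b U $ j) = 1"
    using bh[OF UB] unfolding mem_axis_hull_iff by blast+
  \<comment> \<open>A zero set containing i or k contains all of U, so it does not suppress these
    coordinates of the summand at U. That summand can be moved along e_i - e_k in both
    directions.\<close>
  have nz: "?b U $ i \<noteq> 0" "?b U $ k \<noteq> 0"
    using bary_zero_iff[OF y(1) UB \<beta> i(1)] bary_zero_iff[OF y(1) UB \<beta> k(1)] y0 by blast+
  define e where "e = min (?b U $ i) (?b U $ k)"
  have e: "e > 0" using nz bU(1) by (simp add: e_def order_less_le)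
  define d :: "real ^ 'a" where "d = axis i 1 - axis k 1"
  have d: "d $ j = (if j = i then 1 else 0) - (if j = k then 1 else 0)" for j
    by (simp add: d_def axis_def)
  have "d $ i = 1" using ik by (simp add: d)
  then have d0: "d \<noteq> 0" by auto
  have mem: "p + c *\<^sub>R d \<in> nestohedron B" if c: "\<bar>c\<bar> \<le> e" for c
  proof -
    let ?s = "\<lambda>T. if T = U then ?b U + c *\<^sub>R d else ?b T"
    have "?b U + c *\<^sub>R d \<in> convex hull ((\<lambda>i. axis i 1) ` U)"
      unfolding mem_axis_hull_iff
    proof (intro conjI allI impI)
      have ge: "\<bar>c\<bar> \<le> ?b U $ i" "\<bar>c\<bar> \<le> ?b U $ k" using c by (auto simp: e_def)
      show "0 \<le> (?b U + c *\<^sub>R d) $ j" for j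
        using ge bU(1)[rule_format, of j] by (auto simp: d)
      show "(?b U + c *\<^sub>R d) $ j = 0" if "j \<notin> U" for j
        using that bU(2) i(1) k(1) by (auto simp: d)
      have "(\<Sum>j\<in>U. d $ j) = 0" using i(1) k(1) by (simp add: d sum_subtractf)
      then show "(\<Sum>j\<in>U. (?b U + c *\<^sub>R d) $ j) = 1"
        using bU(3) by (simp add: sum.distrib sum_distrib_left[symmetric])
    qed
    then have "\<forall>T\<in>B. ?s T \<in> convex hull ((\<lambda>i. axis i 1) ` T)" using bh by simp
    moreover have "p + c *\<^sub>R d = (\<Sum>T\<in>B. ?s T)"
    proof -
      have "(\<Sum>T\<in>B. ?s T) = (\<Sum>T\<in>B. ?b T + (if T = U then c *\<^sub>R d else 0))"
        by (intro sum.cong) auto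
      then show ?thesis using UB y(2) by (simp add: sum.distrib moment_def)
    qed
    ultimately show ?thesis unfolding mem_nestohedron_iff by (intro exI[of _ ?s]) simp
  qed
  have "p \<in> open_segment (p + e *\<^sub>R d) (p + (- e) *\<^sub>R d)"
    unfolding in_segment using e d0 by (intro conjI exI[of _ "1/2"]) (auto simp: algebra_simps scaleR_2[symmetric])
  moreover have "p + e *\<^sub>R d \<in> nestohedron B" "p + (- e) *\<^sub>R d \<in> nestohedron B"
    using mem[of e] mem[of "- e"] e by auto
  ultimately show False using p unfolding extreme_point_of_def by blast
qed

definition lift_set :: "'v set set \<Rightarrow> 'v set \<Rightarrow> 'v set \<Rightarrow> 'v set" where
  "lift_set B S U = (if U \<union> S \<in> B then U \<union> S else U)"

definition face_nested :: "'v::finite set \<Rightarrow> 'v set set \<Rightarrow> 'v set \<Rightarrow> real ^ 'v \<Rightarrow> 'v set set" where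
  "face_nested V B S v = insert S (lift_set B S `
     {U \<in> bs_contract V B S - {V - S}. v \<in> nesto_facet (bs_contract V B S) U})"

lemma product_face_eq: "product_face V B S v = \<Inter>(nesto_facet B ` face_nested V B S v)"
  by (simp only: product_face_def face_nested_def lift_set_def image_insert Inter_insert image_image)

lemma lift_set_Diff:
  assumes "U \<in> bs_contract V B S"
  shows "lift_set B S U - S = U"
  using assms by (auto simp: lift_set_def bs_contract_def)

lemma lift_set_not_subset:
  assumes "U \<in> bs_contract V B S"
  shows "\<not> lift_set B S U \<subseteq> S"
  using assms by (auto simp: lift_set_def bs_contract_def)

lemma face_nested_not_subset:
  assumes "T \<in> face_nested V B S v" "T \<noteq> S"
  shows "\<not> T \<subseteq> S"
  using assms lift_set_not_subset unfolding face_nested_def by blast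

lemma face_nested_subset:
  assumes cb: "connected_building_set V B" and S: "S \<in> B - {V}"
  shows "face_nested V B S v \<subseteq> B - {V}"
proof -
  have bs: "building_set V B" using cb by (rule connected_building_set_imp)
  have SV: "S \<subset> V" "S \<noteq> {}"
    using S building_set_subset[OF bs, of S] building_set_nonempty[OF bs, of S] by blast+
  have "lift_set B S U \<in> B - {V}" if U: "U \<in> bs_contract V B S" "U \<noteq> V - S" for U
  proof -
    have "lift_set B S U \<in> B" using U by (auto simp: lift_set_def bs_contract_def)
    moreover have "lift_set B S U \<noteq> V" using lift_set_Diff[OF U(1)] U(2) by blast
    ultimately show ?thesis by simp
  qed
  then show ?thesis using S unfolding face_nested_def by blast
qed

text \<open>Transfers maximality from the contraction. If T could be added, let R be its parent, and
  let i and k be the indices provided for T and R. Both are outside S and in no set of a facet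
  through v that is smaller than R - S, so \<open>extreme_point_nested\<close> gives i = k, although
  k is not in T.\<close>

lemma face_nested_maximal:
  assumes cb: "connected_building_set V B" and S: "S \<in> B - {V}"
    and v: "v extreme_point_of nestohedron (bs_contract V B S)"
    and T: "T \<in> B - {V}" "\<not> T \<subseteq> S" and n: "nested B (insert T (face_nested V B S v))"
  shows "T \<in> face_nested V B S v"
proof (rule ccontr)
  assume T0: "T \<notin> face_nested V B S v"
  let ?C = "bs_contract V B S" and ?\<sigma> = "face_nested V B S v"
  have cC: "connected_building_set (V - S) ?C" using connected_bs_contract[OF cb S] .
  have bs: "building_set V B" and VB: "V \<in> B" using cb by (auto simp: connected_building_set_def)
  have SV: "S \<subset> V" using S building_set_subset[OF bs, of S] by blast
  have sub: "insert T ?\<sigma> \<subseteq> B" using T(1) face_nested_subset[OF cb S] by blast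
  obtain R where R: "R \<in> insert V (insert T ?\<sigma>)" "T \<subset> R"
      "\<And>Q. Q \<in> insert V (insert T ?\<sigma>) \<Longrightarrow> T \<subset> Q \<Longrightarrow> R \<subseteq> Q"
    using nested_parent[OF cb n sub T(1)] by blast
  have RB: "R \<in> B" using R(1) sub VB by blast
  obtain i where i: "i \<in> T" "\<And>Q. Q \<in> insert T ?\<sigma> \<Longrightarrow> i \<in> Q \<Longrightarrow> T \<subseteq> Q"
    using n T(1) unfolding nested_def by (metis DiffD1)
  obtain k where k: "k \<in> R" "\<And>Q. Q \<in> insert T ?\<sigma> \<Longrightarrow> k \<in> Q \<Longrightarrow> R \<subseteq> Q"
    using n RB unfolding nested_def by metis
  have S\<sigma>: "S \<in> ?\<sigma>" by (simp add: face_nested_def)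
  have RS: "\<not> R \<subseteq> S" using R(2) T(2) by blast
  have iS: "i \<notin> S" using i(2)[of S] S\<sigma> T(2) by blast
  have kS: "k \<notin> S" using k(2)[of S] S\<sigma> RS by blast
  have kT: "k \<notin> T" using k(2)[of T] R(2) by blast
  let ?U = "R - S"
  \<comment> \<open>The lift of Q is in the nested set. If it contains k, it contains R; if it
    contains i, it contains T, strictly because T is not in the nested set, and hence the parent
    R.\<close>
  have Q: "?U \<subseteq> Q" if Q: "Q \<in> ?C - {V - S}" "v \<in> nesto_facet ?C Q" "i \<in> Q \<or> k \<in> Q" for Q
  proof -
    have L: "lift_set B S Q \<in> ?\<sigma>" using Q(1,2) unfolding face_nested_def by blast
    have "Q \<subseteq> lift_set B S Q" by (auto simp: lift_set_def)
    then have ik: "i \<in> lift_set B S Q \<or> k \<in> lift_set B S Q" using Q(3) by blast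
    have "R \<subseteq> lift_set B S Q"
    proof (cases "k \<in> lift_set B S Q")
      case True
      then show ?thesis using k(2) L by blast
    next
      case False
      then have "T \<subseteq> lift_set B S Q" using i(2) L ik by blast
      moreover have "T \<noteq> lift_set B S Q" using L T0 by blast
      ultimately show ?thesis using R(3) L by blast
    qed
    then show ?thesis using lift_set_Diff[of Q V B S] Q(1) by blast
  qed
  have "?U = V - S \<or> (?U \<in> ?C - {V - S} \<and> v \<in> nesto_facet ?C ?U)"
  proof (cases "R = V")
    case False
    then have "R \<in> ?\<sigma>" "R \<noteq> S" using R(1,2) RS by auto
    then obtain U where U: "U \<in> ?C - {V - S}" "v \<in> nesto_facet ?C U" "R = lift_set B S U"
      unfolding face_nested_def by blast
    then show ?thesis using lift_set_Diff[of U V B S] by auto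
  qed simp
  then have "i = k"
    by (rule extreme_point_nested[OF cC v]) (use i(1) k(1) iS kS R(2) Q in blast)+
  then show False using i(1) kT by blast
qed

text \<open>For R \<subseteq> S the index comes from \<tau>, since the members of \<sigma> that meet
  S contain S. For other R it comes from \<sigma>; it is outside S, hence outside all members of
  \<tau>.\<close>

lemma nested_bs_restrict_Un:
  assumes bs: "building_set V B" and \<sigma>: "nested B \<sigma>" "\<sigma> \<subseteq> B" and S: "S \<in> \<sigma>"
    and ns: "\<And>T. T \<in> \<sigma> \<Longrightarrow> T \<noteq> S \<Longrightarrow> \<not> T \<subseteq> S"
    and \<tau>: "nested (bs_restrict B S) \<tau>" "\<tau> \<subseteq> bs_restrict B S"
  shows "nested B (\<sigma> \<union> \<tau>)"
  unfolding nested_def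
proof
  fix R assume R: "R \<in> B"
  show "\<exists>i\<in>R. \<forall>T\<in>\<sigma> \<union> \<tau>. i \<in> T \<longrightarrow> R \<subseteq> T"
  proof (cases "R \<subseteq> S")
    case True
    then have "R \<in> bs_restrict B S" using R by (simp add: bs_restrict_def)
    then obtain i where i: "i \<in> R" "\<And>T. T \<in> \<tau> \<Longrightarrow> i \<in> T \<Longrightarrow> R \<subseteq> T"
      using \<tau>(1) unfolding nested_def by metis
    have "R \<subseteq> T" if T: "T \<in> \<sigma>" "i \<in> T" for T
    proof -
      have "T \<inter> S \<noteq> {}" using T(2) i(1) True by blast
      then have "T \<subseteq> S \<or> S \<subseteq> T" using nested_comparable[OF bs \<sigma>(1) T(1) S] \<sigma>(2) T(1) S by blast
      then show ?thesis using ns[OF T(1)] True by blast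
    qed
    then show ?thesis using i by blast
  next
    case False
    obtain i where i: "i \<in> R" "\<And>T. T \<in> \<sigma> \<Longrightarrow> i \<in> T \<Longrightarrow> R \<subseteq> T"
      using \<sigma>(1) R unfolding nested_def by metis
    have "i \<notin> S" using i(2)[OF S] False by blast
    then have "i \<notin> T" if "T \<in> \<tau>" for T using \<tau>(2) that unfolding bs_restrict_def by blast
    then show ?thesis using i by blast
  qed
qed

lemma nested_bs_restrict: "nested B \<tau> \<Longrightarrow> nested (bs_restrict B S) \<tau>"
  by (simp add: nested_def bs_restrict_def)

section \<open>Moving disc coordinates\<close>

lemma moment_scale:
  fixes \<sigma> :: "'v::finite set set"
  assumes z: "\<And>T. z $ T = (if T \<in> \<sigma> then 2 * y $ T else y $ T)"
  shows "moment B (\<lambda>i. \<Prod>T | T \<in> \<sigma> \<and> i \<in> T. 2) y = moment B (\<lambda>_. 1) z"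
proof -
  let ?\<beta> = "\<lambda>i. \<Prod>T | T \<in> \<sigma> \<and> i \<in> T. (2::real)"
  have "bary ?\<beta> T y = bary (\<lambda>_. 1) T z" for T
  proof -
    \<comment> \<open>Doubling contributes a 2 for each R in \<sigma> with i in R and not T
      \<subseteq> R. The weight of i also counts the R containing T; these form c, which is common
      to all i in T and cancels.\<close>
    define c :: real where "c = (\<Prod>R | R \<in> \<sigma> \<and> T \<subseteq> R. 2)"
    have c: "c \<noteq> 0" by (simp add: c_def)
    have e: "?\<beta> i * num T y i = c * num T z i" if i: "i \<in> T" for i
    proof -
      have "{R. R \<in> \<sigma> \<and> i \<in> R} = {R. R \<in> \<sigma> \<and> T \<subseteq> R} \<union> {R. i \<in> R \<and> \<not> T \<subseteq> R \<and> R \<in> \<sigma>}"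
        using i by auto
      then have "?\<beta> i = (\<Prod>R\<in>{R. R \<in> \<sigma> \<and> T \<subseteq> R} \<union> {R. i \<in> R \<and> \<not> T \<subseteq> R \<and> R \<in> \<sigma>}. 2)"
        by (simp only:)
      also have "\<dots> = c * (\<Prod>R | i \<in> R \<and> \<not> T \<subseteq> R \<and> R \<in> \<sigma>. 2)"
        unfolding c_def by (rule prod.union_disjoint) auto
      also have "(\<Prod>R | i \<in> R \<and> \<not> T \<subseteq> R \<and> R \<in> \<sigma>. 2) = (\<Prod>R | i \<in> R \<and> \<not> T \<subseteq> R. if R \<in> \<sigma> then 2 else (1::real))"
        by (rule prod.mono_neutral_cong_left) auto
      finally have "?\<beta> i * num T y i = c * ((\<Prod>R | i \<in> R \<and> \<not> T \<subseteq> R. if R \<in> \<sigma> then 2 else 1) * num T y i)"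
        by (simp only: mult.assoc)
      also have "(\<Prod>R | i \<in> R \<and> \<not> T \<subseteq> R. if R \<in> \<sigma> then 2 else 1) * num T y i = num T z i"
        unfolding num_def prod.distrib[symmetric] by (rule prod.cong) (auto simp: z)
      finally show ?thesis .
    qed
    have "(\<Sum>k\<in>T. ?\<beta> k * num T y k) = c * (\<Sum>k\<in>T. num T z k)"
      unfolding sum_distrib_left by (rule sum.cong) (simp_all only: e)
    then show ?thesis using c by (simp add: bary_def vec_eq_iff e del: prod_constant)
  qed
  then show ?thesis by (simp add: moment_def)
qed

text \<open>A shift to the right by half the distance to the boundary: the boundary stays fixed and
  the centre goes to 1/2.\<close>

definition disc_move :: "complex \<Rightarrow> complex" where
  "disc_move x = x + of_real ((1 - norm x) / 2)"

lemma disc_move_0: "disc_move 0 = 1 / 2"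
  by (simp add: disc_move_def)

text \<open>The shift is Lipschitz with constant 1/2, so it cannot make up for the distance between
  distinct points.\<close>

lemma inj_disc_move: "inj disc_move"
proof (rule injI)
  fix x y assume "disc_move x = disc_move y"
  then have "x - y = of_real ((norm x - norm y) / 2)"
    by (simp add: disc_move_def algebra_simps diff_divide_distrib)
  then have "norm (x - y) = \<bar>norm x - norm y\<bar> / 2" by (metis abs_divide abs_numeral norm_of_real)
  moreover have "\<bar>norm x - norm y\<bar> \<le> norm (x - y)" by (rule norm_triangle_ineq3)
  ultimately obtain a where "norm (x - y) = a / 2" "a \<le> norm (x - y)" by blast
  then have "norm (x - y) = 0" using norm_ge_zero[of "x - y"] by linarith
  then show "x = y" by simp
qed

lemma norm_disc_move:
  assumes "norm x \<le> 1"
  shows "norm (disc_move x) \<le> 1" "norm (disc_move x) < 1 \<longleftrightarrow> norm x < 1"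
proof -
  have "norm (disc_move x) \<le> norm x + norm (of_real ((1 - norm x) / 2) :: complex)"
    unfolding disc_move_def by (rule norm_triangle_ineq)
  also have "\<dots> = (1 + norm x) / 2" unfolding norm_of_real using assms by (simp add: field_simps)
  finally have le: "norm (disc_move x) \<le> (1 + norm x) / 2" .
  show "norm (disc_move x) \<le> 1" using le assms by simp
  have "disc_move x = x" if "norm x = 1" using that by (simp add: disc_move_def)
  then show "norm (disc_move x) < 1 \<longleftrightarrow> norm x < 1" using le assms by (cases "norm x = 1") auto
qed

lemma disc_move_surj:
  assumes "norm y \<le> 1"
  shows "\<exists>x. norm x \<le> 1 \<and> disc_move x = y"
proof -
  \<comment> \<open>A preimage has the form y - s, where s is its own shift, that is, 2 s + norm (y
    - s) = 1. The left-hand side is at most 1 at s = 0 and at least 1 at s = 1/2.\<close>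
  let ?f = "\<lambda>s::real. 2 * s + norm (y - of_real s)"
  have "\<exists>s\<ge>0. s \<le> 1/2 \<and> ?f s = 1"
    by (rule IVT') (use assms in \<open>auto intro!: continuous_intros\<close>)
  then obtain s where s: "0 \<le> s" "?f s = 1" by blast
  have "(1 - norm (y - of_real s)) / 2 = s" using s(2) by (simp add: field_simps)
  then have "disc_move (y - of_real s) = y" unfolding disc_move_def by (simp only: diff_add_cancel)
  moreover have "norm (y - of_real s) \<le> 1" using s by simp
  ultimately show ?thesis by blast
qed

lemma continuous_disc_move: "continuous_on UNIV disc_move"
  unfolding disc_move_def by (intro continuous_intros) auto

definition move_coords :: "'v set set \<Rightarrow> 'v set set \<Rightarrow> ('v set \<Rightarrow> complex) \<Rightarrow> 'v set \<Rightarrow> complex" where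
  "move_coords W \<sigma> z = (\<lambda>T\<in>W. if T \<in> \<sigma> then disc_move (z T) else z T)"

text \<open>Transported from the manifold, which is a quotient of a compact product.\<close>

lemma compact_moment_angle_complex:
  assumes cb: "connected_building_set V B"
  shows "compact_space (moment_angle_complex (B - {V}) (nested_set_complex V B))"
proof -
  let ?P = "nestohedron B"
  obtain h where h: "homeomorphic_map (moment_angle_manifold ?P)
      (moment_angle_complex (B - {V}) (nested_set_complex V B)) h"
    using moment_angle_homeomorphism[OF cb face_coords_coord[OF cb, of "\<lambda>_. 1"]] by auto
  have "compact_space (moment_angle_manifold ?P)"
    unfolding moment_angle_manifold_def by (rule compact_space_quotient_topology[OF compact_torus_times])
  then show ?thesis
    using h homeomorphic_compact_space homeomorphic_map_imp_homeomorphic_space by blast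
qed

text \<open>\<open>disc_move\<close> does not change which coordinates have modulus less than 1, so
  it respects the simplices.\<close>

lemma homeomorphic_map_move_coords:
  assumes cb: "connected_building_set V B"
  defines "Z \<equiv> moment_angle_complex (B - {V}) (nested_set_complex V B)"
  shows "homeomorphic_map Z Z (move_coords (B - {V}) \<sigma>)"
proof -
  let ?W = "B - {V}" and ?D = "move_coords (B - {V}) \<sigma>"
  have ext: "?D z \<in> extensional ?W" for z by (simp add: move_coords_def)
  have le: "norm (z T) \<le> 1" if "z \<in> topspace Z" "T \<in> ?W" for z T
  proof -
    have "moduli V B z $ T \<le> 1"
      using that topspace_moment_angle_complex[OF cb, of z] unfolding Z_def by (simp add: cubes_def)
    then show ?thesis using that(2) by (simp add: moduli_def)
  qed
  have mem_iff: "?D z \<in> topspace Z \<longleftrightarrow> z \<in> topspace Z"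
    if z: "z \<in> extensional ?W" "\<And>T. T \<in> ?W \<Longrightarrow> norm (z T) \<le> 1" for z
  proof -
    have "{T. moduli V B (?D z) $ T < 1} = {T. moduli V B z $ T < 1}"
      using norm_disc_move(2)[OF z(2)] by (auto simp: moduli_def move_coords_def)
    moreover have "moduli V B (?D z) $ T \<le> 1" "moduli V B z $ T \<le> 1"
      "0 \<le> moduli V B (?D z) $ T" "0 \<le> moduli V B z $ T"
      "T \<notin> ?W \<Longrightarrow> moduli V B (?D z) $ T = 1" "T \<notin> ?W \<Longrightarrow> moduli V B z $ T = 1" for T
      using z(2) norm_disc_move(1)[OF z(2)] by (auto simp: moduli_def move_coords_def)
    ultimately show ?thesis
      unfolding Z_def topspace_moment_angle_complex[OF cb] using z(1) ext by (simp add: cubes_def)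
  qed
  have extZ: "z \<in> extensional ?W" if "z \<in> topspace Z" for z
    using that topspace_moment_angle_complex[OF cb, of z] unfolding Z_def by simp
  have inZ: "?D z \<in> topspace Z" if "z \<in> topspace Z" for z
    using mem_iff[OF extZ[OF that] le[OF that]] that by blast
  have cont: "continuous_map Z Z ?D"
  proof -
    have pr: "continuous_map Z euclidean (\<lambda>z. z T)" if "T \<in> ?W" for T
      unfolding Z_def by (rule continuous_map_moment_angle_complex_component[OF that])
    have "continuous_map Z euclidean (\<lambda>z. ?D z T)" if T: "T \<in> ?W" for T
    proof (cases "T \<in> \<sigma>")
      case True
      have "continuous_map Z euclidean (disc_move \<circ> (\<lambda>z. z T))"
        by (rule continuous_map_compose[OF pr[OF T]]) (simp add: continuous_disc_move)
      then show ?thesis using T True by (simp add: move_coords_def o_def)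
    next
      case False
      then show ?thesis using pr[OF T] T by (simp add: move_coords_def)
    qed
    then show ?thesis
      using inZ unfolding Z_def by (intro continuous_map_moment_angle_complex) simp_all
  qed
  have surj: "?D ` topspace Z = topspace Z"
  proof
    show "?D ` topspace Z \<subseteq> topspace Z" using inZ by blast
    show "topspace Z \<subseteq> ?D ` topspace Z"
    proof
      fix w assume w: "w \<in> topspace Z"
      have "\<exists>x. norm x \<le> 1 \<and> (if T \<in> \<sigma> then disc_move x else x) = w T" if "T \<in> ?W" for T
        using disc_move_surj[OF le[OF w that]] le[OF w that] by (cases "T \<in> \<sigma>") auto
      then obtain f where f: "\<And>T. T \<in> ?W \<Longrightarrow> norm (f T) \<le> 1 \<and> (if T \<in> \<sigma> then disc_move (f T) else f T) = w T"
        by metis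
      define z where "z = restrict f ?W"
      have "?D z = w"
      proof
        fix T show "?D z T = w T"
          using f[of T] extensional_arb[OF extZ[OF w], of T]
          unfolding move_coords_def z_def restrict_def by presburger
      qed
      moreover have "z \<in> topspace Z"
        using mem_iff[of z] w f unfolding \<open>?D z = w\<close> by (simp add: z_def)
      ultimately show "w \<in> ?D ` topspace Z" by blast
    qed
  qed
  have inj: "inj_on ?D (topspace Z)"
  proof (rule inj_onI)
    fix z w assume zw: "z \<in> topspace Z" "w \<in> topspace Z" and eq: "?D z = ?D w"
    show "z = w"
    proof
      fix T show "z T = w T"
      proof (cases "T \<in> ?W")
        case True
        then have "(if T \<in> \<sigma> then disc_move (z T) else z T) = (if T \<in> \<sigma> then disc_move (w T) else w T)"
          using fun_cong[OF eq, of T] unfolding move_coords_def restrict_def by (simp only: if_True)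
        then show ?thesis using inj_disc_move by (auto split: if_splits dest: injD)
      next
        case False
        then show ?thesis using extensional_arb[OF extZ[OF zw(1)] False] extensional_arb[OF extZ[OF zw(2)] False] by simp
      qed
    qed
  qed
  show ?thesis
    by (rule continuous_imp_homeomorphic_map[OF cont _ _ surj inj])
      (simp_all add: Z_def compact_moment_angle_complex[OF cb] Hausdorff_moment_angle_complex)
qed

section \<open>The commutative diagram\<close>

lemma equiv_ma_rel: "convex P \<Longrightarrow> equiv (topspace (torus_times P)) (ma_rel P)"
  by (intro equivI refl_onI symI transI subsetI; clarsimp simp: ma_rel_iff)

text \<open>Of \<open>i\<close> only the homeomorphism onto the face and its behaviour on facets are
  given, and no formula.\<close>

locale product_face_embedding =
  fixes V S :: "'v::finite set" and B :: "'v set set"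
    and v :: "real ^ 'v" and i :: "real ^ 'v \<Rightarrow> real ^ 'v"
  assumes cb: "connected_building_set V B" and SB: "S \<in> B - {V}"
    and v: "v extreme_point_of nestohedron (bs_contract V B S)"
    and fi: "face_identification V B S v i"
begin

abbreviation "BS \<equiv> bs_restrict B S"
abbreviation "P \<equiv> nestohedron B"
abbreviation "Q \<equiv> nestohedron BS"
abbreviation "G \<equiv> product_face V B S v"
abbreviation "\<sigma> \<equiv> face_nested V B S v"

section \<open>Coordinates and facets of the face \<open>G\<close>\<close>

lemma bs: "building_set V B"
  using cb by (rule connected_building_set_imp)

lemma cbS: "connected_building_set S BS"
  using connected_bs_restrict[OF bs] SB by blast

lemma SV: "S \<subset> V"
  using SB building_set_subset[OF bs, of S] by blast

lemma BS_subset: "T \<in> BS - {S} \<Longrightarrow> T \<in> B - {V}" "T \<in> BS - {S} \<Longrightarrow> T \<subseteq> S"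
  using SV by (auto simp: bs_restrict_def)

lemma S_mem: "S \<in> \<sigma>"
  by (simp add: face_nested_def)

lemma \<sigma>_subset: "\<sigma> \<subseteq> B - {V}"
  by (rule face_nested_subset[OF cb SB])

lemma \<sigma>_disjoint: "T \<in> \<sigma> \<Longrightarrow> T \<notin> BS - {S}"
  using face_nested_not_subset[of T V B S v] by (auto simp: bs_restrict_def)

lemma G_iff: "p \<in> G \<longleftrightarrow> (\<forall>T\<in>\<sigma>. p \<in> nesto_facet B T)"
  by (simp add: product_face_eq)

lemma G_subset: "G \<subseteq> P"
  using S_mem by (auto simp: G_iff nesto_facet_def)

lemma i_image: "i ` Q = G" and i_inj: "inj_on i Q" and i_cont: "continuous_on Q i"
  using fi unfolding face_identification_def homeomorphism_def
  by (auto intro: inj_on_inverseI)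

lemma i_mem: "x \<in> Q \<Longrightarrow> i x \<in> G" "x \<in> Q \<Longrightarrow> i x \<in> P"
  using i_image G_subset by blast+

lemma i_facet: "T \<in> BS - {S} \<Longrightarrow> i ` nesto_facet BS T = G \<inter> nesto_facet B T"
  using fi unfolding face_identification_def by blast

lemma i_facet_iff:
  assumes T: "T \<in> BS - {S}" and x: "x \<in> Q"
  shows "x \<in> nesto_facet BS T \<longleftrightarrow> i x \<in> nesto_facet B T"
proof -
  have "nesto_facet BS T \<subseteq> Q" by (auto simp: nesto_facet_def)
  then have "x \<in> nesto_facet BS T \<longleftrightarrow> i x \<in> i ` nesto_facet BS T"
    using inj_on_image_mem_iff[OF i_inj x] by simp
  then show ?thesis using i_facet[OF T] i_mem(1)[OF x] by simp
qed

lemma Q_nonempty: "Q \<noteq> {}"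
proof -
  have "nested BS {}"
    using building_set_nonempty[OF connected_building_set_imp[OF cbS]] by (auto simp: nested_def)
  then have "cube_vertex {} \<in> cubes S BS" by (intro cube_vertex_in_cubes) auto
  then show ?thesis using moment_in_nestohedron[of _ S BS "\<lambda>_. 1"] by auto
qed

lemma nested_\<sigma>: "nested B \<sigma>"
proof -
  have "G \<noteq> {}" using Q_nonempty i_image by blast
  then have "P \<inter> \<Inter>(nesto_facet B ` \<sigma>) \<noteq> {}" using G_subset by (auto simp: product_face_eq)
  then show ?thesis using nested_iff_facets_meet[OF cb \<sigma>_subset] by blast
qed

text \<open>A coordinate below 1 at any other T would enlarge the nested set \<sigma>, against its
  maximality. So only coordinates at proper subsets of S in the building set vary along the
  face.\<close>

lemma coord_on_G:
  assumes c: "face_coords V B c" and p: "p \<in> G"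
  shows "T \<in> \<sigma> \<Longrightarrow> c p $ T = 0"
    and "T \<notin> \<sigma> \<Longrightarrow> T \<notin> BS - {S} \<Longrightarrow> c p $ T = 1"
proof -
  have pP: "p \<in> P" using p G_subset by blast
  have y: "c p \<in> cubes V B" by (rule face_coords_mem[OF c pP])
  have zero: "c p $ T = 0" if "T \<in> \<sigma>" for T
    using face_coords_zero_iff[OF c pP, of T] \<sigma>_subset that p by (auto simp: G_iff)
  then show "T \<in> \<sigma> \<Longrightarrow> c p $ T = 0" .
  assume T: "T \<notin> \<sigma>" "T \<notin> BS - {S}"
  show "c p $ T = 1"
  proof (rule ccontr)
    assume ne: "c p $ T \<noteq> 1"
    then have TB: "T \<in> B - {V}" using y by (auto simp: cubes_def)
    have "c p $ T < 1" using y ne by (auto simp: cubes_def order_less_le)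
    then have "insert T \<sigma> \<subseteq> {T. c p $ T < 1}" using zero by auto
    then have "nested B (insert T \<sigma>)" using y nested_subset unfolding cubes_def by blast
    moreover have "\<not> T \<subseteq> S" using T TB S_mem by (auto simp: bs_restrict_def)
    ultimately show False using face_nested_maximal[OF cb SB v TB] T(1) by blast
  qed
qed

text \<open>For uniqueness, let F_R have the same trace. R in \<sigma> would make the trace all of
  G; otherwise the coordinate at R vanishes somewhere on G, so R is in \<open>BS - {S}\<close> by
  \<open>coord_on_G\<close>, and traces of such facets are distinct.\<close>

lemma ambient_facet_eq:
  assumes T: "T \<in> BS - {S}"
  shows "ambient_facet Q P i (nesto_facet BS T) = nesto_facet B T"
  unfolding ambient_facet_def
proof (rule the_equality)
  show "nesto_facet B T facet_of P \<and> i ` nesto_facet BS T = i ` Q \<inter> nesto_facet B T"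
  proof
    have "nesto_facet B T \<in> facets P"
      unfolding facets_nestohedron[OF cb] using BS_subset(1)[OF T] by (rule imageI)
    then show "nesto_facet B T facet_of P" by simp
  qed (simp add: i_facet[OF T] i_image)
next
  have sub: "nesto_facet BS T \<subseteq> Q" by (auto simp: nesto_facet_def)
  have ne: "nesto_facet BS T \<noteq> {}" "nesto_facet BS T \<noteq> Q" using nesto_facet_ne[OF cbS T] by blast+
  fix F assume F: "F facet_of P \<and> i ` nesto_facet BS T = i ` Q \<inter> F"
  then have "F \<in> facets P" by simp
  then obtain R where R: "R \<in> B - {V}" "F = nesto_facet B R"
    unfolding facets_nestohedron[OF cb] by (elim imageE)
  have eq: "i ` nesto_facet BS T = G \<inter> nesto_facet B R" using F R(2) i_image by simp
  have "R \<notin> \<sigma>"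
  proof
    assume "R \<in> \<sigma>"
    then have "i ` nesto_facet BS T = i ` Q" using eq i_image by (auto simp: G_iff)
    then show False using ne(2) inj_on_image_eq_iff[OF i_inj sub order_refl] by blast
  qed
  moreover obtain p where p: "p \<in> G" "p \<in> nesto_facet B R" using eq ne(1) by blast
  have c: "face_coords V B (coord V B (\<lambda>_. 1))" by (rule face_coords_coord[OF cb]) simp
  have "coord V B (\<lambda>_. 1) p $ R = 0"
    using face_coords_zero_iff[OF c _ R(1)] p G_subset by blast
  ultimately have RS: "R \<in> BS - {S}" using coord_on_G(2)[OF c p(1), of R] by force
  then have "i ` nesto_facet BS T = i ` nesto_facet BS R" using eq i_facet by simp
  moreover have "nesto_facet BS R \<subseteq> Q" by (auto simp: nesto_facet_def)
  ultimately have "nesto_facet BS T = nesto_facet BS R"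
    using inj_on_image_eq_iff[OF i_inj sub] by blast
  then have "T = R" by (rule inj_onD[OF inj_on_nesto_facet[OF cbS] _ T RS])
  then show "F = nesto_facet B T" using R(2) by simp
qed

section \<open>The map induced on moment-angle manifolds\<close>

lemma torus_inclusion_eq:
  assumes T: "T \<in> B - {V}"
  shows "torus_inclusion Q P i t (nesto_facet B T) = (if T \<in> BS - {S} then t (nesto_facet BS T) else 1)"
proof -
  let ?a = "ambient_facet Q P i"
  have F: "nesto_facet B T \<in> facets P" unfolding facets_nestohedron[OF cb] using T by (rule imageI)
  have img: "?a ` facets Q = nesto_facet B ` (BS - {S})"
    unfolding facets_nestohedron[OF cbS] image_image by (rule image_cong) (simp_all only: ambient_facet_eq)
  have mem: "nesto_facet B T \<in> ?a ` facets Q \<longleftrightarrow> T \<in> BS - {S}"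
    unfolding img using inj_on_image_mem_iff[OF inj_on_nesto_facet[OF cb] T, of "BS - {S}"] BS_subset(1) by blast
  have inj: "inj_on ?a (facets Q)"
  proof (rule inj_onI)
    fix F F' assume "F \<in> facets Q" "F' \<in> facets Q" and eq: "?a F = ?a F'"
    then obtain R R' where R: "R \<in> BS - {S}" "F = nesto_facet BS R" "R' \<in> BS - {S}" "F' = nesto_facet BS R'"
      unfolding facets_nestohedron[OF cbS] by (elim imageE)
    then have "nesto_facet B R = nesto_facet B R'" using eq ambient_facet_eq by simp
    then have "R = R'"
      by (rule inj_onD[OF inj_on_nesto_facet[OF cb] _ BS_subset(1)[OF R(1)] BS_subset(1)[OF R(3)]])
    then show "F = F'" using R by simp
  qed
  have "inv_into (facets Q) ?a (nesto_facet B T) = nesto_facet BS T" if TS: "T \<in> BS - {S}"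
    using inv_into_f_f[OF inj, of "nesto_facet BS T"] TS facets_nestohedron[OF cbS] ambient_facet_eq[OF TS] by auto
  then show ?thesis using F mem by (simp add: torus_inclusion_def)
qed

lemma torus_inclusion_mem:
  assumes t: "t \<in> topspace (torus (facets Q))"
  shows "torus_inclusion Q P i t \<in> topspace (torus (facets P))"
proof -
  have "norm (torus_inclusion Q P i t F) = 1" if F: "F \<in> facets P" for F
  proof -
    obtain T where "T \<in> B - {V}" "F = nesto_facet B T"
      using F unfolding facets_nestohedron[OF cb] by (elim imageE)
    then show ?thesis using torus_inclusion_eq[of T t] torus_facet_norm[OF cbS t] by simp
  qed
  then show ?thesis by (auto simp: topspace_torus PiE_iff torus_inclusion_def)
qed

lemma induced_ma_map_class:
  assumes t: "t \<in> topspace (torus (facets Q))" and x: "x \<in> Q"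
  shows "induced_ma_map Q P i (ma_rel Q `` {(t, x)}) = ma_rel P `` {(torus_inclusion Q P i t, i x)}"
proof -
  let ?f = "\<lambda>(t, x). (torus_inclusion Q P i t, i x)"
  have rel: "(?f (t, x), ?f z) \<in> ma_rel P" if "z \<in> ma_rel Q `` {(t, x)}" for z
  proof -
    obtain u q where z: "z = (u, q)" by (cases z)
    have r: "((t, x), (u, q)) \<in> ma_rel Q" using that z by simp
    then have u: "z = (u, x)" "u \<in> topspace (torus (facets Q))"
      unfolding ma_rel_iff[OF convex_nestohedron] z by simp_all
    have u3: "t (nesto_facet BS T) = u (nesto_facet BS T)"
      if "T \<in> BS - {S}" "x \<notin> nesto_facet BS T" for T
    proof -
      have "nesto_facet BS T \<in> facets Q" unfolding facets_nestohedron[OF cbS] using that(1) by (rule imageI)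
      then show ?thesis using r that(2) unfolding ma_rel_iff[OF convex_nestohedron] by blast
    qed
    have "torus_inclusion Q P i t (nesto_facet B T) = torus_inclusion Q P i u (nesto_facet B T)"
      if T: "T \<in> B - {V}" "i x \<notin> nesto_facet B T" for T
      unfolding torus_inclusion_eq[OF T(1)] using u3[of T] i_facet_iff[OF _ x, of T] T(2) by simp
    then have "\<forall>F\<in>facets P. i x \<notin> F \<longrightarrow> torus_inclusion Q P i t F = torus_inclusion Q P i u F"
      unfolding facets_nestohedron[OF cb] by blast
    then show ?thesis
      unfolding u(1) prod.case ma_rel_iff[OF convex_nestohedron]
      using torus_inclusion_mem[OF t] torus_inclusion_mem[OF u(2)] i_mem(2)[OF x] by blast
  qed
  have self: "(t, x) \<in> ma_rel Q `` {(t, x)}"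
    using t x by (simp add: ma_rel_iff[OF convex_nestohedron])
  have "ma_rel P `` {?f z} = ma_rel P `` {?f (t, x)}" if "z \<in> ma_rel Q `` {(t, x)}" for z
    using equiv_class_eq[OF equiv_ma_rel[OF convex_nestohedron] rel[OF that]] by simp
  then have "(\<Union>z\<in>ma_rel Q `` {(t, x)}. ma_rel P `` {?f z}) = ma_rel P `` {?f (t, x)}"
    using self by blast
  then show ?thesis unfolding induced_ma_map_def by (simp add: Image_eq_UN[of _ "_ ` _"])
qed

text \<open>The coordinates of the face pulled back to Q, with those in \<sigma> reset to 1. The
  left vertical map is made from them, so it is tied to the chart used on P.\<close>

definition cS :: "('v \<Rightarrow> real) \<Rightarrow> real ^ 'v \<Rightarrow> real ^ ('v set)" where
  "cS \<beta> x = (\<chi> T. if T \<in> BS - {S} then coord V B \<beta> (i x) $ T else 1)"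

text \<open>The forgotten coordinates are constant on G, which gives injectivity. For surjectivity a
  point is extended by 0 on \<sigma>; nestedness of the result is
  \<open>nested_bs_restrict_Un\<close>.\<close>

lemma face_coords_cS:
  assumes \<beta>: "\<forall>j. \<beta> j > 0"
  shows "face_coords S BS (cS \<beta>)"
proof -
  let ?c = "coord V B \<beta>"
  have c: "face_coords V B ?c" by (rule face_coords_coord[OF cb \<beta>])
  have mem: "cS \<beta> x \<in> cubes S BS" if x: "x \<in> Q" for x
  proof -
    have y: "?c (i x) \<in> cubes V B" by (rule face_coords_mem[OF c i_mem(2)[OF x]])
    have sub: "{T. cS \<beta> x $ T < 1} \<subseteq> {T. ?c (i x) $ T < 1}" by (auto simp: cS_def)
    have "nested B {T. ?c (i x) $ T < 1}" using y by (simp add: cubes_def)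
    then have "nested BS {T. cS \<beta> x $ T < 1}" by (intro nested_bs_restrict nested_subset[OF _ sub])
    then show ?thesis using y by (simp add: cubes_def cS_def)
  qed
  have inj: "inj_on (cS \<beta>) Q"
  proof (rule inj_onI)
    fix x x' assume x: "x \<in> Q" and x': "x' \<in> Q" and eq: "cS \<beta> x = cS \<beta> x'"
    have "?c (i x) $ T = ?c (i x') $ T" for T
    proof (cases "T \<in> BS - {S}")
      case True
      then show ?thesis using arg_cong[OF eq, of "\<lambda>y. y $ T"] by (simp add: cS_def)
    next
      case False
      then show ?thesis
        using coord_on_G[OF c i_mem(1)[OF x], of T] coord_on_G[OF c i_mem(1)[OF x'], of T] by (cases "T \<in> \<sigma>") simp_all
    qed
    then have "?c (i x) = ?c (i x')" by (simp add: vec_eq_iff)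
    then have "i x = i x'" by (rule inj_onD[OF face_coords_inj[OF c] _ i_mem(2)[OF x] i_mem(2)[OF x']])
    then show "x = x'" by (rule inj_onD[OF i_inj _ x x'])
  qed
  have surj: "y' \<in> cS \<beta> ` Q" if y': "y' \<in> cubes S BS" for y'
  proof -
    define y :: "real ^ ('v set)" where "y = (\<chi> T. if T \<in> \<sigma> then 0 else y' $ T)"
    have out: "y' $ T = 1" if "T \<notin> BS - {S}" for T using y' that by (simp add: cubes_def)
    have sub: "{T. y' $ T < 1} \<subseteq> BS" using out by force
    have "nested B (\<sigma> \<union> {T. y' $ T < 1})"
      by (rule nested_bs_restrict_Un[OF bs nested_\<sigma> _ S_mem face_nested_not_subset])
        (use \<sigma>_subset y' sub in \<open>auto simp: cubes_def\<close>)
    moreover have "{T. y $ T < 1} = \<sigma> \<union> {T. y' $ T < 1}" by (auto simp: y_def)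
    moreover have "0 \<le> y $ T" "y $ T \<le> 1" for T using y' by (simp_all add: y_def cubes_def)
    moreover have "y $ T = 1" if "T \<notin> B - {V}" for T
      using that out[of T] BS_subset(1)[of T] \<sigma>_subset by (auto simp: y_def)
    ultimately have y: "y \<in> cubes V B" unfolding cubes_def by simp
    have "moment B \<beta> y \<in> nesto_facet B T" if "T \<in> \<sigma>" for T
      using moment_in_facet_iff[OF cb y \<beta>, of T] \<sigma>_subset that by (auto simp: y_def)
    then have "moment B \<beta> y \<in> G" unfolding G_iff by blast
    then obtain x where x: "x \<in> Q" "i x = moment B \<beta> y" using i_image by (metis imageE)
    have "cS \<beta> x = y'"
      using coord_moment[OF cb \<beta> y] \<sigma>_disjoint out by (auto simp: vec_eq_iff cS_def x(2) y_def)
    then show ?thesis using x(1) by blast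
  qed
  have "continuous_on Q (\<lambda>x. if T \<in> BS - {S} then ?c (i x) $ T else 1)" for T
  proof -
    have "continuous_on Q (?c \<circ> i)"
      using i_cont continuous_on_subset[OF continuous_on_coord[OF cb \<beta>] G_subset]
      by (intro continuous_on_compose) (simp_all add: i_image)
    then have "continuous_on Q (\<lambda>x. ?c (i x) $ T)" unfolding o_def by (rule continuous_on_component)
    then show ?thesis by (cases "T \<in> BS - {S}") (simp_all only: if_True if_False continuous_on_const)
  qed
  then have "continuous_on Q (cS \<beta>)"
    unfolding cS_def by (rule continuous_on_vec_lambda)
  moreover have "bij_betw (cS \<beta>) Q (cubes S BS)"
    unfolding bij_betw_def using inj mem surj by blast
  moreover have "cS \<beta> x $ T = 0 \<longleftrightarrow> x \<in> nesto_facet BS T" if "x \<in> Q" "T \<in> BS - {S}" for x T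
    using i_facet_iff[OF that(2,1)] face_coords_zero_iff[OF c i_mem(2)[OF that(1)] BS_subset(1)[OF that(2)]] that(2)
    by (simp add: cS_def)
  ultimately show ?thesis unfolding face_coords_def by blast
qed

text \<open>The base 2 is the factor between \<open>disc_move 0\<close> = 1/2 and the boundary value
  1.\<close>

definition \<beta> :: "'v \<Rightarrow> real" where
  "\<beta> j = (\<Prod>T | T \<in> \<sigma> \<and> j \<in> T. 2)"

lemma \<beta>_pos: "\<forall>j. \<beta> j > 0"
  by (simp add: \<beta>_def)

lemma face_coords_1: "face_coords V B (coord V B (\<lambda>_. 1))"
  by (rule face_coords_coord[OF cb]) simp

lemma face_coords_\<beta>: "face_coords V B (coord V B \<beta>)"
  by (rule face_coords_coord[OF cb \<beta>_pos])

abbreviation "ZQ \<equiv> moment_angle_manifold Q"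
abbreviation "ZP \<equiv> moment_angle_manifold P"
abbreviation "ZNS \<equiv> moment_angle_complex (BS - {S}) (nested_set_complex S BS)"
abbreviation "ZN \<equiv> moment_angle_complex (B - {V}) (nested_set_complex V B)"
abbreviation "\<phi> \<equiv> induced_ma_map Q P i"
abbreviation "j \<equiv> full_subcomplex_map (BS - {S}) (B - {V})"

text \<open>The commuting square on representatives. In the chart for \<beta>, the point p has
  coordinates 1/2 on \<sigma>; by \<open>moment_scale\<close> those with trivial weights are 1
  there, and the remaining ones are unchanged.\<close>

lemma chart_correspondence:
  assumes t: "t \<in> topspace (torus (facets Q))" and x: "x \<in> Q"
    and u: "u \<in> topspace (torus (facets P))" and p: "p \<in> P"
    and eq: "chart V B (coord V B \<beta>) (u, p) =
      move_coords (B - {V}) \<sigma> (chart V B (coord V B \<beta>) (torus_inclusion Q P i t, i x))"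
  shows "chart V B (coord V B (\<lambda>_. 1)) (u, p) = j (chart S BS (cS \<beta>) (t, x))"
proof -
  let ?c = "coord V B \<beta>" and ?c1 = "coord V B (\<lambda>_. 1)" and ?W = "B - {V}"
  let ?w = "chart V B ?c (torus_inclusion Q P i t, i x)"
  have y: "?c (i x) \<in> cubes V B" by (rule face_coords_mem[OF face_coords_\<beta> i_mem(2)[OF x]])
  have y\<sigma>: "?c (i x) $ T = 0" if "T \<in> \<sigma>" for T
    using coord_on_G(1)[OF face_coords_\<beta> i_mem(1)[OF x]] that .
  have y1: "?c (i x) $ T = 1" if "T \<notin> \<sigma>" "T \<notin> BS - {S}" for T
    using coord_on_G(2)[OF face_coords_\<beta> i_mem(1)[OF x]] that .
  have n: "norm (t (nesto_facet BS T)) = 1" if "T \<in> BS - {S}" for T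
    by (rule torus_facet_norm[OF cbS t that])
  have w: "?w T = (if T \<in> \<sigma> then 0 else if T \<in> BS - {S} then t (nesto_facet BS T) * of_real (?c (i x) $ T) else 1)"
    if T: "T \<in> ?W" for T
  proof -
    have "?w T = torus_inclusion Q P i t (nesto_facet B T) * of_real (?c (i x) $ T)"
      using T by (simp add: chart_def)
    then show ?thesis unfolding torus_inclusion_eq[OF T] using y\<sigma>[of T] y1[of T] by simp
  qed
  have up: "u (nesto_facet B T) * of_real (?c p $ T) =
      (if T \<in> \<sigma> then 1 / 2 else if T \<in> BS - {S} then t (nesto_facet BS T) * of_real (?c (i x) $ T) else 1)"
    if T: "T \<in> ?W" for T
  proof -
    have "u (nesto_facet B T) * of_real (?c p $ T) = chart V B ?c (u, p) T" using T by (simp add: chart_def)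
    also have "\<dots> = (if T \<in> \<sigma> then disc_move (?w T) else ?w T)" unfolding eq using T by (simp add: move_coords_def)
    finally show ?thesis unfolding w[OF T] by (simp add: disc_move_0)
  qed
  have cp: "?c p \<in> cubes V B" "moment B \<beta> (?c p) = p" using coord_in_cubes[OF cb \<beta>_pos p] .
  have cpT: "?c p $ T = (if T \<in> \<sigma> then 1 / 2 else if T \<in> BS - {S} then ?c (i x) $ T else 1)" for T
  proof (cases "T \<in> ?W")
    case True
    have nn: "0 \<le> ?c p $ T" "0 \<le> ?c (i x) $ T" using cp(1) y by (simp_all add: cubes_def)
    have "?c p $ T = norm (u (nesto_facet B T) * of_real (?c p $ T))"
      using torus_facet_norm[OF cb u True] nn by (simp add: norm_mult)
    also have "\<dots> = (if T \<in> \<sigma> then 1 / 2 else if T \<in> BS - {S} then ?c (i x) $ T else 1)"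
      unfolding up[OF True] using n[of T] nn by (simp add: norm_mult)
    finally show ?thesis .
  next
    case False
    then have "T \<notin> \<sigma>" "T \<notin> BS - {S}" using \<sigma>_subset BS_subset(1)[of T] by blast+
    moreover have "?c p $ T = 1" using False cp(1) by (simp add: cubes_def)
    ultimately show ?thesis by (simp only: if_False)
  qed
  \<comment> \<open>The coordinates of p for trivial weights, with 1/2 doubled to 1. They are below
    1 only where those of \<open>i x\<close> are, so nestedness persists.\<close>
  define z :: "real ^ ('v set)" where "z = (\<chi> T. if T \<in> BS - {S} then ?c (i x) $ T else 1)"
  have "z $ T = (if T \<in> \<sigma> then 2 * ?c p $ T else ?c p $ T)" for T
    using \<sigma>_disjoint[of T] unfolding cpT by (auto simp: z_def)
  then have "moment B (\<lambda>_. 1) z = moment B \<beta> (?c p)"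
    using moment_scale[of z \<sigma> "?c p" B] unfolding \<beta>_def by simp
  then have zp: "moment B (\<lambda>_. 1) z = p" using cp(2) by simp
  have "z \<in> cubes V B"
  proof -
    have sub: "{T. z $ T < 1} \<subseteq> {T. ?c (i x) $ T < 1}" by (auto simp: z_def)
    have "nested B {T. ?c (i x) $ T < 1}" using y by (simp add: cubes_def)
    then have "nested B {T. z $ T < 1}" by (rule nested_subset[OF _ sub])
    moreover have "z $ T = 1" if "T \<notin> B - {V}" for T using that BS_subset(1)[of T] by (auto simp: z_def)
    moreover have "0 \<le> z $ T" "z $ T \<le> 1" for T using y by (simp_all add: z_def cubes_def)
    ultimately show ?thesis unfolding cubes_def by simp
  qed
  then have c1: "?c1 p = z" using coord_moment[OF cb, of "\<lambda>_. 1" z] zp by simp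
  show ?thesis
  proof
    fix T
    show "chart V B ?c1 (u, p) T = j (chart S BS (cS \<beta>) (t, x)) T"
    proof (cases "T \<in> ?W")
      case False
      then show ?thesis unfolding chart_def full_subcomplex_map_def prod.case restrict_def by (simp only: if_False)
    next
      case True
      have "u (nesto_facet B T) * of_real (z $ T) =
          (if T \<in> BS - {S} then t (nesto_facet BS T) * of_real (?c (i x) $ T) else 1)"
      proof (cases "T \<in> \<sigma>")
        case T: True
        \<comment> \<open>The new centre 1/2 is a positive real, so the phase is 1, as the image of
          \<open>j\<close> requires.\<close>
        then have "u (nesto_facet B T) * (1 / 2) = 1 / 2" using up[OF True] cpT[of T] by simp
        then have "u (nesto_facet B T) = 1" by simp
        moreover have "z $ T = 1" using \<sigma>_disjoint[OF T] unfolding z_def by auto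
        ultimately show ?thesis using \<sigma>_disjoint[OF T] by (simp only: if_False of_real_1 mult_1)
      next
        case False
        then have "z $ T = ?c p $ T" unfolding cpT z_def by simp
        then show ?thesis using up[OF True] False by simp
      qed
      then show ?thesis
        using True by (simp add: chart_def full_subcomplex_map_def c1 cS_def)
    qed
  qed
qed

section \<open>Inclusion of and restriction to the full subcomplex\<close>

lemma full_subcomplex_map_mem: "z \<in> topspace ZNS \<Longrightarrow> j z \<in> topspace ZN"
proof -
  assume z: "z \<in> topspace ZNS"
  then have m: "moduli S BS z \<in> cubes S BS" using topspace_moment_angle_complex[OF cbS] by blast
  have e: "moduli V B (j z) = moduli S BS z"
    using BS_subset(1) by (auto simp: moduli_def full_subcomplex_map_def vec_eq_iff)
  have "{T. moduli S BS z $ T < 1} \<subseteq> BS" by (auto simp: moduli_def)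
  \<comment> \<open>Nestedness passes from \<open>BS\<close> to B with S added as a member; S is
    dropped afterwards.\<close>
  then have "nested B ({S} \<union> {T. moduli S BS z $ T < 1})"
    using m by (intro nested_bs_restrict_Un[OF bs nested_singleton[OF bs]]) (use SB in \<open>auto simp: cubes_def\<close>)
  then have "nested B {T. moduli S BS z $ T < 1}" by (rule nested_subset) blast
  moreover have "moduli S BS z $ T = 1" if "T \<notin> B - {V}" for T
    using that BS_subset(1)[of T] unfolding moduli_def by auto
  ultimately have "moduli S BS z \<in> cubes V B" using m by (simp add: cubes_def)
  then show "j z \<in> topspace ZN"
    unfolding topspace_moment_angle_complex[OF cb] e by (simp add: full_subcomplex_map_def)
qed

lemma restrict_mem: "z \<in> topspace ZN \<Longrightarrow> restrict z (BS - {S}) \<in> topspace ZNS"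
proof -
  assume z: "z \<in> topspace ZN"
  then have m: "moduli V B z \<in> cubes V B" using topspace_moment_angle_complex[OF cb] by blast
  have e: "moduli S BS (restrict z (BS - {S})) $ T = (if T \<in> BS - {S} then moduli V B z $ T else 1)" for T
    using BS_subset(1)[of T] by (simp add: moduli_def)
  have sub: "{T. moduli S BS (restrict z (BS - {S})) $ T < 1} \<subseteq> {T. moduli V B z $ T < 1}"
    unfolding e by auto
  have "nested B {T. moduli V B z $ T < 1}" using m by (simp add: cubes_def)
  then have "nested BS {T. moduli S BS (restrict z (BS - {S})) $ T < 1}"
    by (intro nested_bs_restrict nested_subset[OF _ sub])
  then have "moduli S BS (restrict z (BS - {S})) \<in> cubes S BS"
    using m unfolding cubes_def mem_Collect_eq by (simp add: e)
  then show "restrict z (BS - {S}) \<in> topspace ZNS"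
    unfolding topspace_moment_angle_complex[OF cbS] by simp
qed

lemma continuous_map_full_subcomplex: "continuous_map ZNS ZN j"
proof (rule continuous_map_moment_angle_complex[OF full_subcomplex_map_mem])
  fix T assume "T \<in> B - {V}"
  then show "continuous_map ZNS euclidean (\<lambda>z. j z T)"
    by (cases "T \<in> BS - {S}")
      (simp_all add: full_subcomplex_map_def continuous_map_moment_angle_complex_component)
qed

lemma continuous_map_restrict: "continuous_map ZN ZNS (\<lambda>z. restrict z (BS - {S}))"
proof (rule continuous_map_moment_angle_complex[OF restrict_mem])
  fix T assume T: "T \<in> BS - {S}"
  then show "continuous_map ZN euclidean (\<lambda>z. restrict z (BS - {S}) T)"
    using continuous_map_moment_angle_complex_component[OF BS_subset(1)[OF T]] by simp
qed

lemma restrict_full_subcomplex_map: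
  assumes "z \<in> topspace ZNS"
  shows "restrict (j z) (BS - {S}) = z"
proof
  fix T
  have "z \<in> extensional (BS - {S})" using assms topspace_moment_angle_complex[OF cbS] by blast
  then show "restrict (j z) (BS - {S}) T = z T"
    using BS_subset(1)[of T] extensional_arb[of z "BS - {S}" T]
    by (cases "T \<in> BS - {S}") (simp_all add: full_subcomplex_map_def)
qed

section \<open>Assembling the square and the retraction\<close>

lemma commutative_diagram:
  obtains h1 h2 where "homeomorphic_map ZQ ZNS h1" "homeomorphic_map ZP ZN h2"
    "\<And>c. c \<in> topspace ZQ \<Longrightarrow> \<phi> c \<in> topspace ZP"
    "\<And>c. c \<in> topspace ZQ \<Longrightarrow> h2 (\<phi> c) = j (h1 c)"
proof -
  let ?D = "move_coords (B - {V}) \<sigma>"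
  \<comment> \<open>\<open>k1\<close> and \<open>kb\<close> are the homeomorphisms for trivial
    weights and for \<beta>; \<open>h1\<close> below is the left vertical map of the square.\<close>
  obtain k1 where k1: "homeomorphic_map ZP ZN k1"
    "\<And>x. x \<in> topspace (torus_times P) \<Longrightarrow> k1 (ma_rel P `` {x}) = chart V B (coord V B (\<lambda>_. 1)) x"
    using moment_angle_homeomorphism[OF cb face_coords_1] by blast
  obtain kb where kb: "homeomorphic_map ZP ZN kb"
    "\<And>x. x \<in> topspace (torus_times P) \<Longrightarrow> kb (ma_rel P `` {x}) = chart V B (coord V B \<beta>) x"
    using moment_angle_homeomorphism[OF cb face_coords_\<beta>] by blast
  obtain h1 where h1: "homeomorphic_map ZQ ZNS h1"
    "\<And>x. x \<in> topspace (torus_times Q) \<Longrightarrow> h1 (ma_rel Q `` {x}) = chart S BS (cS \<beta>) x"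
    using moment_angle_homeomorphism[OF cbS face_coords_cS[OF \<beta>_pos]] by blast
  obtain kb' where kb': "homeomorphic_maps ZP ZN kb kb'"
    using kb(1) homeomorphic_map_maps by blast
  then have kb'h: "homeomorphic_map ZN ZP kb'"
    using homeomorphic_maps_sym homeomorphic_maps_map by blast
  let ?h2 = "k1 \<circ> (kb' \<circ> (?D \<circ> kb))"
  have h2: "homeomorphic_map ZP ZN ?h2"
    by (intro homeomorphic_map_compose[of _ ZP] homeomorphic_map_compose[of _ ZN] k1 kb kb'h
        homeomorphic_map_move_coords[OF cb])
  have topP: "topspace ZP = (\<lambda>x. ma_rel P `` {x}) ` topspace (torus_times P)"
    unfolding moment_angle_manifold_def
    using quotient_imp_surjective_map[OF quotient_map_quotient_topology] by metis
  have topQ: "topspace ZQ = (\<lambda>x. ma_rel Q `` {x}) ` topspace (torus_times Q)"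
    unfolding moment_angle_manifold_def
    using quotient_imp_surjective_map[OF quotient_map_quotient_topology] by metis
  have main: "\<phi> c \<in> topspace ZP \<and> ?h2 (\<phi> c) = j (h1 c)" if c: "c \<in> topspace ZQ" for c
  proof -
    obtain t x where tx: "t \<in> topspace (torus (facets Q))" "x \<in> Q" "c = ma_rel Q `` {(t, x)}"
      using c unfolding topQ by auto
    let ?a = "(torus_inclusion Q P i t, i x)"
    have a: "?a \<in> topspace (torus_times P)" using torus_inclusion_mem[OF tx(1)] i_mem(2)[OF tx(2)] by simp
    have \<phi>c: "\<phi> c = ma_rel P `` {?a}" unfolding tx(3) by (rule induced_ma_map_class[OF tx(1,2)])
    then have mem: "\<phi> c \<in> topspace ZP" unfolding topP using a by blast
    define b where "b = kb' (?D (kb (\<phi> c)))"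
    have kbc: "kb (\<phi> c) \<in> topspace ZN" using mem homeomorphic_imp_surjective_map[OF kb(1)] by blast
    then have D: "?D (kb (\<phi> c)) \<in> topspace ZN"
      using homeomorphic_imp_surjective_map[OF homeomorphic_map_move_coords[OF cb]] by blast
    then have "b \<in> topspace ZP" unfolding b_def using homeomorphic_imp_surjective_map[OF kb'h] by blast
    then obtain u p where up: "u \<in> topspace (torus (facets P))" "p \<in> P" "b = ma_rel P `` {(u, p)}"
      unfolding topP by auto
    have "kb b = ?D (kb (\<phi> c))" using kb' D unfolding b_def homeomorphic_maps_def by blast
    then have "chart V B (coord V B \<beta>) (u, p) = ?D (chart V B (coord V B \<beta>) ?a)"
      using kb(2)[of "(u, p)"] kb(2)[OF a] up \<phi>c by simp
    then have "chart V B (coord V B (\<lambda>_. 1)) (u, p) = j (chart S BS (cS \<beta>) (t, x))"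
      by (rule chart_correspondence[OF tx(1,2) up(1,2)])
    moreover have "k1 b = chart V B (coord V B (\<lambda>_. 1)) (u, p)" using k1(2)[of "(u, p)"] up by simp
    moreover have "h1 c = chart S BS (cS \<beta>) (t, x)" using h1(2)[of "(t, x)"] tx by simp
    ultimately have "?h2 (\<phi> c) = j (h1 c)" by (simp add: b_def)
    with mem show ?thesis by simp
  qed
  show thesis by (rule that[OF h1(1) h2]) (use main in blast)+
qed

lemma diagram_and_retraction:
  shows "continuous_map ZQ ZP \<phi>"
    and "\<exists>h1 h2. homeomorphic_map ZQ ZNS h1 \<and> homeomorphic_map ZP ZN h2 \<and>
      (\<forall>z\<in>topspace ZQ. h2 (\<phi> z) = j (h1 z))"
    and "\<exists>r. continuous_map ZP ZQ r \<and> (\<forall>z\<in>topspace ZQ. r (\<phi> z) = z)"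
proof -
  obtain h1 h2 where h: "homeomorphic_map ZQ ZNS h1" "homeomorphic_map ZP ZN h2"
    and \<phi>: "\<And>c. c \<in> topspace ZQ \<Longrightarrow> \<phi> c \<in> topspace ZP"
    and comm: "\<And>c. c \<in> topspace ZQ \<Longrightarrow> h2 (\<phi> c) = j (h1 c)"
    by (rule commutative_diagram) blast
  show "\<exists>h1 h2. homeomorphic_map ZQ ZNS h1 \<and> homeomorphic_map ZP ZN h2 \<and>
      (\<forall>z\<in>topspace ZQ. h2 (\<phi> z) = j (h1 z))" using h comm by blast
  obtain g1 g2 where g: "homeomorphic_maps ZQ ZNS h1 g1" "homeomorphic_maps ZP ZN h2 g2"
    using h unfolding homeomorphic_map_maps by blast
  have c: "continuous_map ZQ ZNS h1" "continuous_map ZNS ZQ g1" "continuous_map ZP ZN h2" "continuous_map ZN ZP g2"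
    and gh: "\<And>c. c \<in> topspace ZQ \<Longrightarrow> g1 (h1 c) = c" "\<And>c. c \<in> topspace ZP \<Longrightarrow> g2 (h2 c) = c"
    using g unfolding homeomorphic_maps_def by auto
  \<comment> \<open>Continuity of the induced map is read off from the square, in which all other
    maps are known to be continuous.\<close>
  have "continuous_map ZQ ZP (g2 \<circ> (j \<circ> h1))"
    by (intro continuous_map_compose[of _ ZN] continuous_map_compose[of _ ZNS] c continuous_map_full_subcomplex)
  then show "continuous_map ZQ ZP \<phi>"
  proof (rule continuous_map_eq)
    fix z assume "z \<in> topspace ZQ"
    then show "(g2 \<circ> (j \<circ> h1)) z = \<phi> z" using comm gh(2)[OF \<phi>] by (metis comp_apply)
  qed
  let ?r = "g1 \<circ> ((\<lambda>z. restrict z (BS - {S})) \<circ> h2)"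
  have "continuous_map ZP ZQ ?r"
    by (intro continuous_map_compose[of _ ZN] continuous_map_compose[of _ ZNS] c continuous_map_restrict)
  moreover have "?r (\<phi> z) = z" if z: "z \<in> topspace ZQ" for z
  proof -
    have "h1 z \<in> topspace ZNS" using z homeomorphic_imp_surjective_map[OF h(1)] by blast
    then show ?thesis using restrict_full_subcomplex_map comm[OF z] gh(1)[OF z] by simp
  qed
  ultimately show "\<exists>r. continuous_map ZP ZQ r \<and> (\<forall>z\<in>topspace ZQ. r (\<phi> z) = z)" by blast
qed

end

theorem proposition5p7:
  fixes V S :: "'v::finite set" and B :: "'v set set"
    and v :: "real ^ 'v" and i :: "real ^ 'v \<Rightarrow> real ^ 'v"
  defines "ZP_S \<equiv> moment_angle_manifold (nestohedron (bs_restrict B S))"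
    and "ZP \<equiv> moment_angle_manifold (nestohedron B)"
    and "ZN_S \<equiv> moment_angle_complex (bs_restrict B S - {S}) (nested_set_complex S (bs_restrict B S))"
    and "ZN \<equiv> moment_angle_complex (B - {V}) (nested_set_complex V B)"
    and "\<phi> \<equiv> induced_ma_map (nestohedron (bs_restrict B S)) (nestohedron B) i"
    and "j \<equiv> full_subcomplex_map (bs_restrict B S - {S}) (B - {V})"
  assumes "connected_building_set V B"
    and "S \<in> B - {V}"
    and "v extreme_point_of nestohedron (bs_contract V B S)"
    and "face_identification V B S v i"
  shows "(continuous_map ZP_S ZP \<phi> \<and> continuous_map ZN_S ZN j \<and>
          (\<exists>h1 h2. homeomorphic_map ZP_S ZN_S h1 \<and> homeomorphic_map ZP ZN h2 \<and>
             (\<forall>z\<in>topspace ZP_S. h2 (\<phi> z) = j (h1 z)))) \<and>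
         induces_split_epi_cohomology TYPE('k::comm_ring_1) ZP_S ZP \<phi>"
proof -
  interpret product_face_embedding V S B v i
    by (rule product_face_embedding.intro) (rule assms(7-10))+
  obtain r where r: "continuous_map ZP ZP_S r" "\<And>z. z \<in> topspace ZP_S \<Longrightarrow> r (\<phi> z) = z"
    using diagram_and_retraction(3) unfolding ZP_def ZP_S_def \<phi>_def by blast
  have c: "continuous_map ZP_S ZP \<phi>"
    using diagram_and_retraction(1) unfolding ZP_def ZP_S_def \<phi>_def .
  have "continuous_map ZN_S ZN j"
    using continuous_map_full_subcomplex unfolding ZN_def ZN_S_def j_def .
  moreover have "\<exists>h1 h2. homeomorphic_map ZP_S ZN_S h1 \<and> homeomorphic_map ZP ZN h2 \<and>
      (\<forall>z\<in>topspace ZP_S. h2 (\<phi> z) = j (h1 z))"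
    using diagram_and_retraction(2) unfolding ZP_def ZP_S_def ZN_def ZN_S_def \<phi>_def j_def .
  ultimately show ?thesis
    using c induces_split_epi_cohomology_retract[OF c r] by blast
qed

end
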